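(* Let $\ast\in\{A,B\}$, and let the parameters be in the $\ast$-type regime. Set $$\sigma_A:=\frac{4\sqrt2\,\mu^3}{3\lambda},\qquad \sigma_B:=\frac{9\sqrt2\,\mu^3}{10h}.$$ For arbitrary $A^-\in\Sigma_\ast^-$ and $A^+\in\Sigma_\ast^+$, $$\inf_{\Psi\in\mathcal A(A^-,A^+)}E(\Psi)=\sigma_\ast .$$ Moreover, this infimum is attained if and only if $$\lVert A^+-A^-\rVert_F=d_\ast .$$ When $\lVert A^+-A^-\rVert_F=d_\ast$, the pair $(A^-,A^+)$ is a simultaneous $\operatorname{SU}(5)$ conjugate of $(\Phi_\ast^-,\Phi_\ast^+)$, i.e. there is $U\in\operatorname{SU}(5)$ with $A^\pm=U^\dagger\Phi_\ast^\pm U$, and a translated conjugate $z\mapsto U^\dagger\Phi_\ast(z-z_0)U$ ($z_0\in\mathbb R$) of the explicit kink $\Phi_\ast$ is a minimizer of $E$ in $\mathcal A(A^-,A^+)$. If $\lVert A^+-A^-\rVert_F>d_\ast$, the infimum is not attained.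
   Context: Let $\mathfrak h_0(5)=\{Q\in\mathbb C^{5\times5}:Q^\dagger=Q,\ \operatorname{Tr}Q=0\}$ with norm $\lVert A\rVert_F=(\operatorname{Tr}(A^2))^{1/2}$. Fix $\mu>0$. The potential is $$V(\Phi)=-\mu^2\operatorname{Tr}(\Phi^2)+h\bigl(\operatorname{Tr}(\Phi^2)\bigr)^2+\lambda\operatorname{Tr}(\Phi^4)+V_0,\qquad\Phi\in\mathfrak h_0(5).$$ $A$-type regime: $\lambda>0$, $h=-\frac{3}{20}\lambda$, $V_0=\frac{3\mu^4}{\lambda}$, $u=\frac{\sqrt5\,\mu}{5\sqrt\lambda}$. In this regime $\Phi_A^+=u\operatorname{diag}(3,3,-2,-2,-2)$, $\Phi_A^-=u\operatorname{diag}(2,2,-3,-3,2)$, and the explicit kink is $$\Phi_A(z)=\frac{\sqrt5\,\mu}{2\sqrt\lambda}\left[\operatorname{diag}(1,1,-1,-1,0)+\frac15\tanh\left(\frac{\mu z}{\sqrt2}\right)\operatorname{diag}(1,1,1,1,-4)\right].$$ $B$-type regime: $h>0$, $\lambda=-\frac{10}{9}h$, $V_0=\frac{9\mu^4}{10h}$, $v=\frac{3\mu}{10\sqrt h}$. In this regime $\Phi_B^+=v\operatorname{diag}(1,1,1,1,-4)$, $\Phi_B^-=v\operatorname{diag}(-1,-1,-1,4,-1)$, and the explicit kink is $$\Phi_B(z)=\frac{3\mu}{4\sqrt h}\left[\operatorname{diag}(0,0,0,1,-1)+\frac15\tanh\left(\frac{\mu z}{\sqrt2}\right)\operatorname{diag}(2,2,2,-3,-3)\right].$$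 For $\ast\in\{A,B\}$, $\Sigma_\ast^\pm=\{U^\dagger\Phi_\ast^\pm U:U\in\operatorname{SU}(5)\}$ and $d_\ast=\min\{\lVert P-Q\rVert_F:P\in\Sigma_\ast^-,\,Q\in\Sigma_\ast^+\}$ (one has $d_A=2\sqrt5\,u$ and $d_B=\sqrt{30}\,v$). For $A^-,A^+\in\mathfrak h_0(5)$, $\mathcal A(A^-,A^+)$ is the set of $\Psi\in H^1_{\mathrm{loc}}(\mathbb R;\mathfrak h_0(5))$ (continuous representatives) with $\Psi'\in L^2(\mathbb R;\mathfrak h_0(5))$, $V(\Psi)\in L^1(\mathbb R)$, $\lim_{z\to-\infty}\Psi(z)=A^-$ and $\lim_{z\to+\infty}\Psi(z)=A^+$. The energy is $E(\Psi)=\int_{\mathbb R}\bigl(\lVert\Psi'(z)\rVert_F^2+V(\Psi(z))\bigr)\,dz$. *)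

theory Defs
  imports "HOL-Analysis.Analysis"
begin

type_synonym mat5 = "complex^5^5"

(* Pitfall: on complex^5^5 the operations * and ^ act entrywise; every matrix product below is
   written with **. *)

definition dagger :: "mat5 \<Rightarrow> mat5" where
  "dagger Q = (\<chi> i j. cnj (Q $ j $ i))"

definition SU5 :: "mat5 set" where
  "SU5 = {U. dagger U ** U = mat 1 \<and> U ** dagger U = mat 1 \<and> det U = 1}"

definition su_conj :: "mat5 \<Rightarrow> mat5 \<Rightarrow> mat5" where
  "su_conj U Q = dagger U ** Q ** U"

definition h0 :: "mat5 set" where
  "h0 = {Q. dagger Q = Q \<and> trace Q = 0}"

(* The traces of powers used below are real for Hermitian arguments; Re only changes the type. *)

definition rtrace :: "mat5 \<Rightarrow> real" where
  "rtrace Q = Re (trace Q)"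

definition frob :: "mat5 \<Rightarrow> real" where
  "frob Q = sqrt (rtrace (Q ** Q))"

(* The literals 1, ..., 5 denote the five distinct elements of the index type 5 (with 5 = 0), and
   vector [a, b, c, d, e] takes the values a, ..., e at 1, ..., 5. *)

definition diag5 :: "real list \<Rightarrow> mat5" where
  "diag5 xs = (\<chi> i j. if i = j then complex_of_real ((vector xs :: real^5) $ i) else 0)"

definition potential :: "real \<Rightarrow> real \<Rightarrow> real \<Rightarrow> real \<Rightarrow> mat5 \<Rightarrow> real" where
  "potential \<mu> h lam V0 \<Phi> =
     - (\<mu>^2) * rtrace (\<Phi> ** \<Phi>) + h * (rtrace (\<Phi> ** \<Phi>))^2
     + lam * rtrace (\<Phi> ** \<Phi> ** \<Phi> ** \<Phi>) + V0"


datatype regime = A_type | B_type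

primrec in_regime :: "regime \<Rightarrow> real \<Rightarrow> real \<Rightarrow> real \<Rightarrow> real \<Rightarrow> bool" where
  "in_regime A_type \<mu> h lam V0 \<longleftrightarrow> lam > 0 \<and> h = - (3/20) * lam \<and> V0 = 3 * \<mu>^4 / lam"
| "in_regime B_type \<mu> h lam V0 \<longleftrightarrow> h > 0 \<and> lam = - (10/9) * h \<and> V0 = 9 * \<mu>^4 / (10 * h)"

primrec vac_scale :: "regime \<Rightarrow> real \<Rightarrow> real \<Rightarrow> real \<Rightarrow> real" where
  "vac_scale A_type \<mu> h lam = sqrt 5 * \<mu> / (5 * sqrt lam)"
| "vac_scale B_type \<mu> h lam = 3 * \<mu> / (10 * sqrt h)"

primrec vac_plus :: "regime \<Rightarrow> real \<Rightarrow> real \<Rightarrow> real \<Rightarrow> mat5" where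
  "vac_plus A_type \<mu> h lam = vac_scale A_type \<mu> h lam *\<^sub>R diag5 [3, 3, -2, -2, -2]"
| "vac_plus B_type \<mu> h lam = vac_scale B_type \<mu> h lam *\<^sub>R diag5 [1, 1, 1, 1, -4]"

primrec vac_minus :: "regime \<Rightarrow> real \<Rightarrow> real \<Rightarrow> real \<Rightarrow> mat5" where
  "vac_minus A_type \<mu> h lam = vac_scale A_type \<mu> h lam *\<^sub>R diag5 [2, 2, -3, -3, 2]"
| "vac_minus B_type \<mu> h lam = vac_scale B_type \<mu> h lam *\<^sub>R diag5 [-1, -1, -1, 4, -1]"

primrec kink :: "regime \<Rightarrow> real \<Rightarrow> real \<Rightarrow> real \<Rightarrow> real \<Rightarrow> mat5" where
  "kink A_type \<mu> h lam z = (sqrt 5 * \<mu> / (2 * sqrt lam)) *\<^sub>R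
     (diag5 [1, 1, -1, -1, 0] + (1/5 * tanh (\<mu> * z / sqrt 2)) *\<^sub>R diag5 [1, 1, 1, 1, -4])"
| "kink B_type \<mu> h lam z = (3 * \<mu> / (4 * sqrt h)) *\<^sub>R
     (diag5 [0, 0, 0, 1, -1] + (1/5 * tanh (\<mu> * z / sqrt 2)) *\<^sub>R diag5 [2, 2, 2, -3, -3])"

primrec wall_tension :: "regime \<Rightarrow> real \<Rightarrow> real \<Rightarrow> real \<Rightarrow> real" where
  "wall_tension A_type \<mu> h lam = 4 * sqrt 2 * \<mu>^3 / (3 * lam)"
| "wall_tension B_type \<mu> h lam = 9 * sqrt 2 * \<mu>^3 / (10 * h)"

definition orbit_plus :: "regime \<Rightarrow> real \<Rightarrow> real \<Rightarrow> real \<Rightarrow> mat5 set" where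
  "orbit_plus r \<mu> h lam = (\<lambda>U. su_conj U (vac_plus r \<mu> h lam)) ` SU5"

definition orbit_minus :: "regime \<Rightarrow> real \<Rightarrow> real \<Rightarrow> real \<Rightarrow> mat5 set" where
  "orbit_minus r \<mu> h lam = (\<lambda>U. su_conj U (vac_minus r \<mu> h lam)) ` SU5"

(* LEAST is the minimum (not just the infimum) of this set of reals; it exists because both orbits
   are compact. *)

definition min_dist :: "regime \<Rightarrow> real \<Rightarrow> real \<Rightarrow> real \<Rightarrow> real" where
  "min_dist r \<mu> h lam =
     (LEAST d. \<exists>P\<in>orbit_minus r \<mu> h lam. \<exists>Q\<in>orbit_plus r \<mu> h lam. d = frob (P - Q))"


definition test_functions :: "(real \<Rightarrow> real) set" where
  "test_functions =
     {\<phi>. (\<forall>n x. (deriv ^^ n) \<phi> differentiable at x) \<and> compact (closure {x. \<phi> x \<noteq> 0})}"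

definition loc_integrable :: "(real \<Rightarrow> mat5) \<Rightarrow> bool" where
  "loc_integrable f \<longleftrightarrow> (\<forall>a b. set_integrable lborel {a..b} f)"

definition has_weak_deriv :: "(real \<Rightarrow> mat5) \<Rightarrow> (real \<Rightarrow> mat5) \<Rightarrow> bool" where
  "has_weak_deriv \<Psi> g \<longleftrightarrow> loc_integrable \<Psi> \<and> loc_integrable g \<and>
     (\<forall>\<phi>\<in>test_functions.
        (LINT z|lborel. deriv \<phi> z *\<^sub>R \<Psi> z) = - (LINT z|lborel. \<phi> z *\<^sub>R g z))"

(* Weak derivatives are unique up to null sets, so energies do not depend on the choice. *)

definition weak_deriv :: "(real \<Rightarrow> mat5) \<Rightarrow> real \<Rightarrow> mat5" where
  "weak_deriv \<Psi> = (SOME g. has_weak_deriv \<Psi> g)"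

(* Square integrability on S of an h0-valued function given up to null sets; frob is the norm on h0
   only, hence the first conjunct. *)

definition L2_on :: "real set \<Rightarrow> (real \<Rightarrow> mat5) \<Rightarrow> bool" where
  "L2_on S f \<longleftrightarrow> (AE z in lborel. z \<in> S \<longrightarrow> f z \<in> h0) \<and>
     set_borel_measurable lborel S f \<and> set_integrable lborel S (\<lambda>z. (frob (f z))^2)"

definition H1_loc :: "(real \<Rightarrow> mat5) set" where
  "H1_loc = {\<Psi>. continuous_on UNIV \<Psi> \<and> (\<forall>z. \<Psi> z \<in> h0) \<and> (\<forall>a b. L2_on {a..b} \<Psi>) \<and>
     (\<exists>g. has_weak_deriv \<Psi> g \<and> (\<forall>a b. L2_on {a..b} g))}"

definition admissible :: "(mat5 \<Rightarrow> real) \<Rightarrow> mat5 \<Rightarrow> mat5 \<Rightarrow> (real \<Rightarrow> mat5) set" where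
  "admissible V Am Ap = {\<Psi>\<in>H1_loc. L2_on UNIV (weak_deriv \<Psi>) \<and>
     integrable lborel (\<lambda>z. V (\<Psi> z)) \<and> (\<Psi> \<longlongrightarrow> Am) at_bot \<and> (\<Psi> \<longlongrightarrow> Ap) at_top}"

definition energy :: "(mat5 \<Rightarrow> real) \<Rightarrow> (real \<Rightarrow> mat5) \<Rightarrow> real" where
  "energy V \<Psi> = (LINT z|lborel. (frob (weak_deriv \<Psi> z))^2 + V (\<Psi> z))"

definition minimizer :: "(mat5 \<Rightarrow> real) \<Rightarrow> mat5 \<Rightarrow> mat5 \<Rightarrow> (real \<Rightarrow> mat5) \<Rightarrow> bool" where
  "minimizer V Am Ap \<Psi> \<longleftrightarrow> \<Psi> \<in> admissible V Am Ap \<and>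
     (\<forall>X\<in>admissible V Am Ap. energy V \<Psi> \<le> energy V X)"

end

theory Submission
  imports Defs "HOL-Computational_Algebra.Polynomial" "HOL-Real_Asymp.Real_Asymp"
begin

text \<open>
  Let \<open>w(\<Phi>)\<close> be the median eigenvalue (A) or the sum of the two extreme eigenvalues (B) of \<open>\<Phi>\<close>.
  By the Hoffman--Wielandt inequality \<open>w\<close> is Lipschitz on traceless Hermitian matrices with constant
  \<open>K = sqrt (4/5)\<close> resp. \<open>K = sqrt (6/5)\<close>, and the quartic potential satisfies
  \<open>V(\<Phi>) \<ge> k\<^sup>2 (1 - (w/w\<^sub>0)\<^sup>2)\<^sup>2\<close>, with equality along the kink; \<open>w\<close> equals \<open>w\<^sub>0\<close> on one orbit and
  \<open>-w\<^sub>0\<close> on the other. Completing the square as for a scalar kink gives \<open>E \<ge> \<sigma>\<close>.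
  If \<open>E = \<sigma>\<close>, the speed of the path is almost everywhere \<open>k (1 - (w/w\<^sub>0)\<^sup>2)\<close> and \<open>w\<close> moves at the full rate
  allowed by its Lipschitz constant, so the path has length \<open>2 w\<^sub>0 / K\<close>, which is the distance of the two orbits.
  Conversely any pair of end points is joined by a kink that is conjugated by a slowly varying unitary
  matrix, at an arbitrarily small extra cost. End points at minimal distance have complementary spectral
  projections that are orthogonal to each other, hence can be diagonalized simultaneously.
\<close>

section \<open>Smooth test functions\<close>

text \<open>The choice of \<open>w\<close> is read off the kink, which runs along a straight
  segment, affine in \<open>tanh\<close>, parallel to the gradient of \<open>w\<close> on traceless
  diagonal matrices. The squares of the Lipschitz constants are the squared lengths of that
  gradient, 1 - 1/5 = 4/5 and 2 - 4/5 = 6/5. Because this segment realises the Lipschitz bound, its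
  length is also the distance of the two orbits; hence attainment and minimal distance turn out to
  be the same condition. Two obstacles shape the proof. The function \<open>w\<close> is not
  differentiable where eigenvalues cross, and a competitor has only a weak derivative, so there is
  no chain rule: all that enters is that a chord is at most the integral of the speed, and this is
  extracted from the weak derivative by explicit test functions. Moreover the optimal speed vanishes
  at the vacua, so the length of an optimal path cannot be found by dividing by it; a regularised
  quotient is used. The relative position of the end points does not influence the infimum since the
  line is infinitely long: a rotation at rate \<open>\<epsilon>\<close> has a squared velocity of
  order \<open>\<epsilon>^2\<close> on a stretch of length about
  \<open>1/\<epsilon>\<close>.\<close>

definition smooth_upto :: "nat \<Rightarrow> (real \<Rightarrow> real) \<Rightarrow> bool" where
  "smooth_upto n f \<longleftrightarrow> (\<forall>k\<le>n. \<forall>x. (deriv ^^ k) f differentiable at x)"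

lemma smooth_upto_0: "smooth_upto 0 f \<longleftrightarrow> (\<forall>x. f differentiable at x)"
  by (simp add: smooth_upto_def)

text \<open>The recursion behind all closure properties: the order drops by one while the function
  is replaced by its derivative, so each induction generalises over the function.\<close>

lemma smooth_upto_Suc:
  "smooth_upto (Suc n) f \<longleftrightarrow> (\<forall>x. f differentiable at x) \<and> smooth_upto n (deriv f)"
proof -
  have "(\<forall>k\<le>Suc n. P k) \<longleftrightarrow> P 0 \<and> (\<forall>k\<le>n. P (Suc k))" for P
    by (metis Suc_le_mono bot_nat_0.extremum not0_implies_Suc)
  then show ?thesis
    by (simp add: smooth_upto_def funpow_Suc_right del: funpow.simps)
qed

lemma smooth_upto_imp_differentiable: "smooth_upto n f \<Longrightarrow> f differentiable at x"
  by (cases n) (auto simp: smooth_upto_0 smooth_upto_Suc)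

lemma smooth_upto_SucD: "smooth_upto (Suc n) f \<Longrightarrow> smooth_upto n f"
  by (simp add: smooth_upto_def)

lemma smooth_upto_SucD': "smooth_upto (Suc n) f \<Longrightarrow> smooth_upto n (deriv f)"
  by (simp add: smooth_upto_Suc)

lemma deriv_works: "f differentiable at x \<Longrightarrow> (f has_real_derivative deriv f x) (at x)"
  for f :: "real \<Rightarrow> real"
  by (simp add: DERIV_deriv_iff_real_differentiable)

lemma smooth_upto_add:
  "smooth_upto n f \<Longrightarrow> smooth_upto n g \<Longrightarrow> smooth_upto n (\<lambda>x. f x + g x)"
proof (induction n arbitrary: f g)
  case 0
  then show ?case by (simp add: smooth_upto_0)
next
  case (Suc n)
  have "deriv (\<lambda>x. f x + g x) = (\<lambda>x. deriv f x + deriv g x)"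
    using Suc.prems by (intro ext DERIV_imp_deriv DERIV_add deriv_works) (auto simp: smooth_upto_Suc)
  then show ?case
    using Suc by (simp add: smooth_upto_Suc)
qed

lemma smooth_upto_mult:
  "smooth_upto n f \<Longrightarrow> smooth_upto n g \<Longrightarrow> smooth_upto n (\<lambda>x. f x * g x)"
proof (induction n arbitrary: f g)
  case 0
  then show ?case by (simp add: smooth_upto_0)
next
  case (Suc n)
  have "deriv (\<lambda>x. f x * g x) = (\<lambda>x. deriv f x * g x + deriv g x * f x)"
    using Suc.prems by (intro ext DERIV_imp_deriv DERIV_mult deriv_works) (auto simp: smooth_upto_Suc)
  moreover have "smooth_upto n (\<lambda>x. deriv f x * g x + deriv g x * f x)"
    using Suc.prems[THEN smooth_upto_SucD] Suc.prems[THEN smooth_upto_SucD']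
    by (intro smooth_upto_add Suc.IH)
  ultimately show ?case
    using Suc.prems by (simp add: smooth_upto_Suc)
qed

lemma smooth_upto_const: "smooth_upto n (\<lambda>x. c)"
proof (induction n arbitrary: c)
  case (Suc n)
  have "deriv (\<lambda>x::real. c) = (\<lambda>x. 0)" by (intro ext) simp
  then show ?case using Suc by (simp add: smooth_upto_Suc)
qed (simp add: smooth_upto_0)

lemma smooth_upto_affine: "smooth_upto n f \<Longrightarrow> smooth_upto n (\<lambda>x. f (c * x + d))"
proof (induction n arbitrary: f)
  case (0 f)
  have D: "((\<lambda>x. f (c * x + d)) has_real_derivative deriv f (c * x + d) * c) (at x)" for x
    by (rule DERIV_chain2[where f=f])
      (use 0 in \<open>auto intro!: derivative_eq_intros deriv_works simp: smooth_upto_0\<close>)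
  then show ?case
    using real_differentiable_def smooth_upto_0 by blast
next
  case (Suc n f)
  have D: "((\<lambda>x. f (c * x + d)) has_real_derivative deriv f (c * x + d) * c) (at x)" for x
    by (rule DERIV_chain2[where f=f])
      (use Suc.prems in \<open>auto intro!: derivative_eq_intros deriv_works simp: smooth_upto_Suc\<close>)
  then have "deriv (\<lambda>x. f (c * x + d)) = (\<lambda>x. deriv f (c * x + d) * c)"
    by (intro ext DERIV_imp_deriv)
  moreover have "smooth_upto n (\<lambda>x. deriv f (c * x + d) * c)"
    using Suc.IH[OF smooth_upto_SucD'[OF Suc.prems]] by (intro smooth_upto_mult smooth_upto_const)
  moreover have "(\<lambda>x. f (c * x + d)) differentiable at x" for x
    using D real_differentiable_def by blast
  ultimately show ?case
    by (simp add: smooth_upto_Suc)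
qed

text \<open>The flat functions: closed under differentiation, since
  \<open>d/dx (p (1/x) e\<^bsup>-1/x\<^esup>) = ((p - p') (1/x) / x^2) e\<^bsup>-1/x\<^esup>\<close>.\<close>

definition flat_fun :: "real poly \<Rightarrow> real \<Rightarrow> real" where
  "flat_fun p x = (if x > 0 then poly p (1/x) * exp (-(1/x)) else 0)"

lemma poly_div_exp_0: "((\<lambda>y::real. poly p y * exp (- y)) \<longlongrightarrow> 0) at_top"
proof -
  have "((\<lambda>y::real. \<Sum>i\<le>degree p. coeff p i * (y ^ i / exp y)) \<longlongrightarrow> (\<Sum>i\<le>degree p. coeff p i * 0)) at_top"
    by (intro tendsto_sum tendsto_mult tendsto_const tendsto_power_div_exp_0)
  moreover have "poly p y * exp (- y) = (\<Sum>i\<le>degree p. coeff p i * (y ^ i / exp y))" for y :: real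
    by (simp add: poly_altdef sum_distrib_left sum_distrib_right exp_minus field_simps)
  ultimately show ?thesis by simp
qed

lemma flat_fun_tendsto_0: "(flat_fun p \<longlongrightarrow> 0) (at 0)"
proof -
  have "((\<lambda>x. poly p (inverse x) * exp (- inverse x)) \<longlongrightarrow> 0) (at_right (0::real))"
    by (rule filterlim_compose[OF poly_div_exp_0 filterlim_inverse_at_top_right])
  then have "(flat_fun p \<longlongrightarrow> 0) (at_right 0)"
    by (rule Lim_transform_eventually[OF _ eventually_mono[OF eventually_at_right_less]])
      (simp add: flat_fun_def inverse_eq_divide)
  moreover have "(flat_fun p \<longlongrightarrow> 0) (at_left 0)"
    by (rule tendsto_eventually) (rule eventually_mono[OF eventually_at_left_real[of "-1" 0]], auto simp: flat_fun_def)
  ultimately show ?thesis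
    using filterlim_split_at by blast
qed

lemma flat_fun_has_derivative:
  "(flat_fun p has_real_derivative flat_fun ([:0,0,1:] * (p - pderiv p)) x) (at x)"
proof -
  consider "x > 0" | "x < 0" | "x = 0" by linarith
  then show ?thesis
  proof cases
    case 1
    have "((\<lambda>x. poly p (1/x) * exp (-(1/x))) has_real_derivative
       flat_fun ([:0,0,1:] * (p - pderiv p)) x) (at x)"
      using 1 by (auto intro!: derivative_eq_intros DERIV_chain2[OF poly_DERIV]
          simp: flat_fun_def field_simps power2_eq_square)
    then show ?thesis
      by (rule has_field_derivative_transform_within_open[where S="{0<..}"]) (use 1 in \<open>auto simp: flat_fun_def\<close>)
  next
    case 2
    have "((\<lambda>x. 0) has_real_derivative flat_fun ([:0,0,1:] * (p - pderiv p)) x) (at x)"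
      using 2 by (simp add: flat_fun_def)
    then show ?thesis
      by (rule has_field_derivative_transform_within_open[where S="{..<0}"]) (use 2 in \<open>auto simp: flat_fun_def\<close>)
  next
    case 3
    have "(\<lambda>h. (flat_fun p (0 + h) - flat_fun p 0) / h) = flat_fun (pCons 0 p)"
      by (auto simp: fun_eq_iff flat_fun_def)
    then have "(flat_fun p has_real_derivative 0) (at 0)"
      unfolding DERIV_def using flat_fun_tendsto_0 by metis
    then show ?thesis
      using 3 by (simp add: flat_fun_def)
  qed
qed

lemma smooth_upto_flat_fun: "smooth_upto n (flat_fun p)"
proof (induction n arbitrary: p)
  case 0
  show ?case
    using flat_fun_has_derivative real_differentiable_def smooth_upto_0 by blast
next
  case (Suc n)
  have "deriv (flat_fun p) = flat_fun ([:0,0,1:] * (p - pderiv p))"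
    by (intro ext DERIV_imp_deriv flat_fun_has_derivative)
  then show ?case
    using Suc flat_fun_has_derivative by (auto simp: smooth_upto_Suc real_differentiable_def)
qed

section \<open>A smooth transition from 0 to 1\<close>

text \<open>Normalised primitive of a bump supported in the unit interval. For negative
  \<open>x\<close> the interval \<open>{0..x}\<close> is empty, which yields the value 0 without a
  case distinction.\<close>

definition smooth_step :: "real \<Rightarrow> real" where
  "smooth_step x =
     integral {0..x} (\<lambda>t. flat_fun 1 t * flat_fun 1 (1 - t)) /
     integral {0..1} (\<lambda>t. flat_fun 1 t * flat_fun 1 (1 - t))"

context
  fixes b :: "real \<Rightarrow> real"
  defines "b \<equiv> \<lambda>t. flat_fun 1 t * flat_fun 1 (1 - t)"
begin

lemma smooth_upto_bump: "smooth_upto n b"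
  using smooth_upto_mult[OF smooth_upto_flat_fun smooth_upto_affine[OF smooth_upto_flat_fun, of n 1 "-1" 1]]
  by (simp add: b_def)

lemma continuous_on_bump: "continuous_on S b"
  by (meson continuous_on_eq_continuous_within differentiable_imp_continuous_within
      differentiable_at_withinI smooth_upto_bump smooth_upto_imp_differentiable)

lemma bump_nonneg: "b x \<ge> 0" and bump_zero: "x \<le> 0 \<or> x \<ge> 1 \<Longrightarrow> b x = 0"
  by (auto simp: b_def flat_fun_def)

lemma bump_integral_pos: "integral {0..1} b > 0"
proof -
  have int: "b integrable_on {0..1}"
    by (intro integrable_continuous_interval continuous_on_bump)
  have "integral {0..1} b \<noteq> 0"
  proof
    assume "integral {0..1} b = 0"
    then have "\<forall>x\<in>cbox 0 1. b x = 0"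
      using has_integral_0_cbox_imp_0[of 0 1 b] continuous_on_bump bump_nonneg int
      by (auto simp: has_integral_iff)
    then have "b (1/2) = 0" by simp
    then show False by (simp add: b_def flat_fun_def)
  qed
  moreover have "integral {0..1} b \<ge> 0"
    using bump_nonneg int by (intro integral_nonneg) auto
  ultimately show ?thesis by simp
qed

lemma smooth_step_eq_0: "x \<le> 0 \<Longrightarrow> smooth_step x = 0"
  by (cases "x = 0") (auto simp: smooth_step_def)

lemma smooth_step_eq_1: "x \<ge> 1 \<Longrightarrow> smooth_step x = 1"
proof -
  assume "x \<ge> 1"
  then have "integral {0..1} b + integral {1..x} b = integral {0..x} b"
    by (intro Henstock_Kurzweil_Integration.integral_combine integrable_continuous_interval continuous_on_bump) auto
  moreover have "integral {1..x} b = 0"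
    using bump_zero by (subst integral_cong[where g="\<lambda>_. 0"]) auto
  ultimately show ?thesis
    using bump_integral_pos by (simp add: smooth_step_def flip: b_def)
qed

text \<open>The integral over \<open>{0..x}\<close> has a fixed lower end at which \<open>x\<close>
  may sit or which it may precede. Near \<open>x\<close> it agrees with the integral from
  \<open>-N\<close>, because the bump vanishes on the negative axis, and for that one
  \<open>x\<close> is an interior point.\<close>

lemma smooth_step_has_derivative:
  "(smooth_step has_real_derivative b x / integral {0..1} b) (at x)"
proof -
  define N where "N = \<bar>x\<bar> + 1"
  have eq: "integral {-N..y} b = integral {0..y} b" if "-N < y" for y
  proof -
    have 0: "integral {-N..z} b = 0" if "z \<le> 0" for z
      using that bump_zero by (subst integral_cong[where g="\<lambda>_. 0"]) auto
    show ?thesis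
    proof (cases "y \<ge> 0")
      case True
      have "integral {-N..0} b + integral {0..y} b = integral {-N..y} b"
        using True by (intro Henstock_Kurzweil_Integration.integral_combine
            integrable_continuous_interval continuous_on_bump) (auto simp: N_def)
      then show ?thesis using 0[of 0] by simp
    qed (use 0[of y] in simp)
  qed
  have "((\<lambda>y. integral {-N..y} b) has_real_derivative b x) (at x within {-N..N})"
    by (rule integral_has_real_derivative) (auto intro!: continuous_on_bump simp: N_def)
  moreover have "at x within {-N..N} = at x"
    by (rule at_within_interior) (simp add: N_def, linarith)
  ultimately have "((\<lambda>y. integral {-N..y} b) has_real_derivative b x) (at x)"
    by simp
  then have "((\<lambda>y. integral {0..y} b) has_real_derivative b x) (at x)"
    by (rule has_field_derivative_transform_within_open[where S="{-N<..}"]) (auto simp: eq, simp add: N_def)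
  then show ?thesis
    unfolding smooth_step_def[abs_def] b_def[symmetric] by (rule DERIV_cdivide)
qed

end

lemma smooth_step_smooth: "smooth_upto n smooth_step"
  and smooth_step_mono: "x \<le> y \<Longrightarrow> smooth_step x \<le> smooth_step y"
proof -
  have D: "deriv smooth_step = (\<lambda>x. flat_fun 1 x * flat_fun 1 (1 - x) * (1 / integral {0..1} (\<lambda>t. flat_fun 1 t * flat_fun 1 (1 - t))))"
    using smooth_step_has_derivative by (auto intro!: DERIV_imp_deriv)
  have "smooth_upto (Suc n) smooth_step"
    unfolding smooth_upto_Suc D
    using smooth_step_has_derivative smooth_upto_bump
    by (auto intro!: smooth_upto_mult[of n "\<lambda>x. flat_fun 1 x * flat_fun 1 (1 - x)"] smooth_upto_const
      simp del: times_divide_eq_right simp: real_differentiable_def)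
  then show "smooth_upto n smooth_step"
    by (rule smooth_upto_SucD)
  show "smooth_step x \<le> smooth_step y" if "x \<le> y"
  proof (rule DERIV_nonneg_imp_nondecreasing[OF that])
    fix t
    show "\<exists>y. (smooth_step has_real_derivative y) (at t) \<and> 0 \<le> y"
      using smooth_step_has_derivative bump_nonneg bump_integral_pos
      by (intro exI conjI, assumption?) (auto intro!: divide_nonneg_pos)
  qed
qed

text \<open>As \<open>n\<close> grows, the plateaus tend to the indicator of the interval and
  their derivatives to the difference of the point masses at \<open>a\<close> and \<open>b\<close>.\<close>

definition plateau :: "real \<Rightarrow> real \<Rightarrow> nat \<Rightarrow> real \<Rightarrow> real" where
  "plateau a b n x = smooth_step (real (Suc n) * (x - a)) - smooth_step (real (Suc n) * (x - b))"

lemma smooth_step_bounds: "0 \<le> smooth_step x" "smooth_step x \<le> 1"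
  using smooth_step_mono[of "min x 0" x] smooth_step_mono[of x "max x 1"]
    smooth_step_eq_0[of "min x 0"] smooth_step_eq_1[of "max x 1"] by auto

lemma smooth_upto_plateau: "smooth_upto n (plateau a b m)"
proof -
  have "smooth_upto n (\<lambda>x. smooth_step (real (Suc m) * x + - (real (Suc m) * a))
      + (-1) * smooth_step (real (Suc m) * x + - (real (Suc m) * b)))"
    by (intro smooth_upto_add smooth_upto_mult smooth_upto_const smooth_upto_affine smooth_step_smooth)
  then show ?thesis
    by (simp add: plateau_def[abs_def] algebra_simps)
qed

lemma plateau_eq_0: "a \<le> b \<Longrightarrow> x \<le> a \<or> x \<ge> b + 1 / Suc n \<Longrightarrow> plateau a b n x = 0"
proof -
  assume "a \<le> b" and x: "x \<le> a \<or> x \<ge> b + 1 / Suc n"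
  show ?thesis
  proof (cases "x \<le> a")
    case True
    then have "real (Suc n) * (x - a) \<le> 0" "real (Suc n) * (x - b) \<le> 0"
      using \<open>a \<le> b\<close> by (auto intro!: mult_nonneg_nonpos)
    then show ?thesis by (simp only: plateau_def smooth_step_eq_0 diff_self)
  next
    case False
    then have "x - b \<ge> 1 / Suc n" using x by simp
    then have "real (Suc n) * (x - b) \<ge> 1" by (simp add: field_simps)
    moreover have "real (Suc n) * (x - a) \<ge> real (Suc n) * (x - b)" using \<open>a \<le> b\<close> by simp
    ultimately show ?thesis
      unfolding plateau_def by (metis diff_self order_trans smooth_step_eq_1)
  qed
qed

lemma abs_plateau_le: "\<bar>plateau a b n x\<bar> \<le> 1"
  using smooth_step_bounds[of "real (Suc n) * (x - a)"] smooth_step_bounds[of "real (Suc n) * (x - b)"]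
  unfolding plateau_def by linarith

lemma plateau_in_test_functions: "a \<le> b \<Longrightarrow> plateau a b n \<in> test_functions"
proof -
  assume ab: "a \<le> b"
  have "{x. plateau a b n x \<noteq> 0} \<subseteq> {a..b + 1 / Suc n}"
    using plateau_eq_0[OF ab] by (force simp: not_le intro: less_imp_le)
  then have "bounded {x. plateau a b n x \<noteq> 0}"
    by (rule bounded_subset[OF bounded_closed_interval])
  then have "compact (closure {x. plateau a b n x \<noteq> 0})"
    by (simp add: compact_closure)
  then show ?thesis
    using smooth_upto_plateau unfolding test_functions_def smooth_upto_def by blast
qed

lemma smooth_step_scaled_tendsto:
  "(\<lambda>n. smooth_step (real (Suc n) * (x - a))) \<longlonglongrightarrow> (if x \<le> a then 0 else 1)"
proof (cases "x \<le> a")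
  case True
  then have "real (Suc n) * (x - a) \<le> 0" for n
    by (auto intro!: mult_nonneg_nonpos)
  then show ?thesis
    using True by (simp only: smooth_step_eq_0) simp
next
  case False
  then have "eventually (\<lambda>n. real n \<ge> 1 / (x - a)) sequentially"
    by real_asymp
  then have "eventually (\<lambda>n. smooth_step (real (Suc n) * (x - a)) = 1) sequentially"
  proof eventually_elim
    case (elim n)
    then have "real (Suc n) * (x - a) \<ge> 1" using False by (simp add: field_simps)
    then show ?case by (rule smooth_step_eq_1)
  qed
  then show ?thesis
    using False by (simp add: tendsto_eventually)
qed

lemma plateau_tendsto: "a \<le> b \<Longrightarrow> (\<lambda>n. plateau a b n x) \<longlonglongrightarrow> indicator {a<..b} x"
  using tendsto_diff[OF smooth_step_scaled_tendsto[of x a] smooth_step_scaled_tendsto[of x b]]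
  unfolding plateau_def by (auto simp: indicator_def split: if_splits)

lemma deriv_plateau:
  "deriv (plateau a b n) x =
    real (Suc n) * (deriv smooth_step (real (Suc n) * (x - a)) - deriv smooth_step (real (Suc n) * (x - b)))"
proof -
  have 1: "(smooth_step has_real_derivative deriv smooth_step x) (at x)" for x
    using smooth_step_smooth[of 0] by (intro deriv_works) (simp add: smooth_upto_0)
  show ?thesis
    unfolding plateau_def[abs_def]
    by (rule DERIV_imp_deriv)
      (auto intro!: derivative_eq_intros DERIV_chain2[where f=smooth_step] 1 simp: algebra_simps simp del: of_nat_Suc)
qed

lemma deriv_smooth_step_eq_0: "x < 0 \<or> x > 1 \<Longrightarrow> deriv smooth_step x = 0"
  using DERIV_imp_deriv[OF smooth_step_has_derivative[of x]] bump_zero[of x] by auto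

lemma continuous_on_deriv_smooth_step: "continuous_on S (deriv smooth_step)"
  using smooth_step_smooth[of "Suc 0"]
  by (intro continuous_at_imp_continuous_on ballI differentiable_imp_continuous_within)
    (auto simp: smooth_upto_Suc smooth_upto_0)

section \<open>Weak derivatives\<close>

text \<open>The derivative of \<open>smooth_step\<close> is a mollifier: total mass 1, support in
  \<open>{0..1}\<close>. The rescaled copies concentrate at \<open>a\<close> from the right, which
  is enough for continuous \<open>\<Psi>\<close>.\<close>

lemma smooth_step_approx_identity:
  fixes \<Psi> :: "real \<Rightarrow> 'a::{euclidean_space}"
  assumes cont: "continuous_on UNIV \<Psi>"
  shows "(\<lambda>n. LINT z|lborel. (Suc n * deriv smooth_step (Suc n * (z - a))) *\<^sub>R \<Psi> z) \<longlonglongrightarrow> \<Psi> a"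
proof -
  let ?\<rho> = "deriv smooth_step"
  have c\<Psi>: "continuous_on S \<Psi>" for S using cont continuous_on_subset by blast
  have bdd: "\<exists>M. \<forall>z\<in>{a..a+1}. norm (\<Psi> z) \<le> M"
    using compact_imp_bounded[OF compact_continuous_image[OF c\<Psi> compact_Icc, of a "a+1"]]
    by (auto simp: bounded_iff)
  then obtain M where M: "norm (\<Psi> z) \<le> M" if "z \<in> {a..a+1}" for z by blast
  \<comment> \<open>Rescaling freezes the mollifier and moves \<open>n\<close> into the argument of
    \<open>\<Psi>\<close>, so that dominated convergence applies; on the support the argument stays
    in \<open>{a..a+1}\<close>.\<close>
  have eq: "(LINT z|lborel. (Suc n * ?\<rho> (Suc n * (z - a))) *\<^sub>R \<Psi> z)
      = (LINT t|lborel. ?\<rho> t *\<^sub>R \<Psi> (a + t / Suc n))" for n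
    by (subst lborel_integral_real_affine[where c="1 / Suc n" and t=a])
      (auto simp del: of_nat_Suc simp flip: integral_scaleR_right)
  have b\<Psi>: "\<Psi> \<in> borel_measurable borel"
    using cont by (rule borel_measurable_continuous_onI)
  have b\<rho>: "?\<rho> \<in> borel_measurable borel"
    by (rule borel_measurable_continuous_onI[OF continuous_on_deriv_smooth_step])
  have M0: "M \<ge> 0" using M[of a] order_trans[OF norm_ge_zero[of "\<Psi> a"]] by simp
  have int: "integrable lborel ?\<rho>"
  proof -
    have "set_integrable lborel {0..1} ?\<rho>"
      by (intro borel_integrable_atLeastAtMost' continuous_on_deriv_smooth_step)
    moreover have "(\<lambda>x. indicat_real {0..1} x *\<^sub>R ?\<rho> x) = ?\<rho>"
      by (rule ext) (use deriv_smooth_step_eq_0 in \<open>auto simp: indicator_def not_le, (meson not_le)+\<close>)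
    ultimately show ?thesis by (simp add: set_integrable_def)
  qed
  have one: "(LINT t|lborel. ?\<rho> t) = 1"
  proof -
    have "(LINT t|lborel. indicator {0..1} t *\<^sub>R ?\<rho> t) = smooth_step 1 - smooth_step 0"
      by (rule integral_FTC_Icc)
        (auto intro!: continuous_on_deriv_smooth_step DERIV_subset[OF deriv_works]
          smooth_upto_imp_differentiable[OF smooth_step_smooth[of 0]]
          simp flip: has_real_derivative_iff_has_vector_derivative)
    moreover have "(\<lambda>x. indicat_real {0..1} x *\<^sub>R ?\<rho> x) = ?\<rho>"
      by (rule ext) (use deriv_smooth_step_eq_0 in \<open>auto simp: indicator_def not_le, (meson not_le)+\<close>)
    ultimately show ?thesis using smooth_step_eq_0[of 0] smooth_step_eq_1[of 1] by simp
  qed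
  have "(\<lambda>n. LINT t|lborel. ?\<rho> t *\<^sub>R \<Psi> (a + t / Suc n)) \<longlonglongrightarrow> (LINT t|lborel. ?\<rho> t *\<^sub>R \<Psi> a)"
  proof (rule integral_dominated_convergence[where w="\<lambda>t. \<bar>?\<rho> t\<bar> * M"])
    show "AE x in lborel. (\<lambda>i. ?\<rho> x *\<^sub>R \<Psi> (a + x / Suc i)) \<longlonglongrightarrow> ?\<rho> x *\<^sub>R \<Psi> a"
    proof (rule AE_I2)
      fix x
      have "(\<lambda>i. a + x / Suc i) \<longlonglongrightarrow> a" by real_asymp
      then have "(\<lambda>i. \<Psi> (a + x / Suc i)) \<longlonglongrightarrow> \<Psi> a"
        by (rule continuous_on_tendsto_compose[OF cont]) auto
      then show "(\<lambda>i. ?\<rho> x *\<^sub>R \<Psi> (a + x / Suc i)) \<longlonglongrightarrow> ?\<rho> x *\<^sub>R \<Psi> a"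
        by (intro tendsto_intros)
    qed
    show "AE x in lborel. norm (?\<rho> x *\<^sub>R \<Psi> (a + x / Suc i)) \<le> \<bar>?\<rho> x\<bar> * M" for i
    proof (rule AE_I2)
      fix x
      show "norm (?\<rho> x *\<^sub>R \<Psi> (a + x / Suc i)) \<le> \<bar>?\<rho> x\<bar> * M"
      proof (cases "x \<in> {0..1}")
        case True
        then have "x / Suc i \<le> 1" by (simp add: field_simps)
        then show ?thesis using True by (auto intro!: mult_left_mono M)
      qed (use deriv_smooth_step_eq_0 in force)
    qed
  qed (use b\<Psi> b\<rho> int in \<open>auto simp del: of_nat_Suc\<close>)
  also have "(LINT t|lborel. ?\<rho> t *\<^sub>R \<Psi> a) = \<Psi> a"
    using int one by simp
  finally show ?thesis unfolding eq .
qed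

lemma set_integrable_cong_support:
  fixes f g :: "real \<Rightarrow> 'a::{banach, second_countable_topology}"
  assumes "set_integrable lborel A f" "\<And>x. x \<notin> A \<Longrightarrow> f x = 0"
  shows "integrable lborel f"
proof -
  have "(\<lambda>x. indicator A x *\<^sub>R f x) = f"
    using assms(2) by (force simp: indicator_def)
  then show ?thesis using assms(1) by (simp add: set_integrable_def)
qed

text \<open>The weak derivative is tested with plateaus. The side with the derivative of the plateau
  tends to point evaluations at \<open>a\<close> and \<open>b\<close>, the other side to the
  integral over the interval.\<close>

lemma weak_deriv_FTC:
  assumes wd: "has_weak_deriv \<Psi> g" and cont: "continuous_on UNIV \<Psi>" and ab: "a \<le> b"
  shows "\<Psi> b - \<Psi> a = (LINT z:{a..b}|lborel. g z)"
proof -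
  have li: "set_integrable lborel {c..d} g" for c d
    using wd by (auto simp: has_weak_deriv_def loc_integrable_def)
  have liO: "set_integrable lborel {a<..b} g"
    by (rule set_integrable_subset[OF li[of a b]]) auto
  have c\<Psi>: "continuous_on S \<Psi>" for S using cont continuous_on_subset by blast
  have gm: "(\<lambda>x. indicator {a..b+1} x *\<^sub>R g x) \<in> borel_measurable lborel"
    using li[of a "b+1"] by (auto simp: set_integrable_def)
  have pm: "plateau a b n \<in> borel_measurable lborel" for n
  proof -
    have "continuous_on UNIV (plateau a b n)"
      using smooth_upto_plateau[of 0 a b n]
      by (intro continuous_at_imp_continuous_on ballI differentiable_imp_continuous_within)
        (simp add: smooth_upto_0)
    then show ?thesis by (simp add: borel_measurable_continuous_onI)
  qed
  \<comment> \<open>The \<open>n\<close>-th plateau reaches up to \<open>b + 1 / Suc n\<close>,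
    hence at most to \<open>b + 1\<close>; the inserted indicator supplies one integrable majorant
    for all \<open>n\<close>.\<close>
  have pe: "plateau a b n z *\<^sub>R g z = plateau a b n z *\<^sub>R (indicator {a..b+1} z *\<^sub>R g z)" for n z
  proof -
    have "1 / real (Suc n) \<le> 1" by simp
    then have "plateau a b n z = 0" if "z \<notin> {a..b+1}"
    proof -
      have "z \<le> a \<or> z \<ge> b + 1" using that by auto
      then show ?thesis using \<open>1 / real (Suc n) \<le> 1\<close> by (intro plateau_eq_0[OF ab]) argo
    qed
    then show ?thesis
      by (auto simp: indicator_def)
  qed
  have "(\<lambda>n. LINT z|lborel. plateau a b n z *\<^sub>R g z) \<longlonglongrightarrow> (LINT z|lborel. indicator {a<..b} z *\<^sub>R g z)"
  proof (rule integral_dominated_convergence[where w="\<lambda>z. norm (indicator {a..b+1} z *\<^sub>R g z)"])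
    show "(\<lambda>z. indicat_real {a<..b} z *\<^sub>R g z) \<in> borel_measurable lborel"
      using liO by (auto simp: set_integrable_def)
    show "(\<lambda>z. plateau a b n z *\<^sub>R g z) \<in> borel_measurable lborel" for n
      unfolding pe by (intro borel_measurable_scaleR pm gm)
    show "integrable lborel (\<lambda>z. norm (indicat_real {a..b + 1} z *\<^sub>R g z))"
      using li[of a "b+1"] by (intro integrable_norm) (simp add: set_integrable_def)
    show "AE x in lborel. (\<lambda>n. plateau a b n x *\<^sub>R g x) \<longlonglongrightarrow> indicat_real {a<..b} x *\<^sub>R g x"
      by (intro AE_I2 tendsto_intros plateau_tendsto ab)
    show "AE x in lborel. norm (plateau a b n x *\<^sub>R g x) \<le> norm (indicat_real {a..b + 1} x *\<^sub>R g x)" for n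
      unfolding pe norm_scaleR using abs_plateau_le by (intro AE_I2 mult_left_le_one_le) auto
  qed
  moreover have "(LINT z|lborel. plateau a b n z *\<^sub>R g z) =
      (LINT z|lborel. (Suc n * deriv smooth_step (Suc n * (z - b))) *\<^sub>R \<Psi> z)
      - (LINT z|lborel. (Suc n * deriv smooth_step (Suc n * (z - a))) *\<^sub>R \<Psi> z)" for n
  proof -
    have int: "integrable lborel (\<lambda>z. (Suc n * deriv smooth_step (Suc n * (z - c))) *\<^sub>R \<Psi> z)" for c
    proof (rule set_integrable_cong_support[where A="{c..c+1/Suc n}"])
      show "set_integrable lborel {c..c + 1 / Suc n}
          (\<lambda>z. (Suc n * deriv smooth_step (Suc n * (z - c))) *\<^sub>R \<Psi> z)"
        by (intro borel_integrable_atLeastAtMost' continuous_intros c\<Psi>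
            continuous_on_compose2[OF continuous_on_deriv_smooth_step[of UNIV]]) auto
      fix x assume "x \<notin> {c..c + 1 / Suc n}"
      then have "real (Suc n) * (x - c) < 0 \<or> real (Suc n) * (x - c) > 1"
        by (auto simp: field_simps mult_less_0_iff not_le simp del: of_nat_Suc)
      then show "(Suc n * deriv smooth_step (Suc n * (x - c))) *\<^sub>R \<Psi> x = 0"
        by (simp only: deriv_smooth_step_eq_0) simp
    qed
    have "(LINT z|lborel. deriv (plateau a b n) z *\<^sub>R \<Psi> z) = - (LINT z|lborel. plateau a b n z *\<^sub>R g z)"
      using wd plateau_in_test_functions[OF ab] by (auto simp: has_weak_deriv_def)
    moreover have "(\<lambda>z. deriv (plateau a b n) z *\<^sub>R \<Psi> z) =
        (\<lambda>z. (Suc n * deriv smooth_step (Suc n * (z - a))) *\<^sub>R \<Psi> z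
            - (Suc n * deriv smooth_step (Suc n * (z - b))) *\<^sub>R \<Psi> z)"
      by (simp only: deriv_plateau flip: scaleR_left_diff_distrib right_diff_distrib)
    ultimately show ?thesis
      by (simp only: Bochner_Integration.integral_diff[OF int int]) (drule arg_cong[where f=uminus], simp only: minus_diff_eq minus_minus)
  qed
  ultimately have "\<Psi> b - \<Psi> a = (LINT z|lborel. indicator {a<..b} z *\<^sub>R g z)"
    using tendsto_diff[OF smooth_step_approx_identity[OF cont, of b] smooth_step_approx_identity[OF cont, of a]]
      LIMSEQ_unique by auto
  \<comment> \<open>Plateaus converge to the indicator of the half-open interval; the missing end
    point is a null set.\<close>
  also have "\<dots> = (LINT z:{a..b}|lborel. g z)"
    unfolding set_lebesgue_integral_def
    by (rule integral_cong_AE)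
     (use liO li[of a b] AE_lborel_singleton[of a] in
       \<open>auto simp: set_integrable_def indicator_def elim!: AE_mp\<close>)
  finally show ?thesis .
qed

lemma deriv_eq_0_outside_support:
  fixes \<phi> :: "real \<Rightarrow> real"
  assumes "x \<notin> closure {x. \<phi> x \<noteq> 0}"
  shows "deriv \<phi> x = 0"
proof -
  have "((\<lambda>x. 0) has_real_derivative 0) (at x)" by simp
  then have "(\<phi> has_real_derivative 0) (at x)"
    by (rule has_field_derivative_transform_within_open[where S="- closure {x. \<phi> x \<noteq> 0}"])
      (use assms closure_subset[of "{x. \<phi> x \<noteq> 0}"] in auto)
  then show ?thesis by (rule DERIV_imp_deriv)
qed

lemma C1_has_weak_deriv:
  assumes D: "\<And>z. (\<Psi> has_vector_derivative \<Psi>' z) (at z)" and c': "continuous_on UNIV \<Psi>'"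
  shows "has_weak_deriv \<Psi> \<Psi>'"
  unfolding has_weak_deriv_def loc_integrable_def
proof (intro conjI allI ballI)
  have c: "continuous_on UNIV \<Psi>"
    using D by (intro continuous_at_imp_continuous_on ballI has_vector_derivative_continuous)
  show "set_integrable lborel {a..b} \<Psi>" "set_integrable lborel {a..b} \<Psi>'" for a b
    using c c' by (auto intro!: borel_integrable_atLeastAtMost' intro: continuous_on_subset)
  fix \<phi> assume "\<phi> \<in> test_functions"
  then have sm: "(deriv ^^ n) \<phi> differentiable at x" and supp: "compact (closure {x. \<phi> x \<noteq> 0})" for n x
    by (auto simp: test_functions_def)
  have D\<phi>: "(\<phi> has_real_derivative deriv \<phi> x) (at x)" for x
    using sm[of 0] by (simp add: deriv_works)
  have c\<phi>: "continuous_on UNIV \<phi>"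
    using sm[of 0] by (simp add: continuous_at_imp_continuous_on differentiable_imp_continuous_within)
  have c\<phi>': "continuous_on UNIV (deriv \<phi>)"
    using sm[of 1] by (simp add: continuous_at_imp_continuous_on differentiable_imp_continuous_within)
  obtain N where N: "\<And>x. x \<in> closure {x. \<phi> x \<noteq> 0} \<Longrightarrow> \<bar>x\<bar> \<le> N"
    using compact_imp_bounded[OF supp] by (auto simp: bounded_real)
  \<comment> \<open>The added 1 places \<open>-M\<close> and \<open>M\<close> outside the support,
    so the boundary terms of the integration by parts vanish.\<close>
  define M where "M = \<bar>N\<bar> + 1"
  have out: "x \<notin> closure {x. \<phi> x \<noteq> 0}" if "x \<notin> {-M<..<M}" for x
    using N[of x] that by (force simp: M_def)
  have z: "\<phi> x = 0" "deriv \<phi> x = 0" if "x \<notin> {-M<..<M}" for x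
    using out[OF that] closure_subset[of "{x. \<phi> x \<noteq> 0}"] deriv_eq_0_outside_support[of x \<phi>] by auto
  have i1: "integrable lborel (\<lambda>z. deriv \<phi> z *\<^sub>R \<Psi> z)" and i2: "integrable lborel (\<lambda>z. \<phi> z *\<^sub>R \<Psi>' z)"
    using c c' c\<phi> c\<phi>' z
    by (auto intro!: set_integrable_cong_support[where A="{-M..M}"] borel_integrable_atLeastAtMost'
        continuous_intros intro: continuous_on_subset)
  have "(LINT z|lborel. deriv \<phi> z *\<^sub>R \<Psi> z) + (LINT z|lborel. \<phi> z *\<^sub>R \<Psi>' z)
     = (LINT z|lborel. indicator {-M..M} z *\<^sub>R (deriv \<phi> z *\<^sub>R \<Psi> z + \<phi> z *\<^sub>R \<Psi>' z))"
    unfolding Bochner_Integration.integral_add[OF i1 i2, symmetric]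
    using z by (intro Bochner_Integration.integral_cong) (auto simp: indicator_def)
  also have "\<dots> = \<phi> M *\<^sub>R \<Psi> M - \<phi> (-M) *\<^sub>R \<Psi> (-M)"
  proof (rule integral_FTC_Icc)
    show "((\<lambda>z. \<phi> z *\<^sub>R \<Psi> z) has_vector_derivative deriv \<phi> x *\<^sub>R \<Psi> x + \<phi> x *\<^sub>R \<Psi>' x) (at x within {- M..M})" for x
      using has_vector_derivative_scaleR[OF D\<phi>[of x] D[of x]]
      by (simp add: add.commute has_vector_derivative_at_within)
    show "continuous_on {- M..M} (\<lambda>x. deriv \<phi> x *\<^sub>R \<Psi> x + \<phi> x *\<^sub>R \<Psi>' x)"
      using c c' c\<phi> c\<phi>' by (intro continuous_intros) (auto intro: continuous_on_subset)
  qed (simp add: M_def)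
  also have "\<dots> = 0" by (simp add: z)
  finally show "(LINT z|lborel. deriv \<phi> z *\<^sub>R \<Psi> z) = - (LINT z|lborel. \<phi> z *\<^sub>R \<Psi>' z)"
    by (simp add: eq_neg_iff_add_eq_0)
qed


text \<open>After truncation to a bounded interval, the Borel sets over which the integral vanishes
  contain the intervals and are closed under complements and countable disjoint unions, so they are
  all Borel sets.\<close>

lemma integral_Icc_0_imp_AE_0:
  fixes f :: "real \<Rightarrow> 'a::{banach, second_countable_topology}"
  assumes int: "\<And>a b. set_integrable lborel {a..b} f"
    and zero: "\<And>a b. a \<le> b \<Longrightarrow> (LINT x:{a..b}|lborel. f x) = 0"
  shows "AE x in lborel. f x = 0"
proof -
  have main: "AE x in lborel. indicator {-N..N} x *\<^sub>R f x = 0" for N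
  proof (rule sigma_finite_measure.density_zero[OF sigma_finite_lborel])
    define F where "F = (\<lambda>x. indicator {-N..N} x *\<^sub>R f x)"
    show F: "integrable lborel (\<lambda>x. indicator {-N..N} x *\<^sub>R f x)"
      using int[of "-N" N] by (simp add: set_integrable_def)
    have iF: "set_integrable lborel A F" if "A \<in> sets lborel" for A
      using integrable_mult_indicator[OF that F] by (simp add: F_def set_integrable_def)
    have box: "(LINT x:{a..b}|lborel. F x) = 0" for a b
    proof -
      have "(LINT x:{a..b}|lborel. F x) = (LINT x:{max a (-N)..min b N}|lborel. f x)"
        unfolding set_lebesgue_integral_def F_def
        by (intro Bochner_Integration.integral_cong) (auto simp: indicator_def)
      also have "\<dots> = 0"
        by (cases "max a (-N) \<le> min b N") (use zero[of "max a (-N)" "min b N"] in \<open>auto simp: set_lebesgue_integral_def\<close>)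
      finally show ?thesis .
    qed
    \<comment> \<open>Needed for the complement case of the induction below.\<close>
    have tot: "(LINT x|lborel. F x) = 0"
      using box[of "-N" N] unfolding set_lebesgue_integral_def F_def
      by (simp flip: indicator_inter_arith scaleR_scaleR add: scaleR_scaleR)
    show "(LINT x:A|lborel. indicator {-N..N} x *\<^sub>R f x) = 0" if "A \<in> sets lborel" for A
    proof -
      have "A \<in> sets borel" using that by simp
      then have "(LINT x:A|lborel. F x) = 0"
      proof (induction rule: borel_set_induct)
        case (interval a b)
        show ?case by (rule box)
      next
        case (compl A)
        have "(LINT x:UNIV|lborel. F x) = (LINT x:A|lborel. F x) + (LINT x:-A|lborel. F x)"
          using set_integral_Un[of A "-A" lborel F] iF compl by simp
        then show ?case using tot compl by (simp add: set_lebesgue_integral_def)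
      next
        case (union A)
        then have "(LINT x:(\<Union>i. A i)|lborel. F x) = (\<Sum>i. (LINT x:(A i)|lborel. F x))"
          by (intro lebesgue_integral_countable_add iF) (auto simp: disjoint_family_on_def)
        then show ?case using union by simp
      qed (simp add: set_lebesgue_integral_def)
      then show ?thesis by (simp add: F_def)
    qed
  qed
  have "AE x in lborel. \<forall>n::nat. indicator {-real n..real n} x *\<^sub>R f x = 0"
    unfolding AE_all_countable using main by blast
  then show ?thesis
  proof eventually_elim
    case (elim x)
    obtain n :: nat where "\<bar>x\<bar> \<le> n" using real_arch_simple by blast
    then show ?case using elim[rule_format, of n] by (auto simp: indicator_def)
  qed
qed

lemma weak_deriv_unique:
  assumes "has_weak_deriv \<Psi> g" "has_weak_deriv \<Psi> g'" "continuous_on UNIV \<Psi>"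
  shows "AE z in lborel. g z = g' z"
proof -
  have li: "set_integrable lborel {a..b} g" "set_integrable lborel {a..b} g'" for a b
    using assms by (auto simp: has_weak_deriv_def loc_integrable_def)
  have "AE z in lborel. g z - g' z = 0"
  proof (rule integral_Icc_0_imp_AE_0)
    show "(LINT z:{a..b}|lborel. g z - g' z) = 0" if "a \<le> b" for a b
      using weak_deriv_FTC[OF assms(1,3) that] weak_deriv_FTC[OF assms(2,3) that] li
      by (simp add: set_integral_diff)
  qed (use li in \<open>auto intro: set_integral_diff\<close>)
  then show ?thesis by simp
qed

lemma has_weak_deriv_weak_deriv: "has_weak_deriv \<Psi> g \<Longrightarrow> has_weak_deriv \<Psi> (weak_deriv \<Psi>)"
  unfolding weak_deriv_def by (rule someI[of "has_weak_deriv \<Psi>"])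

section \<open>Hermitian and unitary matrices\<close>

lemma exhaust_5:
  fixes x :: 5
  shows "x = 1 \<or> x = 2 \<or> x = 3 \<or> x = 4 \<or> x = 5"
proof (induct x)
  case (of_int z)
  then have "z = 0 \<or> z = 1 \<or> z = 2 \<or> z = 3 \<or> z = 4" by fastforce
  then show ?case by auto
qed

lemma UNIV_5: "UNIV = {1, 2, 3, 4, 5::5}"
  using exhaust_5 by auto

lemma sum_5: "sum f (UNIV::5 set) = f 1 + f 2 + f 3 + f 4 + f 5"
  unfolding UNIV_5 by (simp add: ac_simps)

lemma vector_5 [simp]:
  "(vector [a,b,c,d,e] :: 'a::zero^5) $ 1 = a"
  "(vector [a,b,c,d,e] :: 'a::zero^5) $ 2 = b"
  "(vector [a,b,c,d,e] :: 'a::zero^5) $ 3 = c"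
  "(vector [a,b,c,d,e] :: 'a::zero^5) $ 4 = d"
  "(vector [a,b,c,d,e] :: 'a::zero^5) $ 5 = e"
  unfolding vector_def by simp_all

lemma dagger_nth [simp]: "dagger Q $ i $ j = cnj (Q $ j $ i)"
  by (simp add: dagger_def)

lemma dagger_dagger [simp]: "dagger (dagger Q) = Q"
  by (simp add: vec_eq_iff)

lemma dagger_add: "dagger (A + B) = dagger A + dagger B"
  and dagger_diff: "dagger (A - B) = dagger A - dagger B"
  and dagger_scaleR: "dagger (c *\<^sub>R A) = c *\<^sub>R dagger A"
  by (simp_all add: vec_eq_iff)

lemma dagger_mat_1 [simp]: "dagger (mat 1) = mat 1"
  by (simp add: vec_eq_iff mat_def)

lemma dagger_mult: "dagger (A ** B) = dagger B ** dagger A"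
  by (simp add: vec_eq_iff matrix_matrix_mult_def mult.commute)

lemma trace_scaleR: "trace (c *\<^sub>R A) = c *\<^sub>R trace (A :: mat5)"
  by (simp add: trace_def scaleR_sum_right)

lemma mult_scaleR_left: "(c *\<^sub>R A) ** B = c *\<^sub>R (A ** B :: mat5)"
  and mult_scaleR_right: "A ** (c *\<^sub>R B) = c *\<^sub>R (A ** B :: mat5)"
  by (simp_all add: vec_eq_iff matrix_matrix_mult_def scaleR_sum_right)

lemma matrix_mult_distribs:
  "A ** (B + C) = A ** B + A ** C" "(A + B) ** C = A ** C + B ** C"
  "A ** (B - C) = A ** B - A ** C" "(A - B) ** C = A ** C - B ** C" for A B C :: mat5
  by (simp_all add: vec_eq_iff matrix_matrix_mult_def algebra_simps sum.distrib sum_subtractf)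

text \<open>Identifies the Euclidean structure of the matrix type with the Frobenius one. The
  analysis can therefore use \<open>norm\<close> throughout, and \<open>frob\<close> appears only
  where the definitions of the problem are met.\<close>

lemma inner_matrix: "A \<bullet> B = Re (trace (dagger A ** B))" for A B :: mat5
proof -
  have "A \<bullet> B = (\<Sum>i\<in>UNIV. \<Sum>j\<in>UNIV. Re (cnj (A $ i $ j) * B $ i $ j))"
    by (simp add: inner_vec_def inner_complex_def)
  also have "\<dots> = (\<Sum>j\<in>UNIV. \<Sum>i\<in>UNIV. Re (cnj (A $ i $ j) * B $ i $ j))"
    by (rule sum.swap)
  finally show ?thesis
    by (simp add: trace_def matrix_matrix_mult_def)
qed

lemma frob_eq_norm: "dagger A = A \<Longrightarrow> frob A = norm A"
  by (simp add: frob_def rtrace_def norm_eq_sqrt_inner inner_matrix)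

lemma inner_hermitian: "dagger A = A \<Longrightarrow> A \<bullet> B = rtrace (A ** B)"
  by (simp add: inner_matrix rtrace_def)

text \<open>The matrices produced by the spectral theorem and by extending orthonormal families have
  arbitrary determinant. Determinant 1 is restored at the end by
  \<open>unitary_rescale_to_SU5\<close>.\<close>

definition unitary :: "mat5 \<Rightarrow> bool" where
  "unitary U \<longleftrightarrow> dagger U ** U = mat 1 \<and> U ** dagger U = mat 1"

lemma unitaryI: "U ** dagger U = mat 1 \<Longrightarrow> unitary U"
  by (simp add: unitary_def matrix_left_right_inverse)

lemma SU5_unitary: "U \<in> SU5 \<Longrightarrow> unitary U"
  by (simp add: SU5_def unitary_def)

lemma unitary_mat_1: "unitary (mat 1)"
  by (simp add: unitary_def)

lemma unitary_dagger: "unitary U \<Longrightarrow> unitary (dagger U)"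
  by (simp add: unitary_def)

lemma unitary_cancel:
  assumes "unitary U"
  shows "U ** (dagger U ** A) = A" "dagger U ** (U ** A) = A"
  using assms by (simp_all add: unitary_def matrix_mul_assoc)

lemma unitary_mult: "unitary U \<Longrightarrow> unitary V \<Longrightarrow> unitary (U ** V)"
  unfolding unitary_def
  by (simp add: dagger_mult unitary_cancel unitary_def flip: matrix_mul_assoc)

lemma su_conj_su_conj: "su_conj U (su_conj V A) = su_conj (V ** U) A"
  by (simp add: su_conj_def dagger_mult matrix_mul_assoc)

lemma su_conj_mult: "unitary U \<Longrightarrow> su_conj U A ** su_conj U B = su_conj U (A ** B)"
  by (simp add: su_conj_def unitary_cancel flip: matrix_mul_assoc)

lemma su_conj_mat_1 [simp]: "su_conj (mat 1) A = A"
  by (simp add: su_conj_def)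

lemma su_conj_id: "unitary U \<Longrightarrow> su_conj U (mat 1) = mat 1"
  by (simp add: su_conj_def unitary_def)

lemma su_conj_add: "su_conj U (A + B) = su_conj U A + su_conj U B"
  and su_conj_scaleR: "su_conj U (c *\<^sub>R A) = c *\<^sub>R su_conj U A"
  by (simp_all add: su_conj_def matrix_mult_distribs mult_scaleR_left mult_scaleR_right)

lemma trace_su_conj: "unitary U \<Longrightarrow> trace (su_conj U A) = trace A"
  unfolding su_conj_def by (subst trace_mul_sym) (simp add: unitary_cancel)

lemma dagger_su_conj: "dagger (su_conj U A) = su_conj U (dagger A)"
  by (simp add: su_conj_def dagger_mult matrix_mul_assoc)

lemma inner_su_conj: "unitary U \<Longrightarrow> su_conj U A \<bullet> su_conj U B = A \<bullet> B"
  by (simp add: inner_matrix dagger_su_conj su_conj_mult trace_su_conj)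

lemma norm_su_conj: "unitary U \<Longrightarrow> norm (su_conj U A) = norm A"
  by (simp add: norm_eq_sqrt_inner inner_su_conj)

lemma su_conj_in_h0: "unitary U \<Longrightarrow> A \<in> h0 \<Longrightarrow> su_conj U A \<in> h0"
  by (simp add: h0_def dagger_su_conj trace_su_conj)

lemma potential_su_conj: "unitary U \<Longrightarrow> potential \<mu> h lam V0 (su_conj U A) = potential \<mu> h lam V0 A"
  by (simp add: potential_def rtrace_def su_conj_mult trace_su_conj)

section \<open>Diagonal matrices\<close>

definition diag_mat :: "(5 \<Rightarrow> real) \<Rightarrow> mat5" where
  "diag_mat x = (\<chi> i j. if i = j then complex_of_real (x i) else 0)"

lemma diag_mat_nth: "diag_mat x $ i $ j = (if i = j then complex_of_real (x i) else 0)"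
  by (simp add: diag_mat_def)

lemma diag5_eq_diag_mat: "diag5 xs = diag_mat (\<lambda>i. vector xs $ i)"
  by (simp add: diag5_def diag_mat_def)

lemma diag_mat_mult_nth: "(diag_mat x ** A) $ i $ j = x i * A $ i $ j"
  and mult_diag_mat_nth: "(A ** diag_mat x) $ i $ j = A $ i $ j * x j"
  by (simp_all add: matrix_matrix_mult_def diag_mat_nth if_distrib if_distribR cong: if_cong)

lemma diag_mat_mult: "diag_mat x ** diag_mat y = diag_mat (\<lambda>i. x i * y i)"
  by (simp add: vec_eq_iff diag_mat_mult_nth) (simp add: diag_mat_nth)

lemma diag_mat_add: "diag_mat x + diag_mat y = diag_mat (\<lambda>i. x i + y i)"
  and diag_mat_scaleR: "c *\<^sub>R diag_mat x = diag_mat (\<lambda>i. c * x i)"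
  by (simp_all add: vec_eq_iff diag_mat_nth scaleR_conv_of_real[where 'a=complex])

lemma dagger_diag_mat [simp]: "dagger (diag_mat x) = diag_mat x"
  by (simp add: vec_eq_iff diag_mat_nth)

lemma trace_diag_mat: "trace (diag_mat x) = of_real (\<Sum>i\<in>UNIV. x i)"
  by (simp add: trace_def diag_mat_nth)

lemma rtrace_diag_mat: "rtrace (diag_mat x) = (\<Sum>i\<in>UNIV. x i)"
  by (simp add: rtrace_def trace_diag_mat)

lemma potential_diag_mat:
  "potential \<mu> h lam V0 (diag_mat x) =
    - (\<mu>^2) * (\<Sum>i\<in>UNIV. x i ^ 2) + h * (\<Sum>i\<in>UNIV. x i ^ 2)^2 + lam * (\<Sum>i\<in>UNIV. x i ^ 4) + V0"
  by (simp add: potential_def diag_mat_mult rtrace_diag_mat power2_eq_square power4_eq_xxxx mult.assoc)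

lemma diag_mat_in_h0: "diag_mat x \<in> h0 \<longleftrightarrow> (\<Sum>i\<in>UNIV. x i) = 0"
  unfolding h0_def mem_Collect_eq trace_diag_mat of_real_eq_0_iff by simp

subsection \<open>Spectral theorem\<close>

lemma inner_complex_vec: "v \<bullet> w = Re (\<Sum>i\<in>UNIV. cnj (v $ i) * w $ i)" for v w :: "complex^'n"
  by (simp add: inner_vec_def inner_complex_def)

text \<open>Complex orthogonality of \<open>v\<close> and \<open>w\<close> thus amounts to two real
  conditions, orthogonality to \<open>w\<close> and to \<open>\<i> *s w\<close>, and real subspace
  and dimension arguments become available.\<close>

lemma inner_ii: "(\<i> *s v) \<bullet> w = Im (\<Sum>i\<in>UNIV. cnj (v $ i) * w $ i)" for v w :: "complex^'n"
  by (simp add: inner_vec_def inner_complex_def algebra_simps)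

lemma inner_ii_ii: "(\<i> *s v) \<bullet> (\<i> *s w) = v \<bullet> w" for v w :: "complex^'n"
  by (simp add: inner_vec_def inner_complex_def algebra_simps)

lemma hermitian_inner:
  assumes "dagger A = A"
  shows "(A *v v) \<bullet> w = v \<bullet> (A *v w)"
proof -
  have A: "cnj (A $ i $ j) = A $ j $ i" for i j
    using assms dagger_nth by metis
  have "(\<Sum>i\<in>UNIV. cnj ((A *v v) $ i) * w $ i) = (\<Sum>i\<in>UNIV. \<Sum>j\<in>UNIV. A $ j $ i * cnj (v $ j) * w $ i)"
    by (simp add: matrix_vector_mult_def sum_distrib_right A)
  also have "\<dots> = (\<Sum>j\<in>UNIV. \<Sum>i\<in>UNIV. A $ j $ i * cnj (v $ j) * w $ i)"
    by (rule sum.swap)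
  also have "\<dots> = (\<Sum>i\<in>UNIV. cnj (v $ i) * (A *v w) $ i)"
    by (simp add: matrix_vector_mult_def sum_distrib_left mult_ac)
  finally show ?thesis
    by (simp add: inner_complex_vec)
qed

lemma quadratic_nonpos_imp_linear_0:
  fixes b c :: real
  assumes "\<And>t. b * t + c * t^2 \<le> 0"
  shows "b = 0"
proof (rule ccontr)
  assume "b \<noteq> 0"
  \<comment> \<open>Maximiser of \<open>b * t - (\<bar>c\<bar> + 1) * t^2\<close>, a lower bound for
    the given quadratic; the \<open>+ 1\<close> keeps the denominator positive.\<close>
  define t where "t = b / (2 * (\<bar>c\<bar> + 1))"
  have "b * t + c * t^2 \<ge> b * t - (\<bar>c\<bar> + 1) * t^2"
    using mult_right_mono[of "- (\<bar>c\<bar> + 1)" c "t^2"] abs_ge_minus_self[of c] by (simp add: algebra_simps)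
  also have "b * t - (\<bar>c\<bar> + 1) * t^2 = b^2 / (4 * (\<bar>c\<bar> + 1))"
    by (simp add: t_def power2_eq_square divide_simps) (simp add: algebra_simps)
  finally have "b^2 / (4 * (\<bar>c\<bar> + 1)) \<le> 0" using assms[of t] by linarith
  moreover have "b^2 / (4 * (\<bar>c\<bar> + 1)) > 0" using \<open>b \<noteq> 0\<close> by simp
  ultimately show False by linarith
qed

text \<open>The Rayleigh quotient attains its maximum on the compact unit sphere of
  \<open>K\<close>. Perturbing a maximiser \<open>v\<close> in a direction \<open>w\<close> of
  \<open>K\<close> shows that the residual \<open>A *v v - m *\<^sub>R v\<close> is orthogonal to
  \<open>w\<close>.\<close>

lemma rayleigh_maximum:
  fixes K :: "(complex^5) set"
  assumes A: "dagger A = A" and K: "subspace K" and AK: "\<And>v. v \<in> K \<Longrightarrow> A *v v \<in> K"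
    and nz: "\<exists>v\<in>K. v \<noteq> 0"
  obtains v m where "v \<in> K" "norm v = 1" "A *v v = m *\<^sub>R v" "\<And>w. w \<in> K \<Longrightarrow> (A *v w) \<bullet> w \<le> m * (w \<bullet> w)"
proof -
  have lin: "linear ((*v) A)"
    by (rule linearI)
      (simp_all add: matrix_vector_mult_def vec_eq_iff scaleR_sum_right algebra_simps sum.distrib)
  have "compact (K \<inter> sphere 0 1)"
    using closed_subspace[OF K] compact_sphere by (rule closed_Int_compact)
  moreover have "K \<inter> sphere 0 1 \<noteq> {}"
  proof -
    obtain v where "v \<in> K" "v \<noteq> 0" using nz by blast
    then have "(1 / norm v) *\<^sub>R v \<in> K \<inter> sphere 0 1"
      using K by (simp add: subspace_scale)
    then show ?thesis by blast
  qed
  moreover have "continuous_on (K \<inter> sphere 0 1) (\<lambda>v. (A *v v) \<bullet> v)"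
    using lin by (intro continuous_on_inner linear_continuous_on continuous_on_id)
      (simp add: linear_conv_bounded_linear)
  ultimately obtain v where "v \<in> K \<inter> sphere 0 1" "\<forall>w\<in>K \<inter> sphere 0 1. (A *v w) \<bullet> w \<le> (A *v v) \<bullet> v"
    using continuous_attains_sup by blast
  then have v: "v \<in> K" "norm v = 1" and max: "\<And>w. w \<in> K \<Longrightarrow> norm w = 1 \<Longrightarrow> (A *v w) \<bullet> w \<le> (A *v v) \<bullet> v"
    by auto
  define m where "m = (A *v v) \<bullet> v"
  have le: "(A *v w) \<bullet> w \<le> m * (w \<bullet> w)" if "w \<in> K" for w
  proof (cases "w = 0")
    case False
    have "(A *v ((1 / norm w) *\<^sub>R w)) \<bullet> ((1 / norm w) *\<^sub>R w) \<le> m"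
      unfolding m_def using that False by (intro max subspace_scale[OF K]) auto
    then have "((A *v w) \<bullet> w) / (norm w)^2 \<le> m"
      by (simp add: linear_scale[OF lin] power2_eq_square)
    then show ?thesis
      using False pos_divide_le_eq[of "(norm w)^2"] by (simp add: power2_norm_eq_inner)
  qed simp
  have "(A *v v - m *\<^sub>R v) \<bullet> w = 0" if "w \<in> K" for w
  proof -
    have "(2 * ((A *v v - m *\<^sub>R v) \<bullet> w)) * t + ((A *v w) \<bullet> w - m * (w \<bullet> w)) * t^2 \<le> 0" for t
    proof -
      have "(A *v (v + t *\<^sub>R w)) \<bullet> (v + t *\<^sub>R w) \<le> m * ((v + t *\<^sub>R w) \<bullet> (v + t *\<^sub>R w))"
        using v that by (intro le subspace_add[OF K] subspace_scale[OF K])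
      moreover have "(v + t *\<^sub>R w) \<bullet> (v + t *\<^sub>R w) = 1 + 2 * t * (v \<bullet> w) + t^2 * (w \<bullet> w)"
      proof -
        have "v \<bullet> v = 1" using v by (simp add: norm_eq_1)
        then show ?thesis
          by (simp add: inner_add_left inner_add_right inner_commute[of w v] power2_eq_square algebra_simps)
      qed
      moreover have "(A *v (v + t *\<^sub>R w)) \<bullet> (v + t *\<^sub>R w) = m + 2 * t * ((A *v v) \<bullet> w) + t^2 * ((A *v w) \<bullet> w)"
      proof -
        have "(A *v w) \<bullet> v = (A *v v) \<bullet> w"
          using hermitian_inner[OF A, of w v] by (simp add: inner_commute)
        then show ?thesis
          by (simp add: linear_add[OF lin] linear_scale[OF lin] inner_add_left inner_add_right m_def power2_eq_square distrib_left)
      qed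
      ultimately have "m + 2 * t * ((A *v v) \<bullet> w) + t^2 * ((A *v w) \<bullet> w) \<le> m * (1 + 2 * t * (v \<bullet> w) + t^2 * (w \<bullet> w))"
        by simp
      then show ?thesis
        by (simp add: inner_diff_left algebra_simps)
    qed
    then have "2 * ((A *v v - m *\<^sub>R v) \<bullet> w) = 0" by (rule quadratic_nonpos_imp_linear_0)
    then show ?thesis by simp
  qed
  \<comment> \<open>By invariance the residual lies in \<open>K\<close> itself, so it is orthogonal
    to itself.\<close>
  from this[of "A *v v - m *\<^sub>R v"] have "A *v v = m *\<^sub>R v"
    using v K by (simp add: subspace_diff subspace_scale AK)
  then show ?thesis using that v le by blast
qed

text \<open>Greedy construction: each new vector maximises the Rayleigh quotient on the complex
  orthogonal complement of the earlier ones, which is invariant under \<open>A\<close>. The last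
  conjunct records this maximality, from which the eigenvalues come out sorted.\<close>

lemma eigenvector_family:
  assumes A: "dagger A = A" and "n \<le> 5"
  shows "\<exists>(e :: nat \<Rightarrow> complex^5) x.
    (\<forall>i<n. A *v e i = x i *\<^sub>R e i \<and> norm (e i) = 1) \<and>
    (\<forall>i<n. \<forall>j<n. i \<noteq> j \<longrightarrow> e i \<bullet> e j = 0 \<and> e i \<bullet> (\<i> *s e j) = 0) \<and>
    (\<forall>i<n. \<forall>v. (\<forall>j<i. v \<bullet> e j = 0 \<and> v \<bullet> (\<i> *s e j) = 0) \<longrightarrow> (A *v v) \<bullet> v \<le> x i * (v \<bullet> v))"
  using \<open>n \<le> 5\<close>
proof (induction n)
  case 0
  then show ?case by auto
next
  case (Suc n)
  then have "n \<le> 5" by simp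
  from Suc.IH[OF this] obtain e :: "nat \<Rightarrow> complex^5" and x where
    fam: "\<forall>i<n. A *v e i = x i *\<^sub>R e i \<and> norm (e i) = 1"
    "\<forall>i<n. \<forall>j<n. i \<noteq> j \<longrightarrow> e i \<bullet> e j = 0 \<and> e i \<bullet> (\<i> *s e j) = 0"
    "\<forall>i<n. \<forall>v. (\<forall>j<i. v \<bullet> e j = 0 \<and> v \<bullet> (\<i> *s e j) = 0) \<longrightarrow> (A *v v) \<bullet> v \<le> x i * (v \<bullet> v)"
    by (elim exE conjE) (rule that)
  have ev: "\<And>i. i < n \<Longrightarrow> A *v e i = x i *\<^sub>R e i" "\<And>i. i < n \<Longrightarrow> norm (e i) = 1" and
    orth: "\<And>i j. i < n \<Longrightarrow> j < n \<Longrightarrow> i \<noteq> j \<Longrightarrow> e i \<bullet> e j = 0 \<and> e i \<bullet> (\<i> *s e j) = 0" and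
    mx: "\<And>i v. i < n \<Longrightarrow> (\<And>j. j < i \<Longrightarrow> v \<bullet> e j = 0 \<and> v \<bullet> (\<i> *s e j) = 0) \<Longrightarrow> (A *v v) \<bullet> v \<le> x i * (v \<bullet> v)"
    using fam by blast+
  define K where "K = {v. \<forall>j<n. v \<bullet> e j = 0 \<and> v \<bullet> (\<i> *s e j) = 0}"
  have subK: "subspace K"
    by (auto simp: K_def subspace_def inner_add_left)
  have Ai: "A *v (\<i> *s e j) = x j *\<^sub>R (\<i> *s e j)" if "j < n" for j
    using ev(1)[OF that] by (simp add: vec_eq_iff vector_scalar_commute)
  have AK: "A *v v \<in> K" if "v \<in> K" for v
    using that by (auto simp: K_def hermitian_inner[OF A] ev Ai)
  \<comment> \<open>Complex orthogonality to \<open>n\<close> vectors is real orthogonality to at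
    most \<open>2 * n\<close>. Since \<open>n \<le> 4\<close> here and the real dimension is 10, a
    nonzero vector remains.\<close>
  define S where "S = e ` {..<n} \<union> (\<lambda>j. \<i> *s e j) ` {..<n}"
  have "dim S \<le> card S" by (rule dim_le_card) (auto simp: S_def span_superset)
  also have "\<dots> \<le> n + n"
    unfolding S_def by (intro order_trans[OF card_Un_le] add_mono order_trans[OF card_image_le]) auto
  also have "\<dots> < DIM(complex^5)" using Suc.prems by simp
  finally obtain v where "v \<noteq> 0" "\<And>y. y \<in> span S \<Longrightarrow> orthogonal v y"
    using orthogonal_to_subspace_exists by blast
  then have "v \<in> K"
    by (auto simp: K_def orthogonal_def S_def span_base)
  then obtain f m where f: "f \<in> K" "norm f = 1" "A *v f = m *\<^sub>R f" "\<And>w. w \<in> K \<Longrightarrow> (A *v w) \<bullet> w \<le> m * (w \<bullet> w)"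
    using rayleigh_maximum[OF A subK AK] \<open>v \<noteq> 0\<close> by metis
  have f0: "f \<bullet> e j = 0" "e j \<bullet> f = 0" "f \<bullet> (\<i> *s e j) = 0" "e j \<bullet> (\<i> *s f) = 0" if "j < n" for j
  proof -
    show 1: "f \<bullet> e j = 0" "f \<bullet> (\<i> *s e j) = 0" using f that by (auto simp: K_def)
    show "e j \<bullet> f = 0" using 1 by (simp add: inner_commute)
    have "(\<i> *s (\<i> *s e j)) \<bullet> (\<i> *s f) = 0" using 1 unfolding inner_ii_ii by (simp add: inner_commute)
    moreover have "\<i> *s (\<i> *s e j) = - e j" by (simp add: vec_eq_iff)
    ultimately show "e j \<bullet> (\<i> *s f) = 0" by simp
  qed
  show ?case
    by (rule exI[of _ "e(n := f)"], rule exI[of _ "x(n := m)"])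
      (use f f0 ev orth mx in \<open>auto simp: less_Suc_eq K_def\<close>)
qed

text \<open>Written as an explicit chain because the literal \<open>5\<close> denotes the element
  \<open>0\<close> of the index type, so the order of the type is not the order 1, 2, 3, 4,
  5.\<close>

definition decreasing5 :: "(5 \<Rightarrow> real) \<Rightarrow> bool" where
  "decreasing5 x \<longleftrightarrow> x 1 \<ge> x 2 \<and> x 2 \<ge> x 3 \<and> x 3 \<ge> x 4 \<and> x 4 \<ge> x 5"

theorem spectral:
  assumes A: "dagger A = A"
  shows "\<exists>U x. unitary U \<and> A = su_conj U (diag_mat x) \<and> decreasing5 x"
proof -
  from eigenvector_family[OF A order.refl] obtain e :: "nat \<Rightarrow> complex^5" and x where
    fam: "\<forall>i<5. A *v e i = x i *\<^sub>R e i \<and> norm (e i) = 1"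
    "\<forall>i<5. \<forall>j<5. i \<noteq> j \<longrightarrow> e i \<bullet> e j = 0 \<and> e i \<bullet> (\<i> *s e j) = 0"
    "\<forall>i<5. \<forall>v. (\<forall>j<i. v \<bullet> e j = 0 \<and> v \<bullet> (\<i> *s e j) = 0) \<longrightarrow> (A *v v) \<bullet> v \<le> x i * (v \<bullet> v)"
    by (elim exE conjE) (rule that)
  have ev: "\<And>i. i < 5 \<Longrightarrow> A *v e i = x i *\<^sub>R e i" "\<And>i. i < 5 \<Longrightarrow> norm (e i) = 1" and
    orth: "\<And>i j. i < 5 \<Longrightarrow> j < 5 \<Longrightarrow> i \<noteq> j \<Longrightarrow> e i \<bullet> e j = 0 \<and> e i \<bullet> (\<i> *s e j) = 0" and
    mx: "\<And>i v. i < 5 \<Longrightarrow> (\<And>j. j < i \<Longrightarrow> v \<bullet> e j = 0 \<and> v \<bullet> (\<i> *s e j) = 0) \<Longrightarrow> (A *v v) \<bullet> v \<le> x i * (v \<bullet> v)"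
    using fam by blast+
  have sorted: "x j \<le> x i" if "i < j" "j < 5" for i j
    using mx[of i "e j"] orth[of j] ev[of j] that by (auto simp: norm_eq_1)
  define pos :: "5 \<Rightarrow> nat" where
    "pos r = (if r = 1 then 0 else if r = 2 then 1 else if r = 3 then 2 else if r = 4 then 3 else 4)" for r
  have pos5: "pos r < 5" and pos_inj: "pos r = pos s \<longleftrightarrow> r = s" for r s
    using exhaust_5[of r] exhaust_5[of s] by (auto simp: pos_def)
  have h: "(\<Sum>c\<in>UNIV. cnj (e (pos r) $ c) * e (pos s) $ c) = (if r = s then 1 else 0)" for r s
  proof (rule complex_eqI)
    show "Re (\<Sum>c\<in>UNIV. cnj (e (pos r) $ c) * e (pos s) $ c) = Re (if r = s then 1 else 0)"
      using orth[OF pos5 pos5, of r s] ev(2)[OF pos5, of r] pos_inj[of r s]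
      unfolding inner_complex_vec[symmetric] by (auto simp: norm_eq_1)
    have "Im (\<Sum>c\<in>UNIV. cnj (e (pos r) $ c) * e (pos r) $ c) = 0"
      by (simp add: algebra_simps)
    moreover have "(\<i> *s e (pos r)) \<bullet> e (pos s) = 0" if "r \<noteq> s"
      using orth[OF pos5 pos5, of s r] pos_inj[of r s] that by (simp add: inner_commute)
    ultimately show "Im (\<Sum>c\<in>UNIV. cnj (e (pos r) $ c) * e (pos s) $ c) = Im (if r = s then 1 else 0)"
      by (cases "r = s") (auto simp: inner_ii)
  qed
  \<comment> \<open>\<open>su_conj\<close> carries the adjoint on the left, so the eigenvectors have
    to be the columns of \<open>dagger U\<close>, i.e. the conjugated rows of
    \<open>U\<close>.\<close>
  define U :: mat5 where "U = (\<chi> r c. cnj (e (pos r) $ c))"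
  have U: "unitary U"
    by (rule unitaryI) (simp add: vec_eq_iff matrix_matrix_mult_def U_def h mat_def)
  have "A ** dagger U = dagger U ** diag_mat (\<lambda>r. x (pos r))"
  proof -
    have "(A ** dagger U) $ c $ r = (A *v e (pos r)) $ c" for c r
      by (simp add: matrix_matrix_mult_def matrix_vector_mult_def U_def)
    then show ?thesis
      by (simp add: vec_eq_iff mult_diag_mat_nth ev pos5 U_def scaleR_conv_of_real[where 'a=complex] mult.commute)
  qed
  then have "A = su_conj U (diag_mat (\<lambda>r. x (pos r)))"
    using U unfolding su_conj_def unitary_def by (metis matrix_mul_assoc matrix_mul_rid)
  moreover have "decreasing5 (\<lambda>r. x (pos r))"
    using sorted by (simp add: decreasing5_def pos_def)
  ultimately show ?thesis using U by blast
qed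


subsection \<open>Perturbation of eigenvalues\<close>

text \<open>Compare with the threshold \<open>y k\<close>, where \<open>k\<close> is the total
  weight: weight missing above the threshold and weight placed below it can both only lower the sum.
  The losses are the products in \<open>pos\<close> and \<open>neg\<close>.\<close>

lemma weighted_sum_le_top:
  fixes c y :: "5 \<Rightarrow> real"
  assumes y: "decreasing5 y" and c: "\<And>j. 0 \<le> c j" "\<And>j. c j \<le> 1"
  shows "(\<Sum>j\<in>UNIV. c j) = 1 \<Longrightarrow> (\<Sum>j\<in>UNIV. c j * y j) \<le> y 1"
    and "(\<Sum>j\<in>UNIV. c j) = 2 \<Longrightarrow> (\<Sum>j\<in>UNIV. c j * y j) \<le> y 1 + y 2"
    and "(\<Sum>j\<in>UNIV. c j) = 3 \<Longrightarrow> (\<Sum>j\<in>UNIV. c j * y j) \<le> y 1 + y 2 + y 3"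
    and "(\<Sum>j\<in>UNIV. c j) = 4 \<Longrightarrow> (\<Sum>j\<in>UNIV. c j * y j) \<le> y 1 + y 2 + y 3 + y 4"
proof -
  have pos: "0 \<le> (1 - c i) * (y i - t)" if "y i \<ge> t" for i t
    using c(2)[of i] that by simp
  have neg: "0 \<le> c i * (t - y i)" if "t \<ge> y i" for i t
    using c(1)[of i] that by simp
  note ord = y[unfolded decreasing5_def]
  show "(\<Sum>j\<in>UNIV. c j * y j) \<le> y 1" if "(\<Sum>j\<in>UNIV. c j) = 1"
  proof -
    have *: "c 1 = 1 - c 2 - c 3 - c 4 - c 5" using that by (simp add: sum_5)
    show ?thesis
      using neg[of 2 "y 1"] neg[of 3 "y 1"] neg[of 4 "y 1"] neg[of 5 "y 1"] ord
      by (simp add: sum_5 * algebra_simps)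
  qed
  show "(\<Sum>j\<in>UNIV. c j * y j) \<le> y 1 + y 2" if "(\<Sum>j\<in>UNIV. c j) = 2"
  proof -
    have *: "c 2 = 2 - c 1 - c 3 - c 4 - c 5" using that by (simp add: sum_5)
    show ?thesis
      using pos[of "y 2" 1] neg[of 3 "y 2"] neg[of 4 "y 2"] neg[of 5 "y 2"] ord
      by (simp add: sum_5 * algebra_simps)
  qed
  show "(\<Sum>j\<in>UNIV. c j * y j) \<le> y 1 + y 2 + y 3" if "(\<Sum>j\<in>UNIV. c j) = 3"
  proof -
    have *: "c 3 = 3 - c 1 - c 2 - c 4 - c 5" using that by (simp add: sum_5)
    show ?thesis
      using pos[of "y 3" 1] pos[of "y 3" 2] neg[of 4 "y 3"] neg[of 5 "y 3"] ord
      by (simp add: sum_5 * algebra_simps)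
  qed
  show "(\<Sum>j\<in>UNIV. c j * y j) \<le> y 1 + y 2 + y 3 + y 4" if "(\<Sum>j\<in>UNIV. c j) = 4"
  proof -
    have *: "c 4 = 4 - c 1 - c 2 - c 3 - c 5" using that by (simp add: sum_5)
    show ?thesis
      using pos[of "y 4" 1] pos[of "y 4" 2] pos[of "y 4" 3] neg[of 5 "y 4"] ord
      by (simp add: sum_5 * algebra_simps)
  qed
qed

text \<open>Averaging with a doubly stochastic matrix makes every initial partial sum of
  \<open>y\<close> at most as large and preserves the total. Summation by parts against the
  decreasing sequence \<open>x\<close> turns this majorization into the claim.\<close>

lemma doubly_stochastic_rearrangement:
  fixes p :: "5 \<Rightarrow> 5 \<Rightarrow> real"
  assumes x: "decreasing5 x" and y: "decreasing5 y"
    and p0: "\<And>i j. 0 \<le> p i j" and rows: "\<And>i. (\<Sum>j\<in>UNIV. p i j) = 1" and cols: "\<And>j. (\<Sum>i\<in>UNIV. p i j) = 1"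
  shows "(\<Sum>i\<in>UNIV. x i * (\<Sum>j\<in>UNIV. p i j * y j)) \<le> (\<Sum>i\<in>UNIV. x i * y i)"
proof -
  define q where "q i = (\<Sum>j\<in>UNIV. p i j * y j)" for i
  have part: "(\<Sum>i\<in>I. q i) = (\<Sum>j\<in>UNIV. (\<Sum>i\<in>I. p i j) * y j)" for I
    unfolding q_def sum_distrib_right by (rule sum.swap)
  have sub: "0 \<le> (\<Sum>i\<in>I. p i j)" "(\<Sum>i\<in>I. p i j) \<le> 1" for I j
    using sum_mono2[of UNIV I "\<lambda>i. p i j"] cols[of j] p0 by (auto intro: sum_nonneg)
  have tot: "(\<Sum>j\<in>UNIV. \<Sum>i\<in>I. p i j) = card I" for I
    by (subst sum.swap) (simp add: rows)
  have d1: "q 1 \<le> y 1"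
    using part[of "{1}"] weighted_sum_le_top(1)[OF y, of "\<lambda>j. \<Sum>i\<in>{1}. p i j", OF sub] tot[of "{1}"] by simp
  have d2: "q 1 + q 2 \<le> y 1 + y 2"
    using part[of "{1,2}"] weighted_sum_le_top(2)[OF y, of "\<lambda>j. \<Sum>i\<in>{1,2}. p i j", OF sub] tot[of "{1,2}"] by simp
  have d3: "q 1 + q 2 + q 3 \<le> y 1 + y 2 + y 3"
    using part[of "{1,2,3}"] weighted_sum_le_top(3)[OF y, of "\<lambda>j. \<Sum>i\<in>{1,2,3}. p i j", OF sub] tot[of "{1,2,3}"]
    by (simp add: add.assoc)
  have d4: "q 1 + q 2 + q 3 + q 4 \<le> y 1 + y 2 + y 3 + y 4"
    using part[of "{1,2,3,4}"] weighted_sum_le_top(4)[OF y, of "\<lambda>j. \<Sum>i\<in>{1,2,3,4}. p i j", OF sub] tot[of "{1,2,3,4}"]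
    by (simp add: add.assoc)
  have d5: "q 1 + q 2 + q 3 + q 4 + q 5 = y 1 + y 2 + y 3 + y 4 + y 5"
    using part[of UNIV] cols by (simp add: sum_5)
  define d where "d i = y i - q i" for i
  \<comment> \<open>Abel summation: the gaps of \<open>x\<close> are paired with the partial sums of
    \<open>d\<close>. The term with \<open>x 5\<close>, whose sign is unknown, drops out because
    \<open>d\<close> has total 0.\<close>
  have "0 \<le> (x 1 - x 2) * d 1 + (x 2 - x 3) * (d 1 + d 2) + (x 3 - x 4) * (d 1 + d 2 + d 3)
     + (x 4 - x 5) * (d 1 + d 2 + d 3 + d 4)"
  proof -
    have "0 \<le> d 1" "0 \<le> d 1 + d 2" "0 \<le> d 1 + d 2 + d 3" "0 \<le> d 1 + d 2 + d 3 + d 4"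
      "0 \<le> x 1 - x 2" "0 \<le> x 2 - x 3" "0 \<le> x 3 - x 4" "0 \<le> x 4 - x 5"
      using x d1 d2 d3 d4 by (auto simp: decreasing5_def d_def)
    then have "0 \<le> (x 1 - x 2) * d 1" "0 \<le> (x 2 - x 3) * (d 1 + d 2)" "0 \<le> (x 3 - x 4) * (d 1 + d 2 + d 3)"
      "0 \<le> (x 4 - x 5) * (d 1 + d 2 + d 3 + d 4)"
      by (simp_all only: mult_nonneg_nonneg)
    then show ?thesis by linarith
  qed
  also have "\<dots> = (\<Sum>i\<in>UNIV. x i * d i) - x 5 * (d 1 + d 2 + d 3 + d 4 + d 5)"
    by (simp add: sum_5 algebra_simps)
  also have "d 1 + d 2 + d 3 + d 4 + d 5 = 0"
    using d5 by (simp add: d_def)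
  finally show ?thesis
    by (simp add: d_def right_diff_distrib sum_subtractf q_def)
qed

text \<open>The relative position of the two eigenbases enters only through the squared moduli of
  the overlap matrix \<open>V ** dagger U\<close>, which form a doubly stochastic matrix.\<close>

lemma inner_su_conj_diag:
  assumes U: "unitary U" and V: "unitary V"
  shows "su_conj U (diag_mat x) \<bullet> su_conj V (diag_mat y) =
    (\<Sum>i\<in>UNIV. x i * (\<Sum>j\<in>UNIV. (cmod ((V ** dagger U) $ j $ i))^2 * y j))"
proof -
  define W where "W = V ** dagger U"
  have "su_conj U (diag_mat x) \<bullet> su_conj V (diag_mat y) = diag_mat x \<bullet> su_conj W (diag_mat y)"
    using inner_su_conj[OF unitary_dagger[OF U], of "su_conj U (diag_mat x)" "su_conj V (diag_mat y)"] U
    by (simp add: su_conj_su_conj W_def unitary_def)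
  also have "\<dots> = (\<Sum>i\<in>UNIV. x i * (\<Sum>j\<in>UNIV. (cmod (W $ j $ i))^2 * y j))"
    by (simp add: inner_hermitian rtrace_def trace_def diag_mat_mult_nth su_conj_def)
      (simp add: matrix_matrix_mult_def diag_mat_nth if_distrib if_distribR cmod_power2 cong: if_cong,
        simp add: power2_eq_square algebra_simps)
  finally show ?thesis by (simp only: W_def)
qed

lemma doubly_stochastic_overlap:
  assumes U: "unitary U" and V: "unitary V"
  shows "(\<Sum>j\<in>UNIV. (cmod ((V ** dagger U) $ j $ i))^2) = 1"
    and "(\<Sum>j\<in>UNIV. (cmod ((V ** dagger U) $ i $ j))^2) = 1"
proof -
  define W where "W = V ** dagger U"
  have "unitary W" using U V by (simp add: W_def unitary_mult unitary_dagger)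
  then have "(W ** dagger W) $ i $ i = 1" "(dagger W ** W) $ i $ i = 1" for i
    by (simp_all add: unitary_def mat_def)
  then have "Re ((W ** dagger W) $ i $ i) = 1" "Re ((dagger W ** W) $ i $ i) = 1" for i
    by simp_all
  then have "(\<Sum>j\<in>UNIV. (cmod (W $ j $ i))^2) = 1" "(\<Sum>j\<in>UNIV. (cmod (W $ i $ j))^2) = 1"
    by (simp_all add: matrix_matrix_mult_def cmod_power2 flip: power2_eq_square)
  then show "(\<Sum>j\<in>UNIV. (cmod ((V ** dagger U) $ j $ i))^2) = 1"
    "(\<Sum>j\<in>UNIV. (cmod ((V ** dagger U) $ i $ j))^2) = 1"
    by (simp_all only: W_def)
qed

text \<open>The norms of the two matrices depend only on their spectra, so after expanding the
  square only the inner product remains, and it is bounded by the rearrangement inequality.\<close>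

theorem hoffman_wielandt:
  assumes U: "unitary U" and V: "unitary V" and x: "decreasing5 x" and y: "decreasing5 y"
  shows "(\<Sum>i\<in>UNIV. (x i - y i)^2) \<le> (norm (su_conj U (diag_mat x) - su_conj V (diag_mat y)))^2"
proof -
  have nd: "diag_mat z \<bullet> diag_mat z = (\<Sum>i\<in>UNIV. z i ^ 2)" for z
    by (simp add: inner_hermitian diag_mat_mult rtrace_diag_mat power2_eq_square)
  have "su_conj U (diag_mat x) \<bullet> su_conj V (diag_mat y) \<le> (\<Sum>i\<in>UNIV. x i * y i)"
    unfolding inner_su_conj_diag[OF U V]
    by (rule doubly_stochastic_rearrangement[OF x y])
      (simp_all add: doubly_stochastic_overlap[OF U V])
  moreover have "(norm (X - Y))^2 = X \<bullet> X + Y \<bullet> Y - 2 * (X \<bullet> Y)" for X Y :: mat5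
    by (simp add: power2_norm_eq_inner inner_diff_left inner_diff_right inner_commute)
  moreover have "(\<Sum>i\<in>UNIV. (x i - y i)^2) = (\<Sum>i\<in>UNIV. x i ^ 2) + (\<Sum>i\<in>UNIV. y i ^ 2) - 2 * (\<Sum>i\<in>UNIV. x i * y i)"
    by (simp add: power2_diff sum.distrib sum_subtractf sum_distrib_left mult.assoc)
  ultimately show ?thesis
    by (simp add: inner_su_conj U V nd)
qed

definition eigenvalues :: "mat5 \<Rightarrow> 5 \<Rightarrow> real" where
  "eigenvalues A = (SOME x. decreasing5 x \<and> (\<exists>U. unitary U \<and> A = su_conj U (diag_mat x)))"

lemma eigenvalues:
  assumes "dagger A = A"
  shows "decreasing5 (eigenvalues A)" "\<exists>U. unitary U \<and> A = su_conj U (diag_mat (eigenvalues A))"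
proof -
  have "\<exists>x. decreasing5 x \<and> (\<exists>U. unitary U \<and> A = su_conj U (diag_mat x))"
    using spectral[OF assms] by blast
  from someI_ex[OF this] show "decreasing5 (eigenvalues A)" "\<exists>U. unitary U \<and> A = su_conj U (diag_mat (eigenvalues A))"
    unfolding eigenvalues_def by auto
qed

lemma eigenvalues_lipschitz:
  assumes "dagger A = A" "dagger B = B"
  shows "(\<Sum>i\<in>UNIV. (eigenvalues A i - eigenvalues B i)^2) \<le> (norm (A - B))^2"
proof -
  obtain U V where "unitary U" "unitary V" "A = su_conj U (diag_mat (eigenvalues A))"
    "B = su_conj V (diag_mat (eigenvalues B))"
    using eigenvalues(2) assms by blast
  then show ?thesis
    using hoffman_wielandt[of U V "eigenvalues A" "eigenvalues B"] eigenvalues(1) assms by simp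
qed

text \<open>Hoffman--Wielandt at distance zero shows that the choice in \<open>eigenvalues\<close>
  is determined.\<close>

lemma eigenvalues_unique:
  assumes "unitary U" "decreasing5 x"
  shows "eigenvalues (su_conj U (diag_mat x)) = x"
proof -
  let ?A = "su_conj U (diag_mat x)"
  have "dagger ?A = ?A" by (simp add: dagger_su_conj)
  from eigenvalues[OF this] obtain V where "unitary V" "?A = su_conj V (diag_mat (eigenvalues ?A))"
    "decreasing5 (eigenvalues ?A)" by blast
  then have "(\<Sum>i\<in>UNIV. (eigenvalues ?A i - x i)^2) \<le> 0"
    using hoffman_wielandt[of V U "eigenvalues ?A" x] assms by simp
  moreover have "0 \<le> (\<Sum>i\<in>UNIV. (eigenvalues ?A i - x i)^2)"
    by (intro sum_nonneg) simp
  ultimately have "(\<Sum>i\<in>UNIV. (eigenvalues ?A i - x i)^2) = 0"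
    by linarith
  then show ?thesis
    by (auto simp: sum_nonneg_eq_0_iff fun_eq_iff)
qed

text \<open>Permuting the rows of \<open>U\<close> together with the diagonal entries changes
  nothing. This serves the vacua of the minus orbit, whose entries are not listed in decreasing
  order.\<close>

lemma eigenvalues_permuted:
  assumes U: "unitary U" and p: "bij p" and x: "decreasing5 (\<lambda>i. x (p i))"
  shows "eigenvalues (su_conj U (diag_mat x)) = (\<lambda>i. x (p i))"
proof -
  define V :: mat5 where "V = (\<chi> i j. U $ p i $ j)"
  have inj: "p i = p j \<longleftrightarrow> i = j" for i j using p by (simp add: bij_is_inj inj_eq)
  have "(U ** dagger U) $ p i $ p j = (mat 1 :: mat5) $ p i $ p j" for i j
    using U by (simp add: unitary_def)
  then have "unitary V"
    by (intro unitaryI) (simp add: vec_eq_iff matrix_matrix_mult_def V_def mat_def inj)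
  moreover have "su_conj U (diag_mat x) = su_conj V (diag_mat (\<lambda>i. x (p i)))"
  proof -
    have "(\<Sum>k\<in>UNIV. cnj (U $ k $ i) * (x k * U $ k $ j)) = (\<Sum>k\<in>UNIV. cnj (U $ p k $ i) * (x (p k) * U $ p k $ j))" for i j
      by (rule sum.reindex_bij_betw[OF p, symmetric])
    then show ?thesis
      by (simp add: vec_eq_iff su_conj_def V_def diag_mat_mult_nth flip: matrix_mul_assoc)
        (simp add: matrix_matrix_mult_def diag_mat_nth V_def if_distrib if_distribR cong: if_cong)
  qed
  ultimately show ?thesis using eigenvalues_unique x by simp
qed

section \<open>Calibrating the potential\<close>

text \<open>Here \<open>t\<close> is minus a quarter of the median eigenvalue, the upper pair of eigenvalues is
  \<open>t + a \<plusminus> d\<close> and the lower pair is \<open>t - a \<plusminus> e\<close>.\<close>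

lemma median_bound_parametrized:
  fixes a d e t q :: real
  assumes "\<bar>5 * t\<bar> \<le> a"
  defines "T2 \<equiv> (t+a+d)^2 + (t+a-d)^2 + (4*t)^2 + (t-a+e)^2 + (t-a-e)^2"
    and "T4 \<equiv> (t+a+d)^4 + (t+a-d)^4 + (4*t)^4 + (t-a+e)^4 + (t-a-e)^4"
  shows "(q - 5/4 * (4*t)^2)^2 / 2 \<le> T4 - 3/20 * T2^2 - q * T2 + 3 * q^2"
proof -
  define S R where "S = d^2 + e^2" and "R = d^2 - e^2"
  \<comment> \<open>The right-hand side vanishes for \<open>d = e = 0\<close> and
    \<open>a^2 = 5/4 * q\<close>, the values along the kink. Only the mixed term with
    \<open>t * a * R\<close> has no definite sign; \<open>\<bar>5 * t\<bar> \<le> a\<close> lets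
    \<open>5 * a^2 * S\<close> absorb it.\<close>
  have id: "T4 - 3/20 * T2^2 - q * T2 + 3 * q^2 - (q - 5/4 * (4*t)^2)^2 / 2 =
    8/5 * ((a^2 - 5/4*q + S/2)^2 + 5/8 * R^2 + (5 * a^2 * S + 15 * t * a * R))"
    unfolding T2_def T4_def S_def R_def
    by (simp add: power2_eq_square power4_eq_xxxx field_simps)
  have "\<bar>15 * t * a * R\<bar> = 3 * \<bar>5 * t\<bar> * a * \<bar>R\<bar>"
    using assms(1) by (simp add: abs_mult)
  also have "\<dots> \<le> 3 * a * a * S"
    using assms(1) by (intro mult_mono) (auto simp: S_def R_def abs_le_iff)
  also have "\<dots> \<le> 5 * a^2 * S"
    by (simp add: power2_eq_square S_def mult_right_mono)
  finally have "0 \<le> 5 * a^2 * S + 15 * t * a * R" by linarith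
  moreover have "0 \<le> X + 5/8 * Y + Z" if "0 \<le> X" "0 \<le> Y" "0 \<le> Z" for X Y Z :: real
    using that by simp
  ultimately have "0 \<le> 8/5 * ((a^2 - 5/4*q + S/2)^2 + 5/8 * R^2 + (5 * a^2 * S + 15 * t * a * R))"
    by simp
  then show ?thesis unfolding id[symmetric] by linarith
qed

lemma median_bound:
  assumes x: "decreasing5 x" and tr: "(\<Sum>i\<in>UNIV. x i) = 0"
  shows "(q - 5/4 * (x 3)^2)^2 / 2 \<le>
    (\<Sum>i\<in>UNIV. x i ^ 4) - 3/20 * (\<Sum>i\<in>UNIV. x i ^ 2)^2 - q * (\<Sum>i\<in>UNIV. x i ^ 2) + 3 * q^2"
proof -
  define t a d e where "t = - x 3 / 4" and "a = (x 1 + x 2) / 2 + x 3 / 4"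
    and "d = (x 1 - x 2) / 2" and "e = (x 4 - x 5) / 2"
  have tr': "x 5 = - x 1 - x 2 - x 3 - x 4" using tr by (simp add: sum_5)
  have "\<bar>5 * t\<bar> \<le> a"
    using x unfolding decreasing5_def t_def a_def tr' by (simp add: abs_le_iff field_simps)
  moreover have "t + a + d = x 1" "t + a - d = x 2" "- (4 * t) = x 3" "t - a + e = x 4" "t - a - e = x 5"
    by (simp_all add: t_def a_def d_def e_def tr' field_simps)
  moreover from this have "(4 * t)^2 = x 3 ^ 2" "(4 * t)^4 = x 3 ^ 4"
    by (metis power2_minus, metis power_minus_even even_numeral)
  ultimately show ?thesis
    using median_bound_parametrized[of t a q d e] by (simp add: sum_5)
qed

text \<open>Here \<open>-3t \<plusminus> r\<close> are the extreme eigenvalues and \<open>2t + z\<^sub>i\<close> the three middle ones, with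
  \<open>z\<^sub>1 + z\<^sub>2 + z\<^sub>3 = 0\<close>; the discriminant of the cubic with roots \<open>z\<^sub>i\<close> controls the cubic term.\<close>

lemma extremes_bound_parametrized:
  fixes r t m n q :: real
  assumes r: "\<bar>5*t + m\<bar> \<le> r" "\<bar>5*t + n\<bar> \<le> r" "\<bar>5*t - m - n\<bar> \<le> r"
  defines "T2 \<equiv> (-3*t+r)^2 + (2*t+m)^2 + (2*t+n)^2 + (2*t-m-n)^2 + (-3*t-r)^2"
    and "T4 \<equiv> (-3*t+r)^4 + (2*t+m)^4 + (2*t+n)^4 + (2*t-m-n)^4 + (-3*t-r)^4"
  shows "27/80 * (q - 100/81 * (6*t)^2)^2 \<le> T2^2 - 10/9 * T4 - q * T2 + 9/10 * q^2"
proof -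
  \<comment> \<open>The power sums of degree 2 and 3 of the roots \<open>m\<close>,
    \<open>n\<close>, \<open>- m - n\<close>.\<close>
  define p c where "p = 2 * (m^2 + m*n + n^2)" and "c = - 3 * m * n * (m + n)"
  have id: "T2^2 - 10/9 * T4 - q * T2 + 9/10 * q^2 - 27/80 * (q - 100/81 * (6*t)^2)^2 =
    4/9 * (4 * (9/16*q - r^2 - p/2)^2 + p * (5 * r^2 - 2/9 * p) + (75 * t^2 * p + 2/9 * p^2 - 20 * t * c))"
    unfolding T2_def T4_def p_def c_def
    by (simp add: power2_eq_square power4_eq_xxxx field_simps)
  have p: "p = m^2 + n^2 + (m+n)^2" by (simp add: p_def power2_eq_square algebra_simps)
  then have p0: "p \<ge> 0" by simp
  have "75 * t^2 + p = (5*t + m)^2 + (5*t + n)^2 + (5*t - m - n)^2"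
    by (simp add: p power2_eq_square algebra_simps)
  also have "\<dots> \<le> r^2 + r^2 + r^2"
    using r by (intro add_mono) (auto intro: abs_le_square_iff[THEN iffD1, OF order_trans[OF _ abs_ge_self]])
  finally have "p \<le> 3 * r^2 - 75 * t^2" by simp
  then have "p \<le> 3 * r^2" using zero_le_power2[of t] by linarith
  then have 1: "0 \<le> p * (5 * r^2 - 2/9 * p)"
    using p0 zero_le_power2[of r] by (intro mult_nonneg_nonneg) linarith+
  have 2: "0 \<le> 75 * t^2 * p + 2/9 * p^2 - 20 * t * c"
  proof (cases "p = 0")
    case True
    then have "m = 0" using p sum_power2_ge_zero[of n "m+n"] by (simp add: add_nonneg_eq_0_iff)
    then show ?thesis by (simp add: True c_def)
  next
    case False
    \<comment> \<open>The square on the right is the discriminant of the cubic. After multiplication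
      by \<open>75 * p\<close> the goal is a quadratic in \<open>t\<close>; completing its square
      leaves exactly this constant.\<close>
    have *: "50/3 * p^3 - 100 * c^2 = 100/3 * ((m-n)*(2*m+n)*(m+2*n))^2"
      unfolding p_def c_def by (simp add: power2_eq_square power3_eq_cube field_simps)
    have "0 \<le> 50/3 * p^3 - 100 * c^2" unfolding * by simp
    then have "0 \<le> (75 * p * t - 10 * c)^2 + (50/3 * p^3 - 100 * c^2)" by simp
    also have "\<dots> = (75 * p) * (75 * t^2 * p + 2/9 * p^2 - 20 * t * c)"
      by (simp add: power2_eq_square power3_eq_cube algebra_simps)
    finally show ?thesis using p0 False by (simp add: zero_le_mult_iff)
  qed
  have "0 \<le> 4/9 * (4 * (9/16*q - r^2 - p/2)^2 + p * (5 * r^2 - 2/9 * p) + (75 * t^2 * p + 2/9 * p^2 - 20 * t * c))"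
  proof -
    have "0 \<le> 4/9 * (4 * X + Y + Z)" if "0 \<le> X" "0 \<le> Y" "0 \<le> Z" for X Y Z :: real
      using that by simp
    from this[OF zero_le_power2 1 2] show ?thesis .
  qed
  then show ?thesis unfolding id[symmetric] by linarith
qed

lemma extremes_bound:
  assumes x: "decreasing5 x" and tr: "(\<Sum>i\<in>UNIV. x i) = 0"
  shows "27/80 * (q - 100/81 * (x 1 + x 5)^2)^2 \<le>
    (\<Sum>i\<in>UNIV. x i ^ 2)^2 - 10/9 * (\<Sum>i\<in>UNIV. x i ^ 4) - q * (\<Sum>i\<in>UNIV. x i ^ 2) + 9/10 * q^2"
proof -
  define t r m n where "t = - (x 1 + x 5) / 6" and "r = (x 1 - x 5) / 2"
    and "m = x 2 - 2 * t" and "n = x 3 - 2 * t"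
  have tr': "x 4 = - x 1 - x 2 - x 3 - x 5" using tr by (simp add: sum_5)
  have "\<bar>5 * t + m\<bar> \<le> r" "\<bar>5 * t + n\<bar> \<le> r" "\<bar>5 * t - m - n\<bar> \<le> r"
    using x unfolding decreasing5_def t_def r_def m_def n_def tr' abs_le_iff by (auto simp: field_simps)
  note abs = this
  have eqs: "-3 * t + r = x 1" "2 * t + m = x 2" "2 * t + n = x 3" "2 * t - m - n = x 4"
    "-3 * t - r = x 5" "(6 * t)^2 = (x 1 + x 5)^2"
    by (simp_all add: t_def r_def m_def n_def tr' field_simps power2_eq_square)
  show ?thesis
    using extremes_bound_parametrized[OF abs, of q] unfolding eqs by (simp add: sum_5)
qed

section \<open>The order parameter and its constants\<close>

primrec order_param :: "regime \<Rightarrow> mat5 \<Rightarrow> real" where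
  "order_param A_type \<Phi> = eigenvalues \<Phi> 3"
| "order_param B_type \<Phi> = eigenvalues \<Phi> 1 + eigenvalues \<Phi> 5"

primrec order_bound :: "regime \<Rightarrow> real \<Rightarrow> real \<Rightarrow> real \<Rightarrow> real" where
  "order_bound A_type \<mu> h lam = 2 * vac_scale A_type \<mu> h lam"
| "order_bound B_type \<mu> h lam = 3 * vac_scale B_type \<mu> h lam"

text \<open>Length of the gradient after projection to trace zero: \<open>1 - 1/5\<close> for one
  coordinate, \<open>2 - 4/5\<close> for the sum of two, under the root.\<close>

primrec order_lipschitz :: "regime \<Rightarrow> real" where
  "order_lipschitz A_type = sqrt (4/5)"
| "order_lipschitz B_type = sqrt (6/5)"

text \<open>Its square is the potential energy at the centre of the kink, where the order parameter
  is 0.\<close>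

primrec well_scale :: "regime \<Rightarrow> real \<Rightarrow> real \<Rightarrow> real \<Rightarrow> real" where
  "well_scale A_type \<mu> h lam = \<mu>^2 / sqrt (2 * lam)"
| "well_scale B_type \<mu> h lam = sqrt (27/80) * \<mu>^2 / sqrt h"

lemma potential_ge_order_param:
  assumes reg: "in_regime r \<mu> h lam V0" and "\<mu> > 0" and \<Phi>: "\<Phi> \<in> h0"
  shows "(well_scale r \<mu> h lam * (1 - (order_param r \<Phi> / order_bound r \<mu> h lam)^2))^2
    \<le> potential \<mu> h lam V0 \<Phi>"
proof -
  define x where "x = eigenvalues \<Phi>"
  have d: "dagger \<Phi> = \<Phi>" and "trace \<Phi> = 0" using \<Phi> by (auto simp: h0_def)
  obtain U where U: "unitary U" "\<Phi> = su_conj U (diag_mat x)"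
    using eigenvalues(2)[OF d] by (auto simp: x_def)
  have tr: "(\<Sum>i\<in>UNIV. x i) = 0"
    using \<open>trace \<Phi> = 0\<close> U trace_diag_mat[of x] of_real_eq_0_iff by (metis trace_su_conj)
  have x: "decreasing5 x" using eigenvalues(1)[OF d] by (simp add: x_def)
  have V: "potential \<mu> h lam V0 \<Phi> =
    - (\<mu>^2) * (\<Sum>i\<in>UNIV. x i ^ 2) + h * (\<Sum>i\<in>UNIV. x i ^ 2)^2 + lam * (\<Sum>i\<in>UNIV. x i ^ 4) + V0"
    using U by (simp add: potential_su_conj potential_diag_mat)
  show ?thesis
  proof (cases r)
    case A_type
    then have p: "lam > 0" "h = - (3/20) * lam" "V0 = 3 * \<mu>^4 / lam" using reg by auto
    \<comment> \<open>Scaling out \<open>lam\<close> leaves one parameter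
      \<open>q = \<mu>^2 / lam\<close>, and \<open>V0\<close> becomes the constant
      \<open>3 * q^2\<close> of the polynomial bound; the other regime scales out \<open>h\<close>
      in the same way.\<close>
    have "lam * ((\<mu>^2/lam - 5/4 * (x 3)^2)^2 / 2) \<le>
      lam * ((\<Sum>i\<in>UNIV. x i ^ 4) - 3/20 * (\<Sum>i\<in>UNIV. x i ^ 2)^2 - \<mu>^2/lam * (\<Sum>i\<in>UNIV. x i ^ 2) + 3 * (\<mu>^2/lam)^2)"
      using p by (intro mult_left_mono median_bound x tr) auto
    also have "\<dots> = potential \<mu> h lam V0 \<Phi>"
      unfolding V unfolding p(2,3) using p(1) by (simp add: field_simps power2_eq_square power4_eq_xxxx)
    also have "lam * ((\<mu>^2/lam - 5/4 * (x 3)^2)^2 / 2) =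
      (well_scale r \<mu> h lam * (1 - (order_param r \<Phi> / order_bound r \<mu> h lam)^2))^2"
    proof -
      have 1: "(order_param r \<Phi> / order_bound r \<mu> h lam)^2 = 5/4 * (x 3)^2 * lam / \<mu>^2"
        using p(1) \<open>\<mu> > 0\<close> by (simp add: A_type x_def power_divide power_mult_distrib field_simps)
      have 2: "(well_scale r \<mu> h lam)^2 = \<mu>^4 / (2 * lam)"
        using p(1) by (simp add: A_type power_divide flip: power_mult)
      show ?thesis
        using p(1) \<open>\<mu> > 0\<close> unfolding power_mult_distrib 1 2
        by (simp add: field_simps power2_eq_square power4_eq_xxxx)
    qed
    finally show ?thesis .
  next
    case B_type
    then have p: "h > 0" "lam = - (10/9) * h" "V0 = 9 * \<mu>^4 / (10 * h)" using reg by auto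
    have "h * (27/80 * (\<mu>^2/h - 100/81 * (x 1 + x 5)^2)^2) \<le>
      h * ((\<Sum>i\<in>UNIV. x i ^ 2)^2 - 10/9 * (\<Sum>i\<in>UNIV. x i ^ 4) - \<mu>^2/h * (\<Sum>i\<in>UNIV. x i ^ 2) + 9/10 * (\<mu>^2/h)^2)"
      using p by (intro mult_left_mono extremes_bound x tr) auto
    also have "\<dots> = potential \<mu> h lam V0 \<Phi>"
      unfolding V unfolding p(2,3) using p(1) by (simp add: field_simps power2_eq_square power4_eq_xxxx)
    also have "h * (27/80 * (\<mu>^2/h - 100/81 * (x 1 + x 5)^2)^2) =
      (well_scale r \<mu> h lam * (1 - (order_param r \<Phi> / order_bound r \<mu> h lam)^2))^2"
    proof -
      define w where "w = x 1 + x 5"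
      have 1: "(order_param r \<Phi> / order_bound r \<mu> h lam)^2 = 100/81 * w^2 * h / \<mu>^2"
        using p(1) \<open>\<mu> > 0\<close> by (simp add: B_type x_def w_def power_divide power_mult_distrib)
      have 2: "(well_scale r \<mu> h lam)^2 = 27/80 * \<mu>^4 / h"
        using p(1) by (simp add: B_type power_divide power_mult_distrib flip: power_mult)
      show ?thesis
        using p(1) \<open>\<mu> > 0\<close> unfolding power_mult_distrib 1 2 w_def[symmetric]
        by (simp add: field_simps power2_eq_square power4_eq_xxxx)
    qed
    finally show ?thesis .
  qed
qed

lemma order_param_lipschitz:
  assumes "P \<in> h0" "Q \<in> h0"
  shows "\<bar>order_param r P - order_param r Q\<bar> \<le> order_lipschitz r * norm (P - Q)"
proof -
  define \<delta> where "\<delta> i = eigenvalues P i - eigenvalues Q i" for i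
  have d: "dagger P = P" "dagger Q = Q" using assms by (auto simp: h0_def)
  have tr: "(\<Sum>i\<in>UNIV. eigenvalues R i) = 0" if "R \<in> h0" for R
  proof -
    have R: "dagger R = R" "trace R = 0" using that by (auto simp: h0_def)
    then obtain U where "unitary U" "R = su_conj U (diag_mat (eigenvalues R))"
      using eigenvalues(2) by blast
    then have "trace (diag_mat (eigenvalues R)) = 0" using R by (metis trace_su_conj)
    then show ?thesis unfolding trace_diag_mat of_real_eq_0_iff .
  qed
  have sum0: "\<delta> 1 + \<delta> 2 + \<delta> 3 + \<delta> 4 + \<delta> 5 = 0"
    using tr[OF assms(1)] tr[OF assms(2)] by (simp add: \<delta>_def sum_5)
  have le: "(\<delta> 1)^2 + (\<delta> 2)^2 + (\<delta> 3)^2 + (\<delta> 4)^2 + (\<delta> 5)^2 \<le> (norm (P - Q))^2"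
    using eigenvalues_lipschitz[OF d] by (simp add: \<delta>_def sum_5)
  have abs: "\<bar>a\<bar> \<le> sqrt c * norm (P - Q)" if "a^2 \<le> c * ((\<delta> 1)^2 + (\<delta> 2)^2 + (\<delta> 3)^2 + (\<delta> 4)^2 + (\<delta> 5)^2)" "c \<ge> 0" for a c
  proof -
    have "a^2 \<le> c * (norm (P - Q))^2"
      using that le mult_left_mono[OF le, of c] by linarith
    then show ?thesis
      using real_le_rsqrt[of "\<bar>a\<bar>" "c * (norm (P - Q))^2"] by (simp add: real_sqrt_mult)
  qed
  show ?thesis
  proof (cases r)
    case A_type
    have "(\<delta> 3)^2 \<le> 4/5 * ((\<delta> 1)^2 + (\<delta> 2)^2 + (\<delta> 3)^2 + (\<delta> 4)^2 + (\<delta> 5)^2)"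
    proof -
      have e: "\<delta> 3 = - \<delta> 1 - \<delta> 2 - \<delta> 4 - \<delta> 5" using sum0 by simp
      \<comment> \<open>Cauchy--Schwarz for the four remaining differences, whose sum is
        \<open>- \<delta> 3\<close>; the zero trace is what improves the constant from 1 to
        4/5.\<close>
      have "0 \<le> (\<delta> 1 - \<delta> 2)^2 + (\<delta> 1 - \<delta> 4)^2 + (\<delta> 1 - \<delta> 5)^2 + (\<delta> 2 - \<delta> 4)^2 + (\<delta> 2 - \<delta> 5)^2 + (\<delta> 4 - \<delta> 5)^2"
        by simp
      then show ?thesis unfolding e by (simp add: power2_eq_square algebra_simps)
    qed
    then show ?thesis using abs[of "\<delta> 3" "4/5"] by (simp add: A_type \<delta>_def)
  next
    case B_type
    have "(\<delta> 1 + \<delta> 5)^2 \<le> 6/5 * ((\<delta> 1)^2 + (\<delta> 2)^2 + (\<delta> 3)^2 + (\<delta> 4)^2 + (\<delta> 5)^2)"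
    proof -
      \<comment> \<open>The sum \<open>\<delta> 1 + \<delta> 5\<close> is, up to sign, also the sum
        of the other three. Cauchy--Schwarz for two and for three terms, mixed with weights 3 and 2,
        gives the factor 6/5.\<close>
      have "0 \<le> 3 * (\<delta> 1 - \<delta> 5)^2 + 2 * ((\<delta> 2 - \<delta> 3)^2 + (\<delta> 2 - \<delta> 4)^2 + (\<delta> 3 - \<delta> 4)^2)"
        by simp
      moreover have "(\<delta> 1 + \<delta> 5)^2 = (\<delta> 2 + \<delta> 3 + \<delta> 4)^2"
        using sum0 by (simp add: power2_eq_iff)
      ultimately show ?thesis by (simp add: power2_eq_square algebra_simps)
    qed
    then show ?thesis using abs[of "\<delta> 1 + \<delta> 5" "6/5"] by (simp add: B_type \<delta>_def algebra_simps)
  qed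
qed

section \<open>Calibrated energy bounds\<close>

lemma set_integrable_mult_continuous:
  fixes f c :: "real \<Rightarrow> real"
  assumes f: "set_integrable lborel {a..b} f" and c: "continuous_on {a..b} c"
  shows "set_integrable lborel {a..b} (\<lambda>z. f z * c z)"
proof -
  obtain M where "\<forall>z\<in>{a..b}. \<bar>c z\<bar> \<le> M"
    using compact_imp_bounded[OF compact_continuous_image[OF c compact_Icc]] by (auto simp: bounded_iff)
  then have M: "\<And>z. z \<in> {a..b} \<Longrightarrow> \<bar>c z\<bar> \<le> M" by blast
  have meas: "(\<lambda>z. (indicator {a..b} z *\<^sub>R f z) * (indicator {a..b} z *\<^sub>R c z)) \<in> borel_measurable lborel"
    using f borel_measurable_continuous_on_indicator[OF _ c]
    by (intro borel_measurable_times) (auto simp: set_integrable_def)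
  have eq: "(\<lambda>z. (indicator {a..b} z *\<^sub>R f z) * (indicator {a..b} z *\<^sub>R c z)) = (\<lambda>z. indicator {a..b} z *\<^sub>R (f z * c z))"
    by (auto simp: indicator_def)
  have "integrable lborel (\<lambda>z. (indicator {a..b} z *\<^sub>R f z) * M)"
    using f by (intro integrable_mult_left) (simp add: set_integrable_def)
  then have "integrable lborel (\<lambda>z. indicator {a..b} z *\<^sub>R (f z * c z))"
    using meas unfolding eq
    by (rule Bochner_Integration.integrable_bound)
      (use order_trans[OF M abs_ge_self] in \<open>auto simp: indicator_def abs_mult intro!: AE_I2 mult_left_mono\<close>)
  then show ?thesis by (simp add: set_integrable_def)
qed

lemma set_integral_Icc_combine:
  fixes f :: "real \<Rightarrow> real"
  assumes "a \<le> m" "m \<le> b" "set_integrable lborel {a..b} f"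
  shows "(LINT z:{a..b}|lborel. f z) = (LINT z:{a..m}|lborel. f z) + (LINT z:{m..b}|lborel. f z)"
proof -
  have i: "set_integrable lborel {a..m} f" "set_integrable lborel {m..b} f"
    using assms by (auto intro: set_integrable_subset[OF assms(3)])
  have "(LINT z:{a..b}|lborel. f z) = integral {a..b} f" "(LINT z:{a..m}|lborel. f z) = integral {a..m} f"
    "(LINT z:{m..b}|lborel. f z) = integral {m..b} f"
    using i assms(3) by (simp_all add: set_borel_integral_eq_integral(2))
  then show ?thesis
    using Henstock_Kurzweil_Integration.integral_combine[OF assms(1,2) set_borel_integral_eq_integral(1)[OF assms(3)]]
    by simp
qed

text \<open>The chain rule estimate \<open>\<bar>(H \<circ> w)'\<bar> \<le> K f (h \<circ> w)\<close> in integrated form, for a path \<open>w\<close> that is not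
  known to be differentiable anywhere: the mean value theorem is applied on the cells of a fine partition.\<close>

lemma integrated_chain_rule_bound:
  fixes f w h H :: "real \<Rightarrow> real"
  assumes ab: "a \<le> b"
    and f: "set_integrable lborel {a..b} f" and f0: "\<And>z. 0 \<le> f z"
    and w: "continuous_on {a..b} w" and wI: "\<And>z. z \<in> {a..b} \<Longrightarrow> w z \<in> {c..d}"
    and lip: "\<And>s t. a \<le> s \<Longrightarrow> s \<le> t \<Longrightarrow> t \<le> b \<Longrightarrow> \<bar>w t - w s\<bar> \<le> K * (LINT z:{s..t}|lborel. f z)"
    and h: "continuous_on {c..d} h" and h0: "\<And>x. x \<in> {c..d} \<Longrightarrow> 0 \<le> h x"
    and H: "\<And>x. x \<in> {c..d} \<Longrightarrow> (H has_real_derivative h x) (at x within {c..d})"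
    and K: "0 \<le> K"
  shows "\<bar>H (w b) - H (w a)\<bar> \<le> K * (LINT z:{a..b}|lborel. f z * h (w z))"
proof -
  let ?I = "\<lambda>s t. LINT z:{s..t}|lborel. f z"
  let ?J = "\<lambda>s t. LINT z:{s..t}|lborel. f z * h (w z)"
  have hw: "continuous_on {a..b} (\<lambda>z. h (w z))"
    using continuous_on_compose2[OF h w] wI by blast
  have fi: "set_integrable lborel {s..t} f" "set_integrable lborel {s..t} (\<lambda>z. f z * h (w z))"
    if "a \<le> s" "t \<le> b" for s t
    using that by (auto intro!: set_integrable_subset[OF f] set_integrable_subset[OF set_integrable_mult_continuous[OF f hw]])
  have step: "\<bar>H (w b) - H (w a)\<bar> \<le> K * ?J a b + e * (K * ?I a b)" if "e > 0" for e
  proof -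
    have "uniformly_continuous_on {a..b} (\<lambda>z. h (w z))"
      using hw by (intro compact_uniformly_continuous) auto
    then obtain \<delta> where \<delta>: "\<delta> > 0" "\<And>y z. y \<in> {a..b} \<Longrightarrow> z \<in> {a..b} \<Longrightarrow> \<bar>y - z\<bar> < \<delta> \<Longrightarrow> \<bar>h (w y) - h (w z)\<bar> < e"
      using \<open>e > 0\<close> unfolding uniformly_continuous_on_def dist_real_def by metis
    have small: "\<bar>H (w t) - H (w s)\<bar> \<le> K * ?J s t + e * (K * ?I s t)"
      if st: "a \<le> s" "s \<le> t" "t \<le> b" "t - s < \<delta>" for s t
    proof -
      have mvt: "\<exists>\<xi>\<in>{min (w s) (w t)..max (w s) (w t)}. \<bar>H (w t) - H (w s)\<bar> = h \<xi> * \<bar>w t - w s\<bar>"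
      proof -
        have *: "\<exists>\<xi>\<in>{x..y}. \<bar>H y - H x\<bar> = h \<xi> * \<bar>y - x\<bar>" if "x \<le> y" "x \<in> {c..d}" "y \<in> {c..d}" for x y
        proof (cases "x = y")
          case False
          have "\<exists>\<xi>\<in>{x<..<y}. H y - H x = (\<lambda>v. v * h \<xi>) (y - x)"
          proof (rule mvt_simple)
            fix z assume "x \<le> z" "z \<le> y"
            then have "(H has_real_derivative h z) (at z within {x..y})"
              using that by (intro DERIV_subset[OF H]) auto
            then show "(H has_derivative (\<lambda>v. v * h z)) (at z within {x..y})"
              by (simp add: has_field_derivative_def mult_commute_abs)
          qed (use that False in auto)
          then obtain \<xi> where \<xi>: "\<xi> \<in> {x<..<y}" "H y - H x = (y - x) * h \<xi>" by blast
          then have "0 \<le> h \<xi>" using that by (intro h0) auto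
          then show ?thesis using \<xi> that by (intro bexI[of _ \<xi>]) (auto simp: abs_mult)
        qed auto
        have "w s \<in> {c..d}" "w t \<in> {c..d}" using wI st by auto
        then show ?thesis
          using *[of "w s" "w t"] *[of "w t" "w s"] by (cases "w s \<le> w t") (auto simp: abs_minus_commute)
      qed
      then obtain \<xi> where \<xi>: "min (w s) (w t) \<le> \<xi>" "\<xi> \<le> max (w s) (w t)" "\<bar>H (w t) - H (w s)\<bar> = h \<xi> * \<bar>w t - w s\<bar>"
        by auto
      \<comment> \<open>The mean value theorem yields an intermediate value \<open>\<xi>\<close> of
        the height, not a time. By connectedness \<open>\<xi>\<close> is attained within the cell,
        so uniform continuity in time compares \<open>h \<xi>\<close> with
        \<open>h (w z)\<close>.\<close>
      have "connected (w ` {s..t})"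
        using st by (intro connected_continuous_image continuous_on_subset[OF w]) auto
      moreover have "min (w s) (w t) \<in> w ` {s..t}" "max (w s) (w t) \<in> w ` {s..t}"
        using st by (auto simp: min_def max_def)
      ultimately have "\<xi> \<in> w ` {s..t}"
        using \<xi> connectedD_interval by blast
      then obtain z0 where z0: "z0 \<in> {s..t}" "w z0 = \<xi>" by blast
      have h\<xi>: "0 \<le> h \<xi>" using z0 st wI h0 by auto
      have "\<bar>H (w t) - H (w s)\<bar> \<le> h \<xi> * (K * ?I s t)"
        unfolding \<xi>(3) using st h\<xi> by (intro mult_left_mono lip) auto
      then have up: "\<bar>H (w t) - H (w s)\<bar> \<le> K * (LINT z:{s..t}|lborel. f z * h \<xi>)"
        by (simp add: mult_ac)
      have "(LINT z:{s..t}|lborel. f z * h \<xi>) \<le> (LINT z:{s..t}|lborel. f z * h (w z) + f z * e)"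
      proof (rule set_integral_mono)
        show "set_integrable lborel {s..t} (\<lambda>z. f z * h \<xi>)"
          using fi st by (intro set_integrable_mult_left) auto
        show "set_integrable lborel {s..t} (\<lambda>z. f z * h (w z) + f z * e)"
          using fi st by (intro set_integral_add(1) set_integrable_mult_left) auto
        fix z assume "z \<in> {s..t}"
        then have "\<bar>h (w z0) - h (w z)\<bar> < e" using z0 st by (intro \<delta>) auto
        then have "h \<xi> \<le> h (w z) + e" using z0 by auto
        then show "f z * h \<xi> \<le> f z * h (w z) + f z * e"
          using f0[of z] by (metis distrib_left mult_left_mono)
      qed
      also have "\<dots> = ?J s t + ?I s t * e"
        using fi st by (subst set_integral_add(2)) (auto intro!: set_integrable_mult_left)
      finally have "K * (LINT z:{s..t}|lborel. f z * h \<xi>) \<le> K * (?J s t + ?I s t * e)"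
        using K by (rule mult_left_mono)
      with up show ?thesis by (simp add: algebra_simps)
    qed
    have "\<bar>H (w t) - H (w s)\<bar> \<le> K * ?J s t + e * (K * ?I s t)"
      if "a \<le> s" "s \<le> t" "t \<le> b" "t - s \<le> n * (\<delta>/2)" for s t and n :: nat
      using that
    proof (induction n arbitrary: t)
      case 0
      then show ?case using small[of s t] \<delta> by auto
    next
      case (Suc n)
      define m where "m = max s (t - \<delta>/2)"
      have m: "s \<le> m" "m \<le> t" "t - m < \<delta>" "m - s \<le> n * (\<delta>/2)"
        using Suc.prems \<delta>(1) by (auto simp: m_def max_def algebra_simps)
      have "\<bar>H (w m) - H (w s)\<bar> \<le> K * ?J s m + e * (K * ?I s m)"
        using m Suc.prems by (intro Suc.IH) auto
      moreover have "\<bar>H (w t) - H (w m)\<bar> \<le> K * ?J m t + e * (K * ?I m t)"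
        using m Suc.prems by (intro small) auto
      moreover have "?J s t = ?J s m + ?J m t" "?I s t = ?I s m + ?I m t"
        using m Suc.prems fi by (auto intro!: set_integral_Icc_combine)
      ultimately show ?case by (simp add: algebra_simps)
    qed
    moreover obtain n :: nat where "b - a \<le> n * (\<delta>/2)"
      using reals_Archimedean3[of "\<delta>/2"] \<delta>(1) by (metis half_gt_zero less_imp_le)
    ultimately show ?thesis using ab by auto
  qed
  show ?thesis
  proof (rule field_le_epsilon)
    fix e :: real assume "e > 0"
    have I0: "0 \<le> K * ?I a b"
      unfolding set_lebesgue_integral_def
      using f0 K by (intro mult_nonneg_nonneg Bochner_Integration.integral_nonneg) auto
    \<comment> \<open>The error of the partition is proportional to \<open>K * ?I a b\<close>; the
      \<open>+ 1\<close> covers the case that this is zero.\<close>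
    then have "e / (K * ?I a b + 1) > 0" using \<open>e > 0\<close> by simp
    from step[OF this] have "\<bar>H (w b) - H (w a)\<bar> \<le> K * ?J a b + e * ((K * ?I a b) / (K * ?I a b + 1))"
      by simp
    also have "\<dots> \<le> K * ?J a b + e * 1"
      using I0 \<open>e > 0\<close> by (intro add_left_mono mult_left_mono) auto
    finally show "\<bar>H (w b) - H (w a)\<bar> \<le> K * ?J a b + e" by simp
  qed
qed

section \<open>The calibrated lower bound and its equality case\<close>

locale calibration =
  fixes V W :: "mat5 \<Rightarrow> real" and K w0 k :: real
  assumes K_pos: "K > 0" and w0_pos: "w0 > 0" and k_pos: "k > 0"
    and W_bound: "P \<in> h0 \<Longrightarrow> \<bar>W P\<bar> \<le> w0"
    and W_lip: "P \<in> h0 \<Longrightarrow> Q \<in> h0 \<Longrightarrow> \<bar>W P - W Q\<bar> \<le> K * norm (P - Q)"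
    and V_ge: "P \<in> h0 \<Longrightarrow> (k * (1 - (W P / w0)^2))^2 \<le> V P"
begin

definition speed :: "real \<Rightarrow> real" where "speed s = k * (1 - (s / w0)^2)"

definition calib :: "real \<Rightarrow> real" where "calib s = k * (s - s^3 / (3 * w0^2))"

text \<open>This is \<open>2 / K\<close> times the integral of \<open>speed\<close> over
  \<open>{-w0..w0}\<close>, as \<open>calib_drop\<close> confirms.\<close>

definition tension :: real where "tension = 8 * k * w0 / (3 * K)"

lemma calib_deriv: "(calib has_real_derivative speed s) (at s within S)"
  unfolding calib_def[abs_def] speed_def using w0_pos
  by (auto intro!: derivative_eq_intros simp: field_simps power2_eq_square)

lemma continuous_on_speed: "continuous_on S speed"
  unfolding speed_def[abs_def] using w0_pos by (intro continuous_intros) auto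

lemma speed_nonneg: "\<bar>s\<bar> \<le> w0 \<Longrightarrow> 0 \<le> speed s"
  unfolding speed_def using w0_pos k_pos abs_le_square_iff[of s w0]
  by (auto intro!: mult_nonneg_nonneg simp: power_divide divide_le_eq)

lemma calib_drop: "2 / K * (calib w0 - calib (- w0)) = tension"
  using w0_pos K_pos by (simp add: calib_def tension_def power2_eq_square power3_eq_cube field_simps)

context
  fixes Am Ap :: mat5 and \<Psi> :: "real \<Rightarrow> mat5"
  assumes adm: "\<Psi> \<in> admissible V Am Ap"
    and Am: "Am \<in> h0" "W Am = w0" and Ap: "Ap \<in> h0" "W Ap = - w0"
begin

definition "rate = (\<lambda>z. norm (weak_deriv \<Psi> z))"
definition "height = (\<lambda>z. W (\<Psi> z))"

lemma \<Psi>_h0: "\<Psi> z \<in> h0" and \<Psi>_cont: "continuous_on UNIV \<Psi>"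
  and wd: "has_weak_deriv \<Psi> (weak_deriv \<Psi>)"
  and V_int: "integrable lborel (\<lambda>z. V (\<Psi> z))"
  using adm by (auto simp: admissible_def H1_loc_def intro: has_weak_deriv_weak_deriv)

text \<open>\<open>weak_deriv\<close> is an arbitrary representative, known to be Hermitian only
  almost everywhere, and \<open>frob\<close> agrees with the norm only on Hermitian
  matrices.\<close>

lemma frob_eq_rate: "AE z in lborel. frob (weak_deriv \<Psi> z) = rate z"
  using adm by (auto simp: admissible_def L2_on_def rate_def h0_def frob_eq_norm elim!: AE_mp)

lemma rate_meas: "rate \<in> borel_measurable lborel"
  using adm unfolding rate_def
  by (auto simp: admissible_def L2_on_def set_borel_measurable_def intro!: borel_measurable_norm)

lemma rate_sq_int: "integrable lborel (\<lambda>z. (rate z)^2)"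
proof -
  have "integrable lborel (\<lambda>z. (frob (weak_deriv \<Psi> z))^2)"
    using adm by (auto simp: admissible_def L2_on_def set_integrable_def)
  then show ?thesis
    by (rule integrable_cong_AE_imp) (use rate_meas frob_eq_rate in \<open>auto elim!: AE_mp\<close>)
qed

lemma energy_eq: "energy V \<Psi> = (LINT z|lborel. (rate z)^2 + V (\<Psi> z))"
proof -
  have "(\<lambda>z. (frob (weak_deriv \<Psi> z))^2) \<in> borel_measurable lborel"
    using adm by (auto simp: admissible_def L2_on_def set_integrable_def)
  then show ?thesis
    unfolding energy_def using rate_meas V_int frob_eq_rate
    by (intro integral_cong_AE) (auto elim!: AE_mp)
qed

lemma rate_int: "set_integrable lborel {a..b} rate"
  using wd unfolding rate_def has_weak_deriv_def loc_integrable_def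
  by (auto intro: set_integrable_norm)

lemma rate_nonneg: "0 \<le> rate z" by (simp add: rate_def)

lemma chord_le: "a \<le> b \<Longrightarrow> norm (\<Psi> b - \<Psi> a) \<le> (LINT z:{a..b}|lborel. rate z)"
  using weak_deriv_FTC[OF wd \<Psi>_cont, of a b] wd unfolding rate_def has_weak_deriv_def loc_integrable_def
  by (auto intro: set_integral_norm_bound)

lemma height_bound: "\<bar>height z\<bar> \<le> w0"
  by (simp add: height_def W_bound \<Psi>_h0)

lemma height_lip: "s \<le> t \<Longrightarrow> \<bar>height t - height s\<bar> \<le> K * (LINT z:{s..t}|lborel. rate z)"
  unfolding height_def using K_pos by (intro order_trans[OF W_lip] mult_left_mono chord_le \<Psi>_h0) auto

lemma W_tendsto:
  assumes "(\<Psi> \<longlongrightarrow> P) F" "P \<in> h0"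
  shows "(height \<longlongrightarrow> W P) F"
proof -
  have "((\<lambda>z. K * norm (\<Psi> z - P)) \<longlongrightarrow> K * norm (P - P)) F"
    using assms(1) by (intro tendsto_intros)
  then have "((\<lambda>z. K * norm (\<Psi> z - P)) \<longlongrightarrow> 0) F" by simp
  then have "((\<lambda>z. W (\<Psi> z) - W P) \<longlongrightarrow> 0) F"
    by (rule Lim_null_comparison[rotated]) (simp add: W_lip \<Psi>_h0 assms(2))
  then show ?thesis
    unfolding height_def by (simp add: LIM_zero_iff)
qed

lemma height_cont: "continuous_on S height"
  unfolding continuous_on_def
proof
  fix x
  have "(\<Psi> \<longlongrightarrow> \<Psi> x) (at x within S)"
    using continuous_on_subset[OF \<Psi>_cont, of S] \<Psi>_cont
    by (meson UNIV_I continuous_on_def tendsto_within_subset subset_UNIV)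
  then show "(height \<longlongrightarrow> height x) (at x within S)"
    using W_tendsto[OF _ \<Psi>_h0] by (simp add: height_def)
qed

text \<open>Kept general in the integrand: it is applied to \<open>speed\<close> for the lower bound
  and to the difference \<open>speed s / \<delta> - speed s / (speed s + \<delta>)\<close> in the
  equality case.\<close>

lemma calibrated:
  assumes "a \<le> b" "continuous_on {-w0..w0} h" "\<And>x. x \<in> {-w0..w0} \<Longrightarrow> 0 \<le> h x"
    and "\<And>x. x \<in> {-w0..w0} \<Longrightarrow> (H has_real_derivative h x) (at x within {-w0..w0})"
  shows "\<bar>H (height b) - H (height a)\<bar> \<le> K * (LINT z:{a..b}|lborel. rate z * h (height z))"
  using height_bound height_lip K_pos
  by (intro integrated_chain_rule_bound[where c="-w0" and d=w0] assms rate_int rate_nonneg height_cont)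
    (auto simp: abs_le_iff minus_le_iff)

lemma speed_sq_le: "(speed (height z))^2 \<le> V (\<Psi> z)"
  using V_ge[OF \<Psi>_h0] by (simp add: speed_def height_def)

lemma speed_height_nonneg: "0 \<le> speed (height z)"
  using speed_nonneg height_bound by blast

lemma two_rate_speed_le: "2 * (rate z * speed (height z)) \<le> (rate z)^2 + V (\<Psi> z)"
  using speed_sq_le[of z] sum_squares_bound[of "rate z" "speed (height z)"] by (simp add: mult.assoc)

lemma speed_height_meas: "(\<lambda>z. speed (height z)) \<in> borel_measurable lborel"
  using continuous_on_compose2[OF continuous_on_speed[of UNIV] height_cont[of UNIV]]
  by (auto intro: borel_measurable_continuous_onI)

lemma rate_speed_int: "integrable lborel (\<lambda>z. rate z * speed (height z))"
  by (rule Bochner_Integration.integrable_bound[of _ "\<lambda>z. (rate z)^2 + V (\<Psi> z)"])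
    (use rate_sq_int V_int rate_meas speed_height_meas two_rate_speed_le rate_nonneg speed_height_nonneg in
      \<open>auto intro!: AE_I2 simp: abs_mult intro: order_trans[OF _ order_trans[OF two_rate_speed_le abs_ge_self]]\<close>)

lemma rate_speed_le: "(LINT z:{a..b}|lborel. rate z * speed (height z)) \<le> (LINT z|lborel. rate z * speed (height z))"
  unfolding set_lebesgue_integral_def
  by (intro integral_mono integrable_mult_indicator rate_speed_int)
    (auto simp: indicator_def rate_nonneg speed_height_nonneg)

lemma rate_speed_le_energy: "(LINT z|lborel. rate z * speed (height z)) \<le> energy V \<Psi> / 2"
proof -
  have "(LINT z|lborel. 2 * (rate z * speed (height z))) \<le> (LINT z|lborel. (rate z)^2 + V (\<Psi> z))"
    using rate_speed_int rate_sq_int V_int two_rate_speed_le by (intro integral_mono) auto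
  then show ?thesis by (simp add: energy_eq)
qed

lemma calib_height_le: "a \<le> b \<Longrightarrow> calib (height a) - calib (height b) \<le> K * (LINT z:{a..b}|lborel. rate z * speed (height z))"
  using calibrated[of a b speed calib] continuous_on_speed speed_nonneg calib_deriv
  by (auto simp: abs_le_iff minus_le_iff)

lemma calib_height_tendsto: "(\<lambda>n. calib (height (- real n)) - calib (height (real n))) \<longlonglongrightarrow> K / 2 * tension"
proof -
  have "filterlim (\<lambda>n. - real n) at_bot sequentially"
    by (simp add: filterlim_real_sequentially filterlim_uminus_at_bot)
  then have "(\<lambda>n. height (- real n)) \<longlonglongrightarrow> w0" "(\<lambda>n. height (real n)) \<longlonglongrightarrow> - w0"
    using filterlim_compose[OF W_tendsto] adm Am Ap filterlim_real_sequentially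
    by (fastforce simp: admissible_def)+
  then have "(\<lambda>n. calib (height (- real n)) - calib (height (real n))) \<longlonglongrightarrow> calib w0 - calib (- w0)"
    unfolding calib_def using w0_pos by (intro tendsto_intros) auto
  also have "calib w0 - calib (- w0) = K / 2 * tension"
    using calib_drop K_pos by (simp add: field_simps)
  finally show ?thesis .
qed

lemma tension_le_rate_speed: "tension / 2 \<le> (LINT z|lborel. rate z * speed (height z))"
proof -
  have "K / 2 * tension \<le> K * (LINT z|lborel. rate z * speed (height z))"
  proof (rule LIMSEQ_le_const2[OF calib_height_tendsto])
    show "\<exists>N. \<forall>n\<ge>N. calib (height (- real n)) - calib (height (real n)) \<le> K * (LINT z|lborel. rate z * speed (height z))"
      using K_pos by (auto intro!: exI order_trans[OF calib_height_le] mult_left_mono rate_speed_le)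
  qed
  then show ?thesis using K_pos by (simp add: field_simps)
qed

lemma energy_ge_tension: "tension \<le> energy V \<Psi>"
  using tension_le_rate_speed rate_speed_le_energy by linarith

text \<open>The energy deficit \<open>g\<close> dominates the square of \<open>rate - speed\<close>
  pointwise, and at minimal energy its integral cannot be positive.\<close>

lemma optimal_speed:
  assumes E: "energy V \<Psi> = tension"
  shows "AE z in lborel. rate z = speed (height z)"
proof -
  define g where "g z = (rate z)^2 + V (\<Psi> z) - 2 * (rate z * speed (height z))" for z
  have gi: "integrable lborel g"
    unfolding g_def using rate_sq_int V_int rate_speed_int by auto
  have g0: "(rate z - speed (height z))^2 \<le> g z" for z
    using speed_sq_le[of z] by (simp add: g_def power2_diff)
  have "(LINT z|lborel. g z) = energy V \<Psi> - 2 * (LINT z|lborel. rate z * speed (height z))"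
    unfolding g_def energy_eq using rate_sq_int V_int rate_speed_int by simp
  then have "(LINT z|lborel. g z) \<le> 0"
    using tension_le_rate_speed E by simp
  moreover have "0 \<le> g z" for z using g0[of z] zero_le_power2 order_trans by blast
  ultimately have "AE z in lborel. g z = 0"
    using integral_nonneg_eq_0_iff_AE[OF gi] by (auto intro: antisym Bochner_Integration.integral_nonneg)
  then show ?thesis
  proof eventually_elim
    case (elim z)
    then show ?case using g0[of z] by simp
  qed
qed

text \<open>Equality in the calibration for \<open>speed\<close> forces equality for every integrand
  between \<open>0\<close> and a multiple of \<open>speed\<close>, in particular for \<open>speed / (speed + \<delta>)\<close>; as \<open>\<delta> \<rightarrow> 0\<close>
  this bounds the length of the path.\<close>

lemma regularized_length:
  assumes E: "energy V \<Psi> = tension" and "\<delta> > 0"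
  shows "K * (LINT z:{a..b}|lborel. rate z * (speed (height z) / (speed (height z) + \<delta>))) \<le> 2 * w0"
proof -
  define h where "h s = speed s / (speed s + \<delta>)" for s
  define H where "H s = integral {-w0..s} h" for s
  let ?I = "{-w0..w0}"
  have sp: "0 \<le> speed s" if "s \<in> ?I" for s using that by (intro speed_nonneg) auto
  have hc: "continuous_on ?I h"
    unfolding h_def using sp \<open>\<delta> > 0\<close> by (intro continuous_intros continuous_on_speed) force
  have h0: "0 \<le> h s" "h s \<le> 1" "h s \<le> speed s / \<delta>" if "s \<in> ?I" for s
    using sp[OF that] \<open>\<delta> > 0\<close> by (simp_all add: h_def frac_le divide_le_eq_1)
  have HD: "(H has_real_derivative h s) (at s within ?I)" if "s \<in> ?I" for s
    unfolding H_def[abs_def] by (rule integral_has_real_derivative[OF hc that])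
  have H0: "0 \<le> H s" "H s \<le> 2 * w0" if "s \<in> ?I" for s
  proof -
    have i: "h integrable_on {-w0..s}"
      using that by (intro integrable_continuous_interval continuous_on_subset[OF hc]) auto
    then show "0 \<le> H s" unfolding H_def using h0 that by (intro integral_nonneg) auto
    have "H s \<le> integral {-w0..s} (\<lambda>_. 1)"
      unfolding H_def using h0 that by (intro integral_le i) auto
    then show "H s \<le> 2 * w0" using that by simp
  qed
  have wI: "height z \<in> ?I" for z using height_bound[of z] by (auto simp: abs_le_iff)
  have hw: "continuous_on S (\<lambda>z. h (height z))" for S
    using continuous_on_compose2[OF hc height_cont] wI by blast
  have fh: "set_integrable lborel {a..b} (\<lambda>z. rate z * h (height z))" for a b
    by (intro set_integrable_mult_continuous rate_int hw)
  have fs: "set_integrable lborel {a..b} (\<lambda>z. rate z * speed (height z))" for a b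
    using integrable_mult_indicator[of "{a..b}" lborel, OF _ rate_speed_int] by (simp add: set_integrable_def)
  \<comment> \<open>The part of the total drop of \<open>calib\<close> that lies outside
    \<open>{-n..n}\<close>; it tends to 0.\<close>
  define rem where "rem n = K / 2 * tension - (calib (height (- real n)) - calib (height (real n)))" for n
  have bd: "K * (LINT z:{-real n..real n}|lborel. rate z * h (height z)) \<le> 2 * w0 + rem n / \<delta>" for n
  proof -
    let ?A = "{-real n..real n}"
    \<comment> \<open>The calibration only bounds integrals from below. Applied to the nonnegative
      difference \<open>speed / \<delta> - h\<close>, and combined with the known upper bound of the
      integral for \<open>speed\<close>, it bounds the integral for \<open>h\<close> from
      above.\<close>
    have "\<bar>(calib (height n) / \<delta> - H (height n)) - (calib (height (- real n)) / \<delta> - H (height (- real n)))\<bar>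
      \<le> K * (LINT z:?A|lborel. rate z * (speed (height z) / \<delta> - h (height z)))"
    proof (rule calibrated[where H="\<lambda>s. calib s / \<delta> - H s" and h="\<lambda>s. speed s / \<delta> - h s"])
      show "continuous_on ?I (\<lambda>s. speed s / \<delta> - h s)"
        using \<open>\<delta> > 0\<close> by (intro continuous_intros continuous_on_speed hc) auto
      show "((\<lambda>s. calib s / \<delta> - H s) has_real_derivative speed s / \<delta> - h s) (at s within ?I)" if "s \<in> ?I" for s
        using that by (intro DERIV_diff DERIV_cdivide calib_deriv HD)
    qed (use h0 in auto)
    also have "(LINT z:?A|lborel. rate z * (speed (height z) / \<delta> - h (height z))) =
      (LINT z:?A|lborel. rate z * speed (height z) / \<delta> - rate z * h (height z))"
      by (simp add: right_diff_distrib)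
    also have "\<dots> = (LINT z:?A|lborel. rate z * speed (height z)) / \<delta> - (LINT z:?A|lborel. rate z * h (height z))"
      using fs fh by (subst set_integral_diff(2)) (auto intro: set_integrable_divide)
    finally have "K * (LINT z:?A|lborel. rate z * h (height z)) \<le> K * ((LINT z:?A|lborel. rate z * speed (height z)) / \<delta>)
       + H (height (- real n)) - H (height n) - (calib (height (- real n)) - calib (height n)) / \<delta>"
      by (simp add: abs_le_iff algebra_simps diff_divide_distrib)
    also have "\<dots> \<le> (K / 2 * tension) / \<delta> + 2 * w0 - (calib (height (- real n)) - calib (height n)) / \<delta>"
    proof -
      have "(LINT z:?A|lborel. rate z * speed (height z)) \<le> tension / 2"
        using order_trans[OF rate_speed_le rate_speed_le_energy] E by simp
      then have "K * (LINT z:?A|lborel. rate z * speed (height z)) / \<delta> \<le> (K / 2 * tension) / \<delta>"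
        using K_pos \<open>\<delta> > 0\<close> by (intro divide_right_mono) auto
      then show ?thesis using H0[OF wI[of n]] H0[OF wI[of "- real n"]] by simp
    qed
    finally show ?thesis by (simp add: rem_def diff_divide_distrib)
  qed
  have "K * (LINT z:{a..b}|lborel. rate z * h (height z)) \<le> 2 * w0"
  proof (rule LIMSEQ_le_const)
    have "(\<lambda>n. 2 * w0 + rem n / \<delta>) \<longlonglongrightarrow> 2 * w0 + (K / 2 * tension - K / 2 * tension) / \<delta>"
      unfolding rem_def using \<open>\<delta> > 0\<close> by (intro tendsto_intros calib_height_tendsto) auto
    then show "(\<lambda>n. 2 * w0 + rem n / \<delta>) \<longlonglongrightarrow> 2 * w0" by simp
    obtain N :: nat where N: "max \<bar>a\<bar> \<bar>b\<bar> \<le> N" using real_arch_simple by blast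
    have "K * (LINT z:{a..b}|lborel. rate z * h (height z)) \<le> 2 * w0 + rem n / \<delta>" if "N \<le> n" for n
    proof -
      have "(LINT z:{a..b}|lborel. rate z * h (height z)) \<le> (LINT z:{-real n..real n}|lborel. rate z * h (height z))"
        unfolding set_lebesgue_integral_def
        by (intro integral_mono fh[unfolded set_integrable_def])
          (use N that rate_nonneg h0(1)[OF wI] in \<open>auto simp: indicator_def\<close>)
      then show ?thesis using bd[of n] K_pos by (meson order_trans mult_left_mono less_imp_le)
    qed
    then show "\<exists>N. \<forall>n\<ge>N. K * (LINT z:{a..b}|lborel. rate z * h (height z)) \<le> 2 * w0 + rem n / \<delta>"
      by blast
  qed
  then show ?thesis by (simp add: h_def)
qed

lemma optimal_length:
  assumes E: "energy V \<Psi> = tension"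
  shows "K * (LINT z:{a..b}|lborel. rate z) \<le> 2 * w0"
proof (rule LIMSEQ_le_const2)
  let ?d = "\<lambda>n. 1 / real (Suc n)"
  let ?h = "\<lambda>n z. speed (height z) / (speed (height z) + ?d n)"
  show "\<exists>N. \<forall>n\<ge>N. K * (LINT z:{a..b}|lborel. rate z * ?h n z) \<le> 2 * w0"
    using regularized_length[OF E] by auto
  have "(\<lambda>n. LINT z|lborel. indicator {a..b} z *\<^sub>R (rate z * ?h n z)) \<longlonglongrightarrow> (LINT z|lborel. indicator {a..b} z *\<^sub>R rate z)"
  proof (rule integral_dominated_convergence[where w="\<lambda>z. indicator {a..b} z *\<^sub>R rate z"])
    show "AE z in lborel. (\<lambda>n. indicator {a..b} z *\<^sub>R (rate z * ?h n z)) \<longlonglongrightarrow> indicator {a..b} z *\<^sub>R rate z"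
      using optimal_speed[OF E]
    proof eventually_elim
      case (elim z)
      show ?case
      \<comment> \<open>Where the speed vanishes the quotient is 0 for every \<open>n\<close> and
        does not tend to 1; there the rate is 0 as well by \<open>optimal_speed\<close>.\<close>
      proof (cases "speed (height z) = 0")
        case False
        have "(\<lambda>n. ?h n z) \<longlonglongrightarrow> speed (height z) / (speed (height z) + 0)"
          using False by (intro tendsto_intros LIMSEQ_Suc[OF lim_1_over_n]) auto
        then have "(\<lambda>n. indicator {a..b} z *\<^sub>R (rate z * ?h n z)) \<longlonglongrightarrow> indicator {a..b} z *\<^sub>R (rate z * 1)"
          using False by (intro tendsto_intros) auto
        then show ?thesis by simp
      qed (simp add: elim)
    qed
    show "AE z in lborel. norm (indicator {a..b} z *\<^sub>R (rate z * ?h n z)) \<le> indicator {a..b} z *\<^sub>R rate z" for n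
    proof (rule AE_I2)
      fix z
      have "0 \<le> ?h n z" "?h n z \<le> 1" using speed_height_nonneg[of z] by (auto simp: divide_le_eq_1 add_nonneg_pos)
      moreover have "norm (indicator {a..b} z *\<^sub>R (rate z * t)) \<le> indicator {a..b} z *\<^sub>R rate z" if "0 \<le> t" "t \<le> 1" for t
        using that rate_nonneg[of z] mult_left_mono[of t 1 "rate z"] by (auto simp: indicator_def)
      ultimately show "norm (indicator {a..b} z *\<^sub>R (rate z * ?h n z)) \<le> indicator {a..b} z *\<^sub>R rate z"
        by blast
    qed
  qed (use rate_int rate_meas speed_height_meas in \<open>auto simp: set_integrable_def\<close>)
  then show "(\<lambda>n. K * (LINT z:{a..b}|lborel. rate z * ?h n z)) \<longlonglongrightarrow> K * (LINT z:{a..b}|lborel. rate z)"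
    unfolding set_lebesgue_integral_def by (intro tendsto_intros)
qed

text \<open>The chord between two points of the path is no longer than the arc, whose length is
  bounded uniformly in the interval; the end points are reached in the limit.\<close>

lemma optimal_endpoints_dist:
  assumes E: "energy V \<Psi> = tension"
  shows "norm (Ap - Am) \<le> 2 * w0 / K"
proof (rule LIMSEQ_le_const2)
  show "(\<lambda>n. norm (\<Psi> (real n) - \<Psi> (- real n))) \<longlonglongrightarrow> norm (Ap - Am)"
  proof -
    have "filterlim (\<lambda>n. - real n) at_bot sequentially"
      by (simp add: filterlim_real_sequentially filterlim_uminus_at_bot)
    then have "(\<lambda>n. \<Psi> (- real n)) \<longlonglongrightarrow> Am" "(\<lambda>n. \<Psi> (real n)) \<longlonglongrightarrow> Ap"
      using adm filterlim_real_sequentially by (auto simp: admissible_def intro: filterlim_compose)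
    then show ?thesis by (intro tendsto_intros)
  qed
  have "norm (\<Psi> (real n) - \<Psi> (- real n)) \<le> 2 * w0 / K" for n
    using chord_le[of "- real n" "real n"] optimal_length[OF E, of "- real n" "real n"] K_pos
    by (simp add: field_simps) (meson order_trans mult_left_mono less_imp_le)
  then show "\<exists>N. \<forall>n\<ge>N. norm (\<Psi> (real n) - \<Psi> (- real n)) \<le> 2 * w0 / K"
    by blast
qed

end

end

section \<open>Continuously differentiable paths\<close>

lemma bounded_bilinear_matrix_mult: "bounded_bilinear ((**) :: mat5 \<Rightarrow> mat5 \<Rightarrow> mat5)"
  unfolding bilinear_conv_bounded_bilinear[symmetric] bilinear_def
  by (auto intro!: linearI simp: matrix_mult_distribs mult_scaleR_left mult_scaleR_right)

lemma bounded_linear_dagger: "bounded_linear dagger"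
  unfolding linear_conv_bounded_linear[symmetric]
  by (auto intro!: linearI simp: dagger_add dagger_scaleR)

lemma bounded_linear_trace: "bounded_linear (trace :: mat5 \<Rightarrow> complex)"
  unfolding linear_conv_bounded_linear[symmetric]
  by (auto intro!: linearI simp: trace_add trace_scaleR)

lemmas has_vector_derivative_matrix_mult =
  bounded_bilinear.has_vector_derivative[OF bounded_bilinear_matrix_mult]

lemmas continuous_on_matrix_mult = bounded_bilinear.continuous_on[OF bounded_bilinear_matrix_mult]

lemmas tendsto_matrix_mult = bounded_bilinear.tendsto[OF bounded_bilinear_matrix_mult]

lemmas continuous_on_dagger = bounded_linear.continuous_on[OF bounded_linear_dagger]

lemmas tendsto_dagger = bounded_linear.tendsto[OF bounded_linear_dagger]

lemmas has_vector_derivative_dagger = bounded_linear.has_vector_derivative[OF bounded_linear_dagger]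

lemma continuous_on_trace: "continuous_on S A \<Longrightarrow> continuous_on S (\<lambda>x. trace (A x :: mat5))"
  by (rule bounded_linear.continuous_on[OF bounded_linear_trace])

lemma derivative_in_h0:
  assumes D: "(\<Psi> has_vector_derivative D) (at z)" and h: "\<And>z. \<Psi> z \<in> h0"
  shows "D \<in> h0"
proof -
  have "(\<lambda>z. dagger (\<Psi> z)) = \<Psi>" "(\<lambda>z. trace (\<Psi> z)) = (\<lambda>z. 0)"
    using h by (auto simp: h0_def)
  then have d: "(\<Psi> has_vector_derivative dagger D) (at z)" "((\<lambda>z. 0) has_vector_derivative trace D) (at z)"
    using has_vector_derivative_dagger[OF D] bounded_linear.has_vector_derivative[OF bounded_linear_trace D] by auto
  have "D = dagger D" using D d(1) by (rule vector_derivative_unique_at)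
  moreover have "0 = trace D" using has_vector_derivative_const d(2) by (rule vector_derivative_unique_at)
  ultimately show ?thesis by (simp add: h0_def)
qed

lemma frob_meas: "frob \<in> borel_measurable borel"
proof -
  have "continuous_on UNIV (\<lambda>Q :: mat5. sqrt (Re (trace (Q ** Q))))"
    by (intro continuous_on_real_sqrt continuous_on_Re continuous_on_trace continuous_on_matrix_mult continuous_on_id)
  then show ?thesis
    by (simp add: frob_def[abs_def] rtrace_def borel_measurable_continuous_onI)
qed

lemma loc_integrable_imp_measurable:
  fixes g :: "real \<Rightarrow> mat5"
  assumes "loc_integrable g"
  shows "g \<in> borel_measurable lborel"
proof (rule borel_measurable_LIMSEQ_metric)
  show "(\<lambda>z. indicator {-real n..real n} z *\<^sub>R g z) \<in> borel_measurable lborel" for n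
    using assms[unfolded loc_integrable_def, rule_format, of "-real n" "real n"]
    by (auto simp: set_integrable_def)
  show "(\<lambda>n. indicator {-real n..real n} z *\<^sub>R g z) \<longlonglongrightarrow> g z" for z
  proof (rule tendsto_eventually)
    obtain N :: nat where "\<bar>z\<bar> \<le> N" using real_arch_simple by blast
    then show "eventually (\<lambda>n. indicator {-real n..real n} z *\<^sub>R g z = g z) sequentially"
      by (auto simp: eventually_sequentially abs_le_iff indicator_def intro!: exI[of _ N])
  qed
qed

text \<open>\<open>energy\<close> and \<open>admissible\<close> refer to a chosen weak derivative;
  by uniqueness almost everywhere it may be exchanged for the classical one, so that explicit paths
  can be evaluated.\<close>

lemma C1_admissible:
  assumes D: "\<And>z. (\<Psi> has_vector_derivative \<Psi>' z) (at z)" and c': "continuous_on UNIV \<Psi>'"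
    and h: "\<And>z. \<Psi> z \<in> h0"
    and i1: "integrable lborel (\<lambda>z. (norm (\<Psi>' z))^2)" and i2: "integrable lborel (\<lambda>z. V (\<Psi> z))"
    and l: "(\<Psi> \<longlongrightarrow> Am) at_bot" "(\<Psi> \<longlongrightarrow> Ap) at_top"
  shows "\<Psi> \<in> admissible V Am Ap"
    and "energy V \<Psi> = (LINT z|lborel. (norm (\<Psi>' z))^2) + (LINT z|lborel. V (\<Psi> z))"
proof -
  have c: "continuous_on UNIV \<Psi>"
    using D by (intro continuous_at_imp_continuous_on ballI has_vector_derivative_continuous)
  have wd: "has_weak_deriv \<Psi> \<Psi>'" by (rule C1_has_weak_deriv[OF D c'])
  have h': "\<Psi>' z \<in> h0" for z using derivative_in_h0[OF D h] .
  have fr: "frob Q = norm Q" if "Q \<in> h0" for Q using that by (simp add: h0_def frob_eq_norm)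
  have L2: "L2_on {a..b} u" if "continuous_on UNIV u" "\<And>z. u z \<in> h0" for u a b
    unfolding L2_on_def set_borel_measurable_def
  proof (intro conjI)
    show "(\<lambda>z. indicator {a..b} z *\<^sub>R u z) \<in> borel_measurable lborel"
      using borel_measurable_continuous_onI[OF that(1)] by simp
    show "set_integrable lborel {a..b} (\<lambda>z. (frob (u z))^2)"
      unfolding fr[OF that(2)]
      by (intro borel_integrable_atLeastAtMost' continuous_intros continuous_on_subset[OF that(1)]) auto
  qed (use that in auto)
  have wd2: "has_weak_deriv \<Psi> (weak_deriv \<Psi>)" using wd by (rule has_weak_deriv_weak_deriv)
  have ae: "AE z in lborel. weak_deriv \<Psi> z = \<Psi>' z" by (rule weak_deriv_unique[OF wd2 wd c])
  have m: "weak_deriv \<Psi> \<in> borel_measurable lborel"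
    using wd2 loc_integrable_imp_measurable by (auto simp: has_weak_deriv_def)
  have m2: "(\<lambda>z. (frob (weak_deriv \<Psi> z))^2) \<in> borel_measurable lborel"
    using measurable_compose[OF m] frob_meas by (intro borel_measurable_power) auto
  have ae2: "AE z in lborel. (norm (\<Psi>' z))^2 = (frob (weak_deriv \<Psi> z))^2"
    using ae by eventually_elim (simp add: fr h')
  have i3: "integrable lborel (\<lambda>z. (frob (weak_deriv \<Psi> z))^2)"
    using i1 m2 ae2 by (rule integrable_cong_AE_imp)
  have "L2_on UNIV (weak_deriv \<Psi>)"
    unfolding L2_on_def set_borel_measurable_def set_integrable_def
    using ae h' m i3 by (auto elim!: AE_mp)
  then show "\<Psi> \<in> admissible V Am Ap"
    using c h L2[OF c h] L2[OF c' h'] wd i2 l by (auto simp: admissible_def H1_loc_def)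
  have "energy V \<Psi> = (LINT z|lborel. (frob (weak_deriv \<Psi> z))^2) + (LINT z|lborel. V (\<Psi> z))"
    unfolding energy_def using i3 i2 by simp
  also have "(LINT z|lborel. (frob (weak_deriv \<Psi> z))^2) = (LINT z|lborel. (norm (\<Psi>' z))^2)"
    using ae2 m2 i1 by (intro integral_cong_AE) (auto elim!: AE_mp)
  finally show "energy V \<Psi> = (LINT z|lborel. (norm (\<Psi>' z))^2) + (LINT z|lborel. V (\<Psi> z))" .
qed

text \<open>With \<open>t = tanh (c * (z - z0))\<close> one has
  \<open>dt = c * (1 - t^2) dz\<close>, so the integral is that of \<open>(1 - t^2) / c\<close> from
  -1 to 1.\<close>

lemma sech4_integral:
  fixes c z0 :: real
  assumes "c > 0"
  shows "integrable lborel (\<lambda>z. (1 - (tanh (c * (z - z0)))^2)^2)"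
    and "(LINT z|lborel. (1 - (tanh (c * (z - z0)))^2)^2) = 4 / (3 * c)"
proof -
  let ?t = "\<lambda>z. tanh (c * (z - z0))"
  let ?f = "\<lambda>z. (1 - (?t z)^2)^2" and ?F = "\<lambda>z. (?t z - (?t z)^3 / 3) / c"
  have F: "(?F has_real_derivative ?f z) (at z)" for z
    using assms by (auto intro!: derivative_eq_intros simp: field_simps power2_eq_square power3_eq_cube)
  have top: "filterlim (\<lambda>z. c * (z - z0)) at_top at_top" and bot: "filterlim (\<lambda>z. c * (z - z0)) at_bot at_bot"
    using assms by real_asymp+
  have t1: "(?F \<longlongrightarrow> (1 - 1^3/3) / c) at_top"
    by (intro tendsto_intros filterlim_compose[OF tanh_real_at_top top]) (use assms in auto)
  have t2: "(?F \<longlongrightarrow> (-1 - (-1)^3/3) / c) at_bot"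
    by (intro tendsto_intros filterlim_compose[OF tanh_real_at_bot bot]) (use assms in auto)
  have U: "einterval (-\<infinity>) \<infinity> = UNIV" by (simp add: einterval_def)
  have ft: "((?F \<circ> real_of_ereal) \<longlongrightarrow> (-1 - (-1)^3/3) / c) (at_right (-\<infinity>))"
    "((?F \<circ> real_of_ereal) \<longlongrightarrow> (1 - 1^3/3) / c) (at_left \<infinity>)"
    using t1 t2 by (simp_all add: at_left_PInf at_right_MInf filterlim_filtermap comp_def)
  have cont: "isCont ?f x" for x
    by (intro continuous_intros) auto
  have 1: "set_integrable lborel (einterval (-\<infinity>) \<infinity>) ?f"
    and 2: "(LBINT x=-\<infinity>..\<infinity>. ?f x) = (1 - 1^3/3) / c - (-1 - (-1)^3/3) / c"
    by (rule interval_integral_FTC_nonneg[OF _ F cont _ ft]; simp)+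
  show "integrable lborel ?f"
    using 1 by (simp add: U set_integrable_def)
  show "(LINT z|lborel. ?f z) = 4 / (3 * c)"
    using 2 assms by (simp add: interval_lebesgue_integral_def U set_lebesgue_integral_def field_simps)
qed

section \<open>Paths of unitary matrices\<close>

definition unitary_path :: "(real \<Rightarrow> mat5) \<Rightarrow> (real \<Rightarrow> mat5) \<Rightarrow> bool" where
  "unitary_path \<gamma> \<gamma>' \<longleftrightarrow> (\<forall>s. unitary (\<gamma> s)) \<and> (\<forall>s. (\<gamma> has_vector_derivative \<gamma>' s) (at s)) \<and>
    continuous_on UNIV \<gamma>'"

lemma unitary_path_continuous: "unitary_path \<gamma> \<gamma>' \<Longrightarrow> continuous_on S \<gamma>"
  unfolding unitary_path_def
  by (intro continuous_at_imp_continuous_on ballI has_vector_derivative_continuous) blast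

text \<open>A continuously differentiable path is required, since it will conjugate the kink and its
  velocity enters the energy.\<close>

definition joined_to_1 :: "mat5 \<Rightarrow> bool" where
  "joined_to_1 U \<longleftrightarrow> (\<exists>\<gamma> \<gamma>'. unitary_path \<gamma> \<gamma>' \<and> \<gamma> 0 = mat 1 \<and> \<gamma> 1 = U)"

lemma joined_to_1_unitary: "joined_to_1 U \<Longrightarrow> unitary U"
  by (auto simp: joined_to_1_def unitary_path_def)

lemma joined_to_1_mat_1: "joined_to_1 (mat 1)"
  unfolding joined_to_1_def unitary_path_def
  by (rule exI[of _ "\<lambda>_. mat 1"], rule exI[of _ "\<lambda>_. 0"]) (simp add: unitary_mat_1)

lemma joined_to_1_mult:
  assumes "joined_to_1 U" "joined_to_1 W"
  shows "joined_to_1 (U ** W)"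
proof -
  obtain g g' h h' where g: "unitary_path g g'" "g 0 = mat 1" "g 1 = U"
    and h: "unitary_path h h'" "h 0 = mat 1" "h 1 = W"
    using assms by (auto simp: joined_to_1_def)
  have "unitary_path (\<lambda>s. g s ** h s) (\<lambda>s. g s ** h' s + g' s ** h s)"
    using g(1) h(1) unitary_path_continuous[OF g(1)] unitary_path_continuous[OF h(1)]
    by (auto simp: unitary_path_def intro!: unitary_mult has_vector_derivative_matrix_mult
        continuous_on_add continuous_on_matrix_mult)
  then show ?thesis
    unfolding joined_to_1_def using g h
    by (intro exI[of _ "\<lambda>s. g s ** h s"] exI[of _ "\<lambda>s. g s ** h' s + g' s ** h s"]) auto
qed

section \<open>Complex reflections and orthonormal frames\<close>

definition outer :: "complex^5 \<Rightarrow> mat5" where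
  "outer v = (\<chi> i j. v $ i * cnj (v $ j))"

definition cinner :: "complex^5 \<Rightarrow> complex^5 \<Rightarrow> complex" where
  "cinner v w = (\<Sum>i\<in>UNIV. cnj (v $ i) * w $ i)"

lemma cinner_diff_right: "cinner v (w - x) = cinner v w - cinner v x"
  and cinner_diff_left: "cinner (v - w) x = cinner v x - cinner w x"
  and cnj_cinner: "cnj (cinner v w) = cinner w v"
  by (simp_all add: cinner_def algebra_simps sum_subtractf sum_distrib_left)

lemma cinner_self: "cinner v v = of_real ((norm v)^2)"
  by (rule complex_eqI)
    (simp_all add: cinner_def power2_norm_eq_inner inner_complex_vec mult.commute)

lemma cinner_self_eq_1: "cinner v v = 1 \<longleftrightarrow> norm v = 1"
proof -
  have "cinner v v = 1 \<longleftrightarrow> (norm v)^2 = 1"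
    unfolding cinner_self by (metis of_real_1 of_real_eq_iff)
  then show ?thesis using norm_ge_zero[of v] by (auto simp: power2_eq_1_iff)
qed

lemma cinner_unitary:
  assumes "unitary U"
  shows "cinner (U *v x) (U *v y) = cinner x y"
proof -
  have "cinner (U *v x) w = cinner x (dagger U *v w)" for w
  proof -
    have "cinner (U *v x) w = (\<Sum>i\<in>UNIV. \<Sum>j\<in>UNIV. cnj (U $ i $ j) * cnj (x $ j) * w $ i)"
      by (simp add: cinner_def matrix_vector_mult_def sum_distrib_right)
    also have "\<dots> = (\<Sum>j\<in>UNIV. \<Sum>i\<in>UNIV. cnj (U $ i $ j) * cnj (x $ j) * w $ i)"
      by (rule sum.swap)
    also have "\<dots> = cinner x (dagger U *v w)"
      by (simp add: cinner_def matrix_vector_mult_def sum_distrib_left mult_ac)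
    finally show ?thesis .
  qed
  then show ?thesis
    using assms by (simp add: matrix_vector_mul_assoc unitary_def)
qed

text \<open>The complex reflection \<open>1 + (e\<^bsup>i\<theta>\<^esup> - 1) v v\<^sup>\<dagger>\<close>, split into real and imaginary parts.\<close>

definition creflection :: "complex^5 \<Rightarrow> real \<Rightarrow> mat5" where
  "creflection v \<theta> = mat 1 + (cos \<theta> - 1) *\<^sub>R outer v + sin \<theta> *\<^sub>R (\<chi> i j. \<i> * outer v $ i $ j)"

lemma creflection_mult_vec: "creflection v \<theta> *v x = x + ((cis \<theta> - 1) * cinner v x) *s v"
proof -
  have "creflection v \<theta> $ i $ j = (mat 1 :: mat5) $ i $ j + (cis \<theta> - 1) * v $ i * cnj (v $ j)" for i j
    by (simp add: creflection_def outer_def complex_eq_iff algebra_simps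
        scaleR_conv_of_real[where 'a=complex])
  then have "(creflection v \<theta> *v x) $ i = (\<Sum>j\<in>UNIV. (mat 1 :: mat5) $ i $ j * x $ j) +
      (\<Sum>j\<in>UNIV. (cis \<theta> - 1) * v $ i * cnj (v $ j) * x $ j)" for i
    by (simp add: matrix_vector_mult_def distrib_right sum.distrib)
  moreover have "(\<Sum>j\<in>UNIV. (mat 1 :: mat5) $ i $ j * x $ j) = x $ i" for i
    using matrix_vector_mul_lid[of x] unfolding vec_eq_iff by (simp add: matrix_vector_mult_def)
  ultimately show ?thesis
    by (simp add: vec_eq_iff cinner_def sum_distrib_left mult_ac)
qed

lemma creflection_unitary:
  assumes "norm v = 1"
  shows "unitary (creflection v \<theta>)"
proof (rule unitaryI)
  let ?P = "outer v" and ?Q = "\<chi> i j. \<i> * outer v $ i $ j"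
  have vv: "(\<Sum>k\<in>UNIV. cnj (v $ k) * v $ k) = 1"
    using cinner_self[of v] assms by (simp add: cinner_def)
  have PP: "?P ** ?P = ?P"
  proof -
    have "(\<Sum>k\<in>UNIV. v $ i * cnj (v $ k) * (v $ k * cnj (v $ j))) = v $ i * cnj (v $ j) * (\<Sum>k\<in>UNIV. cnj (v $ k) * v $ k)" for i j
      by (simp add: sum_distrib_left mult_ac)
    then show ?thesis by (simp add: vec_eq_iff outer_def matrix_matrix_mult_def vv)
  qed
  have scale: "(\<chi> i j. c * ?P $ i $ j) ** (\<chi> i j. d * ?P $ i $ j) = (\<chi> i j. (c * d) * (?P ** ?P) $ i $ j)" for c d
    by (simp add: vec_eq_iff matrix_matrix_mult_def sum_distrib_left mult_ac)
  have "?P ** ?Q = ?Q" "?Q ** ?P = ?Q" "?Q ** ?Q = - ?P"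
    using scale[of 1 \<i>] scale[of \<i> 1] scale[of \<i> \<i>]
    by (simp_all add: PP vec_lambda_eta) (simp add: vec_eq_iff)
  note PQ = this
  have "dagger ?P = ?P" "dagger ?Q = - ?Q"
    by (simp_all add: vec_eq_iff outer_def mult.commute)
  note dag = this
  have zero: "(cos \<theta> - 1) + (cos \<theta> - 1) + (cos \<theta> - 1) * (cos \<theta> - 1) + sin \<theta> * sin \<theta> = 0"
    using sin_cos_squared_add[of \<theta>] by (simp add: power2_eq_square algebra_simps)
  have comb: "a *\<^sub>R X + (s *\<^sub>R Y + (a *\<^sub>R (X + a *\<^sub>R X + s *\<^sub>R Y) - s *\<^sub>R (Y + a *\<^sub>R Y - s *\<^sub>R X)))
      = (a + a + a * a + s * s) *\<^sub>R X" for a s :: real and X Y :: mat5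
    by (simp add: vec_eq_iff scaleR_conv_of_real[where 'a=complex] algebra_simps)
  show "creflection v \<theta> ** dagger (creflection v \<theta>) = mat 1"
    unfolding creflection_def
    by (simp add: dagger_add dagger_scaleR matrix_mult_distribs mult_scaleR_left mult_scaleR_right PP PQ dag
        bounded_bilinear.minus_right[OF bounded_bilinear_matrix_mult])
      (simp only: comb zero scaleR_zero_left)
qed

lemma creflection_joined:
  assumes "norm v = 1"
  shows "joined_to_1 (creflection v \<theta>)"
proof -
  let ?Q = "\<chi> i j. \<i> * outer v $ i $ j"
  have "unitary_path (\<lambda>s. creflection v (s * \<theta>))
      (\<lambda>s. (- sin (s * \<theta>) * \<theta>) *\<^sub>R outer v + (cos (s * \<theta>) * \<theta>) *\<^sub>R ?Q)"
    unfolding unitary_path_def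
  proof (intro conjI allI)
    show "((\<lambda>s. creflection v (s * \<theta>)) has_vector_derivative
        (- sin (s * \<theta>) * \<theta>) *\<^sub>R outer v + (cos (s * \<theta>) * \<theta>) *\<^sub>R ?Q) (at s)" for s
      unfolding creflection_def by (auto intro!: derivative_eq_intros)
  qed (auto intro!: creflection_unitary assms continuous_intros)
  then show ?thesis
    unfolding joined_to_1_def
    by (intro exI[of _ "\<lambda>s. creflection v (s * \<theta>)"] exI conjI) (assumption, simp_all add: creflection_def)
qed

text \<open>As in the real case the reflection acts along \<open>a - b\<close>, so it fixes
  everything orthogonal to both vectors. Over the complex numbers the factor -1 sends
  \<open>a\<close> to \<open>b\<close> only if their inner product is real, and a suitable phase
  replaces it.\<close>

lemma reflect_vector:
  assumes a: "norm a = 1" and b: "norm b = 1"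
  shows "\<exists>R. joined_to_1 R \<and> R *v a = b \<and> (\<forall>x. cinner a x = 0 \<longrightarrow> cinner b x = 0 \<longrightarrow> R *v x = x)"
proof (cases "a = b")
  case True
  then show ?thesis using joined_to_1_mat_1 by (intro exI[of _ "mat 1"]) auto
next
  case False
  define n where "n = norm (a - b)"
  define v where "v = (1 / n) *\<^sub>R (a - b)"
  define s where "s = cinner (a - b) a"
  have n0: "n > 0" using False by (simp add: n_def)
  have nv: "norm v = 1" using n0 by (simp add: v_def n_def)
  have s: "s = 1 - cinner b a" using cinner_self[of a] a by (simp add: s_def cinner_diff_left)
  have "cinner (a - b) (a - b) = s + cnj s"
    using cinner_self[of a] cinner_self[of b] a b cnj_cinner[of b a]
    by (simp add: s cinner_diff_left cinner_diff_right)
  then have ns: "s + cnj s = of_real (n^2)" by (simp add: cinner_self n_def)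
  have s0: "s \<noteq> 0" using ns n0 by auto
  \<comment> \<open>Solves \<open>(\<omega> - 1) * s = - (s + cnj s)\<close>, the right-hand side
    being minus the squared norm of \<open>a - b\<close>; its modulus is 1 because numerator and
    denominator are conjugate up to sign.\<close>
  define \<omega> where "\<omega> = - cnj s / s"
  have "cmod \<omega> = 1" using s0 by (simp add: \<omega>_def norm_divide)
  then have cis: "cis (Arg \<omega>) = \<omega>"
    using cis_Arg[of \<omega>] by (cases "\<omega> = 0") (auto simp: sgn_div_norm)
  have cv: "cinner v x = cinner (a - b) x / n" for x
    by (simp add: v_def cinner_def sum_divide_distrib scaleR_conv_of_real[where 'a=complex])
  have "(\<omega> - 1) * s = - (s + cnj s)"
    using s0 by (simp add: \<omega>_def field_simps)
  then have "(\<omega> - 1) * s = - of_real (n^2)" unfolding ns .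
  then have k: "(\<omega> - 1) * cinner v a = - of_real n"
    using n0 by (simp add: cv flip: s_def) (simp add: power2_eq_square)
  have "creflection v (Arg \<omega>) *v a = b"
    unfolding creflection_mult_vec cis k using n0
    by (simp add: vec_eq_iff v_def scaleR_conv_of_real[where 'a=complex])
  moreover have "creflection v (Arg \<omega>) *v x = x" if "cinner a x = 0" "cinner b x = 0" for x
    unfolding creflection_mult_vec using that by (simp add: cv cinner_diff_left)
  ultimately show ?thesis using creflection_joined[OF nv] by blast
qed

lemma cinner_axis: "cinner (axis i 1) (axis j 1) = (if i = j then 1 else 0)"
proof -
  have "cnj (axis i 1 $ k) * c = (if k = i then c else 0)" for k and c :: complex
    by (simp add: axis_def)
  then show ?thesis by (simp add: cinner_def) (simp add: axis_def)
qed

lemma mult_axis: "(A *v axis j 1) $ i = A $ i $ j" for A :: mat5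
proof -
  have "A $ i $ k * axis j 1 $ k = (if k = j then A $ i $ j else 0)" for k
    by (simp add: axis_def)
  then show ?thesis by (simp add: matrix_vector_mult_def)
qed

text \<open>Vectors are placed one at a time by a reflection that fixes those already in position.
  With all indices this joins every unitary matrix to the identity; with fewer it completes a
  partial orthonormal family to a basis.\<close>

lemma orthonormal_extension:
  fixes u :: "5 \<Rightarrow> complex^5"
  assumes "\<And>i j. i \<in> J \<Longrightarrow> j \<in> J \<Longrightarrow> cinner (u i) (u j) = (if i = j then 1 else 0)"
  shows "\<exists>W. joined_to_1 W \<and> (\<forall>j\<in>J. W *v axis j 1 = u j)"
  using finite[of J] assms
proof (induction J rule: finite_induct)
  case empty
  then show ?case using joined_to_1_mat_1 by blast
next
  case (insert k J)
  then obtain W where W: "joined_to_1 W" "\<And>j. j \<in> J \<Longrightarrow> W *v axis j 1 = u j" by blast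
  have uW: "unitary W" using W joined_to_1_unitary by blast
  have n1: "norm (W *v axis k 1) = 1" "norm (u k) = 1"
    using insert.prems[of k k] by (simp_all add: cinner_unitary[OF uW] cinner_axis flip: cinner_self_eq_1)
  obtain R where R: "joined_to_1 R" "R *v (W *v axis k 1) = u k"
    "\<And>x. cinner (W *v axis k 1) x = 0 \<Longrightarrow> cinner (u k) x = 0 \<Longrightarrow> R *v x = x"
    using reflect_vector[OF n1] by blast
  have "R *v (W *v axis j 1) = u j" if "j \<in> J" for j
  proof -
    have "j \<noteq> k" using that insert by auto
    then have "cinner (W *v axis k 1) (W *v axis j 1) = 0"
      by (simp add: cinner_unitary[OF uW] cinner_axis)
    moreover have "cinner (u k) (W *v axis j 1) = 0"
      using that \<open>j \<noteq> k\<close> insert.prems[of k j] W(2)[OF that] by auto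
    ultimately have "cinner (W *v axis k 1) (W *v axis j 1) = 0" "cinner (u k) (W *v axis j 1) = 0"
      by blast+
    then show ?thesis using R(3) W(2)[OF that] by simp
  qed
  then show ?case
    using R joined_to_1_mult[OF R(1) W(1)]
    by (intro exI[of _ "R ** W"]) (auto simp flip: matrix_vector_mul_assoc)
qed

theorem unitary_joined_to_1:
  assumes U: "unitary U"
  shows "joined_to_1 U"
proof -
  obtain W where W: "joined_to_1 W" "\<And>j. W *v axis j 1 = U *v axis j 1"
    using orthonormal_extension[of UNIV "\<lambda>j. U *v axis j 1"] by (auto simp: cinner_unitary[OF U] cinner_axis)
  have "W $ i $ j = U $ i $ j" for i j
    using W(2)[of j] mult_axis by metis
  then have "W = U" by (simp add: vec_eq_iff)
  then show ?thesis using W(1) by simp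
qed

section \<open>The explicit kinks\<close>

primrec kink_amplitude :: "regime \<Rightarrow> real \<Rightarrow> real \<Rightarrow> real \<Rightarrow> real" where
  "kink_amplitude A_type \<mu> h lam = sqrt 5 * \<mu> / (2 * sqrt lam)"
| "kink_amplitude B_type \<mu> h lam = 3 * \<mu> / (4 * sqrt h)"

primrec kink_centre :: "regime \<Rightarrow> real list" where
  "kink_centre A_type = [1, 1, -1, -1, 0]"
| "kink_centre B_type = [0, 0, 0, 1, -1]"

primrec kink_direction :: "regime \<Rightarrow> real list" where
  "kink_direction A_type = [1, 1, 1, 1, -4]"
| "kink_direction B_type = [2, 2, 2, -3, -3]"

definition kink_velocity :: "regime \<Rightarrow> real \<Rightarrow> real \<Rightarrow> real \<Rightarrow> mat5" where
  "kink_velocity r \<mu> h lam = (kink_amplitude r \<mu> h lam / 5) *\<^sub>R diag5 (kink_direction r)"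

text \<open>The kink as an affine function of \<open>t = tanh (\<mu> / sqrt 2 * z)\<close>: a
  straight segment with the two vacua at \<open>t = -1\<close> and \<open>t = 1\<close>.\<close>

definition kink_profile :: "regime \<Rightarrow> real \<Rightarrow> real \<Rightarrow> real \<Rightarrow> real \<Rightarrow> mat5" where
  "kink_profile r \<mu> h lam t =
    kink_amplitude r \<mu> h lam *\<^sub>R diag5 (kink_centre r) + t *\<^sub>R kink_velocity r \<mu> h lam"

lemma kink_eq_profile: "kink r \<mu> h lam z = kink_profile r \<mu> h lam (tanh (\<mu> / sqrt 2 * z))"
  by (cases r) (simp_all add: kink_profile_def kink_velocity_def scaleR_add_right mult_ac)

lemma kink_profile_diag:
  "kink_profile r \<mu> h lam t = diag_mat (\<lambda>i. kink_amplitude r \<mu> h lam *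
    (vector (kink_centre r) $ i + t / 5 * vector (kink_direction r) $ i))"
  unfolding kink_profile_def kink_velocity_def diag5_eq_diag_mat diag_mat_scaleR diag_mat_add
  by (simp add: algebra_simps)

primrec plus_entries :: "regime \<Rightarrow> real list" where
  "plus_entries A_type = [3, 3, -2, -2, -2]"
| "plus_entries B_type = [1, 1, 1, 1, -4]"

primrec minus_entries :: "regime \<Rightarrow> real list" where
  "minus_entries A_type = [2, 2, -3, -3, 2]"
| "minus_entries B_type = [-1, -1, -1, 4, -1]"

lemma vac_diag:
  "vac_plus r \<mu> h lam = diag_mat (\<lambda>i. vac_scale r \<mu> h lam * vector (plus_entries r) $ i)"
  "vac_minus r \<mu> h lam = diag_mat (\<lambda>i. vac_scale r \<mu> h lam * vector (minus_entries r) $ i)"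
  by (cases r; simp add: diag5_eq_diag_mat diag_mat_scaleR)+

lemma diag_mat_cong5:
  assumes "x 1 = y 1" "x 2 = y 2" "x 3 = y 3" "x 4 = y 4" "x 5 = y 5"
  shows "diag_mat x = diag_mat y"
proof -
  have "x i = y i" for i using assms exhaust_5[of i] by auto
  then show ?thesis by presburger
qed

lemma kink_profile_ends:
  "kink_profile r \<mu> h lam 1 = vac_plus r \<mu> h lam"
  "kink_profile r \<mu> h lam (-1) = vac_minus r \<mu> h lam"
  unfolding kink_profile_diag vac_diag
  by (cases r; intro diag_mat_cong5; simp add: field_simps)+

lemma kink_profile_in_h0: "kink_profile r \<mu> h lam t \<in> h0"
  unfolding kink_profile_diag diag_mat_in_h0
  by (cases r) (simp_all add: sum_5 algebra_simps)

lemma kink_deriv: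
  "((\<lambda>z. kink r \<mu> h lam (z - z0)) has_vector_derivative
    (\<mu> / sqrt 2 * (1 - (tanh (\<mu> / sqrt 2 * (z - z0)))^2)) *\<^sub>R kink_velocity r \<mu> h lam) (at z)"
proof -
  have D: "((\<lambda>z. tanh (c * (z - z0))) has_real_derivative c * (1 - (tanh (c * (z - z0)))^2)) (at z)" for c
    by (auto intro!: derivative_eq_intros)
  from has_vector_derivative_add[OF has_vector_derivative_const
      has_vector_derivative_scaleR[OF D[of "\<mu> / sqrt 2"] has_vector_derivative_const]]
  show ?thesis
    unfolding kink_eq_profile kink_profile_def by simp
qed

lemma kink_limits:
  assumes "\<mu> > 0"
  shows "((\<lambda>z. kink r \<mu> h lam (z - z0)) \<longlongrightarrow> vac_minus r \<mu> h lam) at_bot"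
    and "((\<lambda>z. kink r \<mu> h lam (z - z0)) \<longlongrightarrow> vac_plus r \<mu> h lam) at_top"
proof -
  define c where "c = \<mu> / sqrt 2"
  have "c > 0" using assms by (simp add: c_def)
  then have lim: "filterlim (\<lambda>z. c * (z - z0)) at_bot at_bot" "filterlim (\<lambda>z. c * (z - z0)) at_top at_top"
    by real_asymp+
  show "((\<lambda>z. kink r \<mu> h lam (z - z0)) \<longlongrightarrow> vac_minus r \<mu> h lam) at_bot"
    unfolding kink_eq_profile c_def[symmetric] kink_profile_ends[symmetric] kink_profile_def
    by (intro tendsto_intros filterlim_compose[OF tanh_real_at_bot lim(1)])
  show "((\<lambda>z. kink r \<mu> h lam (z - z0)) \<longlongrightarrow> vac_plus r \<mu> h lam) at_top"
    unfolding kink_eq_profile c_def[symmetric] kink_profile_ends[symmetric] kink_profile_def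
    by (intro tendsto_intros filterlim_compose[OF tanh_real_at_top lim(2)])
qed

lemma vac_in_h0: "vac_plus r \<mu> h lam \<in> h0" "vac_minus r \<mu> h lam \<in> h0"
  unfolding kink_profile_ends[symmetric] by (rule kink_profile_in_h0)+

locale regime_parameters =
  fixes r :: regime and \<mu> h lam V0 :: real
  assumes reg: "in_regime r \<mu> h lam V0" and \<mu>: "\<mu> > 0"
begin

abbreviation "pot \<equiv> potential \<mu> h lam V0"
abbreviation "vac_p \<equiv> vac_plus r \<mu> h lam"
abbreviation "vac_m \<equiv> vac_minus r \<mu> h lam"
abbreviation "w_max \<equiv> order_bound r \<mu> h lam"
abbreviation "k_well \<equiv> well_scale r \<mu> h lam"
abbreviation "wall \<equiv> wall_tension r \<mu> h lam"
abbreviation "velocity \<equiv> kink_velocity r \<mu> h lam"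

lemma kink_amplitude_sq:
  "(kink_amplitude r \<mu> h lam)^2 = (case r of A_type \<Rightarrow> 5 * \<mu>^2 / (4 * lam) | B_type \<Rightarrow> 9 * \<mu>^2 / (16 * h))"
  using reg by (cases r) (simp_all add: power_divide power_mult_distrib)

lemma well_scale_sq:
  "k_well^2 = (case r of A_type \<Rightarrow> \<mu>^4 / (2 * lam) | B_type \<Rightarrow> 27/80 * \<mu>^4 / h)"
  using reg by (cases r) (simp_all add: power_divide power_mult_distrib flip: power_mult)

text \<open>Equipartition: this makes the kinetic density of the kink equal to its potential
  density, both being \<open>k_well^2 * (1 - t^2)^2\<close>.\<close>

lemma norm_kink_velocity:
  "(norm velocity)^2 * (\<mu> / sqrt 2)^2 = k_well^2"
proof -
  have "(norm (diag_mat x))^2 = (\<Sum>i\<in>UNIV. x i ^ 2)" for x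
    unfolding power2_norm_eq_inner
    by (simp add: inner_hermitian diag_mat_mult rtrace_diag_mat power2_eq_square)
  then have nv: "(norm velocity)^2 =
      (kink_amplitude r \<mu> h lam)^2 / 25 * (\<Sum>i\<in>UNIV. (vector (kink_direction r) $ (i::5))^2)"
    unfolding kink_velocity_def diag5_eq_diag_mat diag_mat_scaleR
    by (simp add: power_mult_distrib power_divide sum_distrib_left)
  show ?thesis
    using reg \<mu> unfolding nv kink_amplitude_sq well_scale_sq
    by (cases r) (simp_all add: sum_5 power_divide field_simps power2_eq_square power4_eq_xxxx)
qed

lemma potential_kink_profile:
  "pot (kink_profile r \<mu> h lam t) = k_well^2 * (1 - t^2)^2"
proof (cases r)
  case A_type
  then have p: "lam > 0" "h = - (3/20) * lam" "V0 = 3 * \<mu>^4 / lam" using reg by auto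
  define c where "c = kink_amplitude r \<mu> h lam"
  have c2: "c^2 = 5 * \<mu>^2 / (4 * lam)" using kink_amplitude_sq by (simp add: c_def A_type)
  \<comment> \<open>With \<open>s = t/5\<close>, the polynomials \<open>4 + 20 * s^2\<close> and
    \<open>4 + 24 * s^2 + 260 * s^4\<close> are the power sums of degree 2 and 4 of the diagonal
    entries divided by \<open>c\<close>.\<close>
  have "pot (kink_profile r \<mu> h lam t) =
    - (\<mu>^2) * (c^2 * (4 + 20 * (t/5)^2)) + h * (c^2 * (4 + 20 * (t/5)^2))^2
    + lam * ((c^2)^2 * (4 + 24 * (t/5)^2 + 260 * (t/5)^4)) + V0"
    unfolding kink_profile_diag potential_diag_mat c_def[symmetric]
    by (simp add: A_type sum_5 power2_eq_square power4_eq_xxxx field_simps)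
  also have "\<dots> = \<mu>^4 / (2 * lam) * (1 - t^2)^2"
    unfolding c2 p(2,3) using p(1) by (simp add: field_simps power2_eq_square power4_eq_xxxx)
  finally show ?thesis using well_scale_sq by (simp add: A_type)
next
  case B_type
  then have p: "h > 0" "lam = - (10/9) * h" "V0 = 9 * \<mu>^4 / (10 * h)" using reg by auto
  define c where "c = kink_amplitude r \<mu> h lam"
  have c2: "c^2 = 9 * \<mu>^2 / (16 * h)" using kink_amplitude_sq by (simp add: c_def B_type)
  have "pot (kink_profile r \<mu> h lam t) =
    - (\<mu>^2) * (c^2 * (2 + 30 * (t/5)^2)) + h * (c^2 * (2 + 30 * (t/5)^2))^2
    + lam * ((c^2)^2 * (2 + 108 * (t/5)^2 + 210 * (t/5)^4)) + V0"
    unfolding kink_profile_diag potential_diag_mat c_def[symmetric]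
    by (simp add: B_type sum_5 power2_eq_square power4_eq_xxxx field_simps)
  also have "\<dots> = 27/80 * \<mu>^4 / h * (1 - t^2)^2"
    unfolding c2 p(2,3) using p(1) by (simp add: field_simps power2_eq_square power4_eq_xxxx)
  finally show ?thesis using well_scale_sq by (simp add: B_type)
qed

text \<open>The factor 2 counts the equal kinetic and potential parts, and the last factor is the
  value from \<open>sech4_integral\<close> for \<open>c = \<mu> / sqrt 2\<close>.\<close>

lemma wall_tension_eq:
  "wall = 2 * (k_well^2 * (4 / (3 * (\<mu> / sqrt 2))))"
  using reg \<mu> unfolding well_scale_sq
  by (cases r) (simp_all add: field_simps power2_eq_square power3_eq_cube power4_eq_xxxx)

lemma kink_speed:
  "(norm ((\<mu> / sqrt 2 * (1 - (tanh (\<mu> / sqrt 2 * (z - z0)))^2)) *\<^sub>R velocity))^2 =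
    k_well^2 * (1 - (tanh (\<mu> / sqrt 2 * (z - z0)))^2)^2"
  unfolding norm_kink_velocity[symmetric]
  by (simp only: norm_scaleR power_mult_distrib power2_abs mult_ac)

lemma conjugated_kink_admissible:
  fixes z0 :: real
  assumes U: "unitary U"
  defines "\<Psi> \<equiv> \<lambda>z. su_conj U (kink r \<mu> h lam (z - z0))"
  shows "\<Psi> \<in> admissible pot (su_conj U vac_m) (su_conj U vac_p)"
    and "energy pot \<Psi> = wall"
proof -
  let ?V = "pot" and ?s = "\<lambda>z. 1 - (tanh (\<mu> / sqrt 2 * (z - z0)))^2"
  let ?D = "\<lambda>z. (\<mu> / sqrt 2 * ?s z) *\<^sub>R velocity"
  have lin: "bounded_linear (su_conj U)"
    unfolding linear_conv_bounded_linear[symmetric] by (intro linearI) (simp_all add: su_conj_add su_conj_scaleR)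
  have \<mu>': "\<mu> / sqrt 2 > 0" using \<mu> by simp
  have n: "(norm (su_conj U (?D z)))^2 = k_well^2 * (?s z)^2" for z
    unfolding norm_su_conj[OF U] by (rule kink_speed)
  have v: "?V (\<Psi> z) = k_well^2 * (?s z)^2" for z
    unfolding \<Psi>_def potential_su_conj[OF U] kink_eq_profile by (rule potential_kink_profile)
  have D: "(\<Psi> has_vector_derivative su_conj U (?D z)) (at z)" for z
    unfolding \<Psi>_def by (rule bounded_linear.has_vector_derivative[OF lin kink_deriv])
  have c: "continuous_on UNIV (\<lambda>z. su_conj U (?D z))"
    by (intro bounded_linear.continuous_on[OF lin] continuous_intros) auto
  have h: "\<Psi> z \<in> h0" for z
    unfolding \<Psi>_def kink_eq_profile by (intro su_conj_in_h0 U kink_profile_in_h0)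
  have i: "integrable lborel (\<lambda>z. k_well^2 * (?s z)^2)"
    by (intro integrable_mult_right sech4_integral[OF \<mu>'])
  have l: "(\<Psi> \<longlongrightarrow> su_conj U vac_m) at_bot" "(\<Psi> \<longlongrightarrow> su_conj U vac_p) at_top"
    unfolding \<Psi>_def by (intro bounded_linear.tendsto[OF lin] kink_limits \<mu>)+
  note C1 = C1_admissible[OF D c h _ _ l, of ?V, unfolded n v, OF i i]
  show "\<Psi> \<in> admissible ?V (su_conj U vac_m) (su_conj U vac_p)"
    by (rule C1(1))
  show "energy ?V \<Psi> = wall"
    using C1(2) sech4_integral(2)[OF \<mu>'] by (simp add: wall_tension_eq)
qed

end

section \<open>Slowly rotated kinks\<close>

lemma norm_dagger: "norm (dagger A) = norm A"
  by (simp add: norm_eq_sqrt_inner inner_matrix trace_mul_sym[of A])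

lemma norm_unitary: "unitary U \<Longrightarrow> norm U = sqrt 5"
  by (simp add: norm_eq_sqrt_inner inner_matrix unitary_def trace_def mat_def)

lemma norm_triple_le: "\<exists>B>0. \<forall>(X::mat5) (Y::mat5) (Z::mat5). norm (X ** Y ** Z) \<le> B * (norm X * norm Y * norm Z)"
proof -
  from bounded_bilinear.pos_bounded[OF bounded_bilinear_matrix_mult]
  obtain K where "K > 0 \<and> (\<forall>(X::mat5) (Y::mat5). norm (X ** Y) \<le> norm X * norm Y * K)" ..
  then have K: "K > 0" "\<And>(X::mat5) (Y::mat5). norm (X ** Y) \<le> norm X * norm Y * K" by simp_all
  have "norm (X ** Y ** Z) \<le> (K * K) * (norm X * norm Y * norm Z)" for X Y Z :: mat5
  proof -
    have "norm (X ** Y ** Z) \<le> norm (X ** Y) * norm Z * K" by (rule K)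
    also have "\<dots> \<le> (norm X * norm Y * K) * norm Z * K"
      using K by (intro mult_right_mono) auto
    finally show ?thesis by (simp add: mult_ac)
  qed
  then show ?thesis using K by (intro exI[of _ "K * K"]) auto
qed

lemma young_norm_sq:
  fixes X Y :: "'a::real_normed_vector"
  assumes "\<eta> > 0"
  shows "(norm (X + Y))^2 \<le> (1 + \<eta>) * (norm X)^2 + (1 + 1/\<eta>) * (norm Y)^2"
proof -
  have "(norm (X + Y))^2 \<le> (norm X + norm Y)^2"
    by (intro power_mono norm_triangle_ineq) auto
  also have "\<dots> \<le> (1 + \<eta>) * (norm X)^2 + (1 + 1/\<eta>) * (norm Y)^2"
  proof -
    have "0 \<le> (\<eta> * norm X - norm Y)^2 / \<eta>" using assms by simp
    also have "\<dots> = \<eta> * (norm X)^2 - 2 * norm X * norm Y + (norm Y)^2 / \<eta>"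
      using assms by (simp add: field_simps power2_eq_square)
    finally show ?thesis by (simp add: power2_sum algebra_simps)
  qed
  finally show ?thesis .
qed

context regime_parameters
begin

text \<open>Conjugating the kink by a unitary path leaves the potential energy unchanged; when the path is
  traversed at rate \<open>\<epsilon>\<close> the extra kinetic energy is of order \<open>\<epsilon>\<close>, apart from a cross term that Young's
  inequality absorbs.\<close>

lemma rotated_kink:
  assumes U1: "unitary U1" and U2: "unitary U2"
  shows "\<exists>C\<ge>0. \<forall>\<epsilon>>0. \<forall>\<eta>>0. \<exists>\<Psi>\<in>admissible pot
      (su_conj U1 vac_m) (su_conj U2 vac_p).
    energy pot \<Psi> \<le> wall + \<eta> * wall + (1 + 1/\<eta>) * (C * \<epsilon>)"
proof -
  let ?V = "pot" and ?k = "kink r \<mu> h lam" and ?\<sigma> = "wall"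
  let ?s = "\<lambda>z. 1 - (tanh (\<mu> / sqrt 2 * (z - 0)))^2"
  let ?D = "\<lambda>z. (\<mu> / sqrt 2 * ?s z) *\<^sub>R velocity"
  have \<mu>': "\<mu> / sqrt 2 > 0" using \<mu> by simp
  \<comment> \<open>Multiplied by \<open>U1\<close> from the right, this path leads from
    \<open>U1\<close> to \<open>U2\<close>.\<close>
  obtain g g' where g: "unitary_path g g'" "g 0 = mat 1" "g 1 = U2 ** dagger U1"
    using unitary_joined_to_1[OF unitary_mult[OF U2 unitary_dagger[OF U1]]] by (auto simp: joined_to_1_def)
  have gu: "unitary (g s)" and gD: "(g has_vector_derivative g' s) (at s)" and g'c: "continuous_on S g'" for s S
    using g(1) continuous_on_subset by (auto simp: unitary_path_def)
  have gc: "continuous_on UNIV g" using unitary_path_continuous[OF g(1)] .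
  obtain M where M: "\<forall>s\<in>{0..1}. norm (g' s) \<le> M"
    using compact_imp_bounded[OF compact_continuous_image[OF g'c compact_Icc, of 0 1]] by (auto simp: bounded_iff)
  obtain L where L: "L > 0" "\<And>(X::mat5) (Y::mat5) (Z::mat5). norm (X ** Y ** Z) \<le> L * (norm X * norm Y * norm Z)"
    using norm_triple_le by blast
  define N where "N = norm (kink_amplitude r \<mu> h lam *\<^sub>R diag5 (kink_centre r)) + norm velocity"
  have kN: "norm (?k z) \<le> N" for z
  proof -
    have "\<bar>tanh (\<mu> / sqrt 2 * z)\<bar> \<le> 1"
      using tanh_real_bounds[of "\<mu> / sqrt 2 * z"] by (simp add: abs_le_iff)
    then have "norm (tanh (\<mu> / sqrt 2 * z) *\<^sub>R velocity) \<le> norm velocity"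
      using mult_right_mono[of "\<bar>tanh (\<mu> / sqrt 2 * z)\<bar>" 1 "norm velocity"] by simp
    then show ?thesis
      unfolding kink_eq_profile kink_profile_def N_def by (intro norm_triangle_le) simp
  qed
  define B where "B = 2 * L * sqrt 5 * N * (L * (M * sqrt 5 * sqrt 5))"
  \<comment> \<open>The factor 4/3 is that of \<open>sech4_integral\<close> with width
    \<open>1/\<epsilon>\<close>: it makes the integral of the bound on the squared rotation term
    exactly \<open>C * \<epsilon>\<close>.\<close>
  define C where "C = B^2 / 4 * (4/3)"
  have "C \<ge> 0" by (simp add: C_def)
  moreover have "\<exists>\<Psi>\<in>admissible ?V (su_conj U1 vac_m) (su_conj U2 vac_p).
      energy ?V \<Psi> \<le> ?\<sigma> + \<eta> * ?\<sigma> + (1 + 1/\<eta>) * (C * \<epsilon>)" if "\<epsilon> > 0" "\<eta> > 0" for \<epsilon> \<eta>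
  proof -
    \<comment> \<open>A slow clock running from 0 to 1. Using \<open>tanh\<close> again lets the
      rotation cost be evaluated by the same integral as the kink energy.\<close>
    define p where "p z = (1 + tanh (\<epsilon> * z)) / 2" for z :: real
    define q where "q z = \<epsilon> / 2 * (1 - (tanh (\<epsilon> * z))^2)" for z :: real
    have pD: "(p has_real_derivative q z) (at z)" for z
      unfolding p_def q_def by (auto intro!: derivative_eq_intros)
    have qc: "continuous_on UNIV q" and pc: "continuous_on UNIV p"
      unfolding p_def q_def by (auto intro!: continuous_intros)
    have p01: "p z \<in> {0..1}" for z using tanh_real_bounds[of "\<epsilon> * z"] by (auto simp: p_def)
    have q0: "0 \<le> q z" for z
      using \<open>\<epsilon> > 0\<close> tanh_real_bounds[of "\<epsilon> * z"] unfolding q_def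
      by (intro mult_nonneg_nonneg) (auto simp: abs_square_le_1 abs_le_iff)
    define G where "G z = g (p z) ** U1" for z
    define G' where "G' z = (q z *\<^sub>R g' (p z)) ** U1" for z
    have Gu: "unitary (G z)" for z unfolding G_def by (intro unitary_mult gu U1)
    have GD: "(G has_vector_derivative G' z) (at z)" for z
    proof -
      have "((g \<circ> p) has_vector_derivative q z *\<^sub>R g' (p z)) (at z)"
        using pD[of z] gD[of "p z"]
        by (intro vector_diff_chain_at) (auto simp: has_real_derivative_iff_has_vector_derivative)
      from has_vector_derivative_matrix_mult[OF this has_vector_derivative_const[of U1]]
      show ?thesis by (simp add: G_def[abs_def] G'_def comp_def)
    qed
    have Gc: "continuous_on UNIV G"
      unfolding G_def by (intro continuous_on_matrix_mult continuous_on_compose2[OF gc pc] continuous_on_const) auto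
    have G'c: "continuous_on UNIV G'"
      unfolding G'_def
      by (intro continuous_on_matrix_mult continuous_on_scaleR qc continuous_on_compose2[OF g'c pc] continuous_on_const) auto
    have kD: "(?k has_vector_derivative ?D z) (at z)" for z
      using kink_deriv[of r \<mu> h lam 0 z] by simp
    have kc: "continuous_on UNIV ?k"
      using kD by (intro continuous_at_imp_continuous_on ballI has_vector_derivative_continuous)
    have Dc: "continuous_on UNIV ?D" by (intro continuous_intros) auto
    define \<Psi> where "\<Psi> z = su_conj (G z) (?k z)" for z
    define X where "X z = su_conj (G z) (?D z)" for z
    define Y where "Y z = dagger (G z) ** ?k z ** G' z + dagger (G' z) ** ?k z ** G z" for z
    have D: "(\<Psi> has_vector_derivative X z + Y z) (at z)" for z
    proof -
      have "((\<lambda>z. dagger (G z) ** ?k z ** G z) has_vector_derivative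
          (dagger (G z) ** ?k z) ** G' z + (dagger (G z) ** ?D z + dagger (G' z) ** ?k z) ** G z) (at z)"
        by (intro has_vector_derivative_matrix_mult has_vector_derivative_dagger GD kD)
      then show ?thesis
        by (simp add: \<Psi>_def[abs_def] su_conj_def X_def Y_def matrix_mult_distribs add_ac)
    qed
    have c: "continuous_on UNIV (\<lambda>z. X z + Y z)"
      unfolding X_def Y_def su_conj_def
      by (intro continuous_on_add continuous_on_matrix_mult continuous_on_dagger Gc G'c kc Dc)
    have h: "\<Psi> z \<in> h0" for z
      unfolding \<Psi>_def kink_eq_profile by (intro su_conj_in_h0 Gu kink_profile_in_h0)
    have v: "?V (\<Psi> z) = k_well^2 * (?s z)^2" for z
      unfolding \<Psi>_def potential_su_conj[OF Gu] kink_eq_profile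
      using potential_kink_profile by simp
    have nX: "(norm (X z))^2 = k_well^2 * (?s z)^2" for z
      unfolding X_def norm_su_conj[OF Gu] by (rule kink_speed)
    have nG': "norm (G' z) \<le> L * (M * sqrt 5 * sqrt 5) * q z" for z
    proof -
      have "norm (G' z) = norm (mat 1 ** (q z *\<^sub>R g' (p z)) ** U1)" by (simp add: G'_def)
      also have "\<dots> \<le> L * (norm (mat 1 :: mat5) * norm (q z *\<^sub>R g' (p z)) * norm U1)" by (rule L)
      also have "\<dots> = L * (norm (g' (p z)) * sqrt 5 * sqrt 5) * q z"
        using q0[of z] by (simp add: norm_unitary U1 unitary_mat_1)
      also have "\<dots> \<le> L * (M * sqrt 5 * sqrt 5) * q z"
        using M p01[of z] q0[of z] L(1) by (intro mult_right_mono mult_left_mono) auto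
      finally show ?thesis .
    qed
    have nY: "norm (Y z) \<le> B * q z" for z
    proof -
      have "norm (Y z) \<le> norm (dagger (G z) ** ?k z ** G' z) + norm (dagger (G' z) ** ?k z ** G z)"
        unfolding Y_def by (rule norm_triangle_ineq)
      also have "\<dots> \<le> L * (norm (dagger (G z)) * norm (?k z) * norm (G' z)) + L * (norm (dagger (G' z)) * norm (?k z) * norm (G z))"
        by (intro add_mono L)
      also have "\<dots> = 2 * L * sqrt 5 * (norm (?k z) * norm (G' z))"
        by (simp add: norm_dagger norm_unitary[OF Gu])
      also have "\<dots> \<le> 2 * L * sqrt 5 * (N * (L * (M * sqrt 5 * sqrt 5) * q z))"
        using kN[of z] nG'[of z] L(1) order_trans[OF norm_ge_zero kN[of z]]
        by (intro mult_left_mono mult_mono) auto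
      finally show ?thesis by (simp add: B_def mult_ac)
    qed
    have nY2: "(norm (Y z))^2 \<le> (C * 3/4) * \<epsilon>^2 * (1 - (tanh (\<epsilon> * (z - 0)))^2)^2" for z
    proof -
      have "(norm (Y z))^2 \<le> (B * q z)^2"
        by (intro power_mono nY) auto
      then show ?thesis
        unfolding C_def q_def by (simp add: power_mult_distrib power_divide)
    qed
    let ?w = "k_well^2"
    let ?b = "\<lambda>z. (1 + \<eta>) * (?w * (?s z)^2) + (1 + 1/\<eta>) * ((C * 3/4) * \<epsilon>^2 * (1 - (tanh (\<epsilon> * (z - 0)))^2)^2)"
    have bd: "(norm (X z + Y z))^2 \<le> ?b z" for z
    proof -
      have "(norm (X z + Y z))^2 \<le> (1 + \<eta>) * (norm (X z))^2 + (1 + 1/\<eta>) * (norm (Y z))^2"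
        by (rule young_norm_sq) fact
      also have "\<dots> \<le> ?b z"
        unfolding nX using nY2[of z] \<open>\<eta> > 0\<close> by (intro add_left_mono mult_left_mono) auto
      finally show ?thesis .
    qed
    note s1 = sech4_integral[OF \<mu>', of 0] and s2 = sech4_integral[OF \<open>\<epsilon> > 0\<close>, of 0]
    have ib: "integrable lborel ?b"
      by (intro Bochner_Integration.integrable_add integrable_mult_right s1(1) s2(1))
    have i1: "integrable lborel (\<lambda>z. (norm (X z + Y z))^2)"
    proof (rule Bochner_Integration.integrable_bound[OF ib])
      have "continuous_on UNIV (\<lambda>z. (norm (X z + Y z))^2)"
        using c by (intro continuous_on_power continuous_on_norm)
      then show "(\<lambda>z. (norm (X z + Y z))^2) \<in> borel_measurable lborel"
        by (simp add: borel_measurable_continuous_onI)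
      show "AE z in lborel. norm ((norm (X z + Y z))^2) \<le> norm (?b z)"
      proof (rule AE_I2)
        fix z
        show "norm ((norm (X z + Y z))^2) \<le> norm (?b z)"
          using order_trans[OF bd[of z] abs_ge_self] by simp
      qed
    qed
    have i2: "integrable lborel (\<lambda>z. ?V (\<Psi> z))"
      unfolding v by (intro integrable_mult_right s1(1))
    have lim: "(\<Psi> \<longlongrightarrow> su_conj U1 vac_m) at_bot" "(\<Psi> \<longlongrightarrow> su_conj U2 vac_p) at_top"
    proof -
      have t: "filterlim (\<lambda>z. \<epsilon> * z) at_bot at_bot" "filterlim (\<lambda>z. \<epsilon> * z) at_top at_top"
        using \<open>\<epsilon> > 0\<close> by real_asymp+
      have "(p \<longlongrightarrow> (1 + -1) / 2) at_bot" "(p \<longlongrightarrow> (1 + 1) / 2) at_top"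
        unfolding p_def
        by (intro tendsto_intros filterlim_compose[OF tanh_real_at_bot t(1)] filterlim_compose[OF tanh_real_at_top t(2)]; simp)+
      then have "((\<lambda>z. g (p z)) \<longlongrightarrow> g 0) at_bot" "((\<lambda>z. g (p z)) \<longlongrightarrow> g 1) at_top"
        using continuous_on_tendsto_compose[OF gc] by auto
      then have "(G \<longlongrightarrow> g 0 ** U1) at_bot" "(G \<longlongrightarrow> g 1 ** U1) at_top"
        unfolding G_def by (intro tendsto_matrix_mult tendsto_const; simp)+
      moreover have "g 0 ** U1 = U1" "g 1 ** U1 = U2"
        using g U1 by (simp_all add: unitary_def flip: matrix_mul_assoc)
      ultimately have Gl: "(G \<longlongrightarrow> U1) at_bot" "(G \<longlongrightarrow> U2) at_top" by simp_all
      show "(\<Psi> \<longlongrightarrow> su_conj U1 vac_m) at_bot" "(\<Psi> \<longlongrightarrow> su_conj U2 vac_p) at_top"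
        unfolding \<Psi>_def su_conj_def using Gl kink_limits[OF \<mu>, of r h lam 0]
        by (intro tendsto_matrix_mult tendsto_dagger; simp)+
    qed
    have adm: "\<Psi> \<in> admissible ?V (su_conj U1 vac_m) (su_conj U2 vac_p)"
      and E: "energy ?V \<Psi> = (LINT z|lborel. (norm (X z + Y z))^2) + (LINT z|lborel. ?V (\<Psi> z))"
      using C1_admissible[OF D c h i1 i2 lim] by blast+
    have "(LINT z|lborel. (norm (X z + Y z))^2) \<le> (LINT z|lborel. ?b z)"
      using i1 ib bd by (intro integral_mono) auto
    also have "\<dots> = (LINT z|lborel. (1 + \<eta>) * (?w * (?s z)^2))
        + (LINT z|lborel. (1 + 1/\<eta>) * ((C * 3/4) * \<epsilon>^2 * (1 - (tanh (\<epsilon> * (z - 0)))^2)^2))"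
      by (intro Bochner_Integration.integral_add integrable_mult_right s1(1) s2(1))
    also have "\<dots> = (1 + \<eta>) * (?\<sigma> / 2) + (1 + 1/\<eta>) * (C * 3/4 * \<epsilon>^2 * (4 / (3 * \<epsilon>)))"
      unfolding integral_mult_right_zero s1(2) s2(2) wall_tension_eq by simp
    also have "C * 3/4 * \<epsilon>^2 * (4 / (3 * \<epsilon>)) = C * \<epsilon>"
      using \<open>\<epsilon> > 0\<close> by (simp add: power2_eq_square)
    finally have "(LINT z|lborel. (norm (X z + Y z))^2) \<le> (1 + \<eta>) * (?\<sigma> / 2) + (1 + 1/\<eta>) * (C * \<epsilon>)" .
    moreover have "(LINT z|lborel. ?V (\<Psi> z)) = ?\<sigma> / 2"
      unfolding v integral_mult_right_zero s1(2) wall_tension_eq by simp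
    moreover have "(1 + \<eta>) * (?\<sigma> / 2) + ?\<sigma> / 2 \<le> ?\<sigma> + \<eta> * ?\<sigma>"
    proof -
      have "0 \<le> ?\<sigma>" unfolding wall_tension_eq using \<mu> by simp
      then have "0 \<le> \<eta> * ?\<sigma>" using \<open>\<eta> > 0\<close> by simp
      then show ?thesis by (simp add: field_simps)
    qed
    ultimately have "energy ?V \<Psi> \<le> ?\<sigma> + \<eta> * ?\<sigma> + (1 + 1/\<eta>) * (C * \<epsilon>)"
      unfolding E by linarith
    then show ?thesis using adm by blast
  qed
  ultimately show ?thesis by blast
qed

lemma near_optimal:
  assumes U: "unitary U1" "unitary U2" and "e > 0"
  shows "\<exists>\<Psi>\<in>admissible pot (su_conj U1 vac_m) (su_conj U2 vac_p).
    energy pot \<Psi> \<le> wall + e"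
proof -
  let ?\<sigma> = "wall"
  obtain C where C: "C \<ge> 0" and *: "\<And>\<epsilon> \<eta>. \<epsilon> > 0 \<Longrightarrow> \<eta> > 0 \<Longrightarrow> \<exists>\<Psi>\<in>admissible pot
      (su_conj U1 vac_m) (su_conj U2 vac_p).
    energy pot \<Psi> \<le> ?\<sigma> + \<eta> * ?\<sigma> + (1 + 1/\<eta>) * (C * \<epsilon>)"
    using rotated_kink[OF U] by blast
  have \<sigma>0: "0 \<le> ?\<sigma>" unfolding wall_tension_eq using \<mu> by simp
  \<comment> \<open>Each of the two error terms gets half of \<open>e\<close>. The factor
    \<open>1 + 1/\<eta>\<close> from Young's inequality forces \<open>\<epsilon>\<close> to be
    chosen after \<open>\<eta>\<close>.\<close>
  define \<eta> where "\<eta> = e / (2 * (?\<sigma> + 1))"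
  define \<epsilon> where "\<epsilon> = e / (2 * (C + 1) * (1 + 1/\<eta>))"
  have \<eta>0: "\<eta> > 0" using \<open>e > 0\<close> \<sigma>0 by (simp add: \<eta>_def)
  then have k: "1 + 1/\<eta> > 0" by (simp add: add_pos_pos)
  then have \<epsilon>0: "\<epsilon> > 0" using \<open>e > 0\<close> C by (simp add: \<epsilon>_def)
  have "\<eta> * ?\<sigma> = e / 2 * (?\<sigma> / (?\<sigma> + 1))" by (simp add: \<eta>_def)
  also have "\<dots> \<le> e / 2 * 1" using \<open>e > 0\<close> \<sigma>0 by (intro mult_left_mono) auto
  finally have 1: "\<eta> * ?\<sigma> \<le> e / 2" by simp
  have "(1 + 1/\<eta>) * (C * \<epsilon>) = e / 2 * (C / (C + 1))"
    using k C by (simp add: \<epsilon>_def)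
  also have "\<dots> \<le> e / 2 * 1" using \<open>e > 0\<close> C by (intro mult_left_mono) auto
  finally have 2: "(1 + 1/\<eta>) * (C * \<epsilon>) \<le> e / 2" by simp
  from *[OF \<epsilon>0 \<eta>0] obtain \<Psi> where "\<Psi> \<in> admissible pot
      (su_conj U1 vac_m) (su_conj U2 vac_p)"
    "energy pot \<Psi> \<le> ?\<sigma> + \<eta> * ?\<sigma> + (1 + 1/\<eta>) * (C * \<epsilon>)" by blast
  moreover from this 1 2 have "energy pot \<Psi> \<le> ?\<sigma> + e" by linarith
  ultimately show ?thesis by blast
qed

end

section \<open>The two vacuum orbits\<close>

lemma mat_1_SU5: "mat 1 \<in> SU5"
  by (simp add: SU5_def)

lemma order_lipschitz_pos: "order_lipschitz r > 0"
  by (cases r) simp_all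

text \<open>Beyond \<open>order_bound\<close> the function \<open>speed\<close> would become
  negative. Clamping keeps the Lipschitz constant and the values at the vacua.\<close>

definition clamped_param :: "regime \<Rightarrow> real \<Rightarrow> real \<Rightarrow> real \<Rightarrow> mat5 \<Rightarrow> real" where
  "clamped_param r \<mu> h lam \<Phi> = max (- order_bound r \<mu> h lam) (min (order_bound r \<mu> h lam) (order_param r \<Phi>))"

context regime_parameters
begin

abbreviation "clamped \<equiv> clamped_param r \<mu> h lam"

lemma order_bound_pos: "w_max > 0"
  and well_scale_pos: "k_well > 0"
  and vac_scale_pos: "vac_scale r \<mu> h lam > 0"
  using reg \<mu> by (cases r; simp)+

lemma order_param_vac_plus:
  assumes "unitary U"
  shows "order_param r (su_conj U vac_p) = - w_max"
proof -
  have "decreasing5 (\<lambda>i. vac_scale r \<mu> h lam * vector (plus_entries r) $ i)"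
    using vac_scale_pos by (cases r) (simp_all add: decreasing5_def del: vac_scale.simps)
  from eigenvalues_unique[OF assms this] show ?thesis
    unfolding vac_diag by (cases r) simp_all
qed

lemma order_param_vac_minus:
  assumes "unitary U"
  shows "order_param r (su_conj U vac_m) = w_max"
proof -
  \<comment> \<open>A transposition that sorts the entries of the minus vacuum.\<close>
  define q :: "5 \<Rightarrow> 5" where "q = (case r of
    A_type \<Rightarrow> (\<lambda>i. if i = 3 then 5 else if i = 5 then 3 else i)
  | B_type \<Rightarrow> (\<lambda>i. if i = 1 then 4 else if i = 4 then 1 else i))"
  have "q (q i) = i" for i by (cases r) (simp_all add: q_def)
  then have b: "bij q" by (rule involuntory_imp_bij)
  have "decreasing5 (\<lambda>i. vac_scale r \<mu> h lam * vector (minus_entries r) $ q i)"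
    using vac_scale_pos by (cases r) (simp_all add: decreasing5_def q_def del: vac_scale.simps)
  from eigenvalues_permuted[OF assms b this] show ?thesis
    unfolding vac_diag by (cases r) (simp_all add: q_def)
qed

lemma calibration_potential:
  "calibration pot (clamped) (order_lipschitz r)
    w_max k_well"
proof
  let ?w = "w_max"
  note w = order_bound_pos
  show "order_lipschitz r > 0" "?w > 0" "k_well > 0"
    using order_lipschitz_pos w well_scale_pos by blast+
  show "\<bar>clamped P\<bar> \<le> ?w" for P
    using w by (auto simp: clamped_param_def)
  show "\<bar>clamped P - clamped Q\<bar> \<le> order_lipschitz r * norm (P - Q)"
    if "P \<in> h0" "Q \<in> h0" for P Q
    using order_param_lipschitz[OF that, of r] unfolding clamped_param_def by linarith
  show "(k_well * (1 - (clamped P / ?w)^2))^2 \<le> pot P"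
    if "P \<in> h0" for P
  proof -
    note V = potential_ge_order_param[OF reg \<mu> that]
    \<comment> \<open>If the clamp is active, the left-hand side of the goal is 0, and the unclamped
      bound still gives a nonnegative potential.\<close>
    have "clamped P \<in> {order_param r P, ?w, - ?w}"
      by (simp add: clamped_param_def max_def min_def)
    then show ?thesis
      using V w order_trans[OF zero_le_power2 V] by (auto simp: power_divide)
  qed
qed

text \<open>The left side is the calibrated lower bound, the right side the energy of the explicit
  kink; their agreement makes the calibration sharp.\<close>

lemma tension_eq_wall_tension:
  "8 * k_well * w_max / (3 * order_lipschitz r) = wall"
proof (cases r)
  case A_type
  then have "lam > 0" using reg by simp
  have *: "sqrt (4/5) = 2 / sqrt (5::real)" by (simp add: real_sqrt_divide)
  show ?thesis
    using \<open>lam > 0\<close> unfolding A_type order_lipschitz.simps *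
    by (simp add: real_sqrt_mult field_simps power2_eq_square power3_eq_cube)
next
  case B_type
  then have "h > 0" using reg by simp
  have *: "sqrt (27/80) = 3 / (4 * sqrt 2) * sqrt (6/5 :: real)"
  proof -
    have "27/80 = (3/4)^2 * ((6/5) / (2::real))" by (simp add: power2_eq_square)
    then have "sqrt (27/80) = sqrt ((3/4)^2) * (sqrt (6/5) / sqrt 2)"
      by (simp only: real_sqrt_mult real_sqrt_divide)
    then show ?thesis by simp
  qed
  show ?thesis
    using \<open>h > 0\<close> unfolding B_type well_scale.simps *
    by (simp add: field_simps power2_eq_square power3_eq_cube)
qed

text \<open>The segment between the two vacua has the direction in which the order parameter changes
  fastest, so the lower bound that the Lipschitz constant imposes on the distance of the orbits is
  attained here.\<close>

lemma norm_vac_diff: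
  "norm (vac_p - vac_m) = 2 * w_max / order_lipschitz r"
proof -
  let ?N = "velocity"
  have "vac_p - vac_m = 2 *\<^sub>R ?N"
    unfolding kink_profile_ends[symmetric] kink_profile_def by (simp add: scaleR_2)
  then have "(norm (vac_p - vac_m))^2 = 4 * (norm ?N)^2"
    by (simp add: power_mult_distrib)
  also have "\<dots> = (2 * w_max / order_lipschitz r)^2"
  proof -
    have "(norm ?N)^2 = 2 * k_well^2 / \<mu>^2"
      using norm_kink_velocity \<mu> by (simp add: power_divide field_simps)
    then show ?thesis
      unfolding well_scale_sq using reg \<mu>
      by (cases r) (simp_all add: power_divide power_mult_distrib field_simps power2_eq_square power4_eq_xxxx)
  qed
  finally show ?thesis
    by (rule power2_eq_imp_eq) (use order_bound_pos order_lipschitz_pos[of r] in auto)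
qed

lemma dist_orbits_ge:
  assumes U: "unitary U1" "unitary U2"
  shows "2 * w_max / order_lipschitz r \<le>
    norm (su_conj U1 vac_m - su_conj U2 vac_p)"
  using order_param_lipschitz[OF su_conj_in_h0[OF U(1) vac_in_h0(2)[of r \<mu> h lam]]
      su_conj_in_h0[OF U(2) vac_in_h0(1)[of r \<mu> h lam]], of r]
    order_param_vac_minus[OF U(1)] order_param_vac_plus[OF U(2)] order_lipschitz_pos[of r]
    order_bound_pos
  by (simp add: pos_divide_le_eq mult.commute)

lemma frob_orbit_diff:
  assumes "U1 \<in> SU5" "U2 \<in> SU5"
  shows "frob (su_conj U1 vac_m - su_conj U2 vac_p) =
    norm (su_conj U1 vac_m - su_conj U2 vac_p)"
    and "frob (su_conj U2 vac_p - su_conj U1 vac_m) =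
    norm (su_conj U2 vac_p - su_conj U1 vac_m)"
proof -
  have "dagger vac_m = vac_m" "dagger vac_p = vac_p"
    using vac_in_h0 by (auto simp: h0_def)
  then show "frob (su_conj U1 vac_m - su_conj U2 vac_p) =
      norm (su_conj U1 vac_m - su_conj U2 vac_p)"
    "frob (su_conj U2 vac_p - su_conj U1 vac_m) =
      norm (su_conj U2 vac_p - su_conj U1 vac_m)"
    by (simp_all add: frob_eq_norm dagger_diff dagger_su_conj)
qed

lemma min_dist_eq:
  "min_dist r \<mu> h lam = 2 * w_max / order_lipschitz r"
  unfolding min_dist_def
proof (rule Least_equality)
  have "vac_m \<in> orbit_minus r \<mu> h lam" "vac_p \<in> orbit_plus r \<mu> h lam"
    unfolding orbit_minus_def orbit_plus_def using image_eqI[OF _ mat_1_SU5] su_conj_mat_1 by metis+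
  moreover have "2 * w_max / order_lipschitz r = frob (vac_m - vac_p)"
    using frob_orbit_diff(1)[OF mat_1_SU5 mat_1_SU5] norm_vac_diff
    by (simp add: norm_minus_commute)
  ultimately show "\<exists>P\<in>orbit_minus r \<mu> h lam. \<exists>Q\<in>orbit_plus r \<mu> h lam.
      2 * w_max / order_lipschitz r = frob (P - Q)"
    by blast
next
  fix d assume "\<exists>P\<in>orbit_minus r \<mu> h lam. \<exists>Q\<in>orbit_plus r \<mu> h lam. d = frob (P - Q)"
  then obtain U1 U2 where U: "U1 \<in> SU5" "U2 \<in> SU5"
    and d: "d = frob (su_conj U1 vac_m - su_conj U2 vac_p)"
    by (auto simp: orbit_minus_def orbit_plus_def)
  show "2 * w_max / order_lipschitz r \<le> d"
    unfolding d frob_orbit_diff(1)[OF U] using U by (intro dist_orbits_ge SU5_unitary)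
qed

end

section \<open>Pairs of vacua at minimal distance\<close>

lemma unitary_rows:
  "unitary U \<longleftrightarrow> (\<forall>i j. (\<Sum>k\<in>UNIV. U $ i $ k * cnj (U $ j $ k)) = (if i = j then 1 else 0))"
proof -
  have "unitary U \<longleftrightarrow> U ** dagger U = mat 1"
    using unitaryI by (auto simp: unitary_def)
  then show ?thesis
    by (simp add: vec_eq_iff matrix_matrix_mult_def mat_def)
qed

lemma det_dagger: "det (dagger A) = cnj (det A)"
proof -
  have "dagger A = transpose (\<chi> i j. cnj (A $ i $ j))"
    by (simp add: vec_eq_iff transpose_def)
  then have "det (dagger A) = det (\<chi> i j. cnj (A $ i $ j))"
    by (simp add: det_transpose)
  also have "\<dots> = cnj (det A)"
    by (simp add: det_def)
  finally show ?thesis .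
qed

text \<open>Multiplying row \<open>m\<close> by the conjugate of the determinant, a phase, keeps the
  rows orthonormal and makes the determinant 1.\<close>

lemma unitary_rescale_to_SU5:
  assumes U: "unitary U"
  shows "\<exists>V\<in>SU5. \<forall>i. i \<noteq> m \<longrightarrow> V $ i = U $ i"
proof -
  define d where "d = cnj (det U)"
  have dd: "d * det U = 1"
  proof -
    have "det (dagger U ** U) = 1" using U by (simp add: unitary_def)
    then show ?thesis by (simp add: d_def det_mul det_dagger)
  qed
  then have dd': "d * cnj d = 1" by (simp add: d_def mult.commute)
  define V :: mat5 where "V = (\<chi> i. if i = m then d *s U $ i else U $ i)"
  have Vn: "V $ i $ k = (if i = m then d else 1) * U $ i $ k" for i k
    by (simp add: V_def)
  have "(\<Sum>k\<in>UNIV. V $ i $ k * cnj (V $ j $ k)) =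
      (if i = m then d else 1) * cnj (if j = m then d else 1) * (\<Sum>k\<in>UNIV. U $ i $ k * cnj (U $ j $ k))" for i j
    unfolding Vn sum_distrib_left by (rule sum.cong) (simp_all add: mult_ac)
  then have "unitary V"
    unfolding unitary_rows using U[unfolded unitary_rows] dd' by auto
  moreover have "det V = 1"
  proof -
    have "det V = d * det (\<chi> i. if i = m then U $ i else U $ i)"
      unfolding V_def by (rule det_row_mul)
    also have "(\<chi> i. if i = m then U $ i else U $ i) = U" by (simp add: vec_eq_iff)
    finally show ?thesis using dd by simp
  qed
  ultimately have "V \<in> SU5" by (simp add: SU5_def unitary_def)
  then show ?thesis by (intro bexI[of _ V]) (auto simp: V_def)
qed

text \<open>The prescribed rows of \<open>U2\<close> and of \<open>U1\<close> form one orthonormal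
  family because of the vanishing overlaps. It is completed to a basis, and the free row
  \<open>m\<close> absorbs the determinant.\<close>

lemma common_unitary:
  assumes U1: "unitary U1" and U2: "unitary U2" and disj: "I \<inter> J = {}" "m \<notin> I \<union> J"
    and orth: "\<And>i j. i \<in> I \<Longrightarrow> j \<in> J \<Longrightarrow> (U1 ** dagger U2) $ j $ i = 0"
  shows "\<exists>U\<in>SU5. (\<forall>i\<in>I. U $ i = U2 $ i) \<and> (\<forall>j\<in>J. U $ j = U1 $ j)"
proof -
  define R where "R i = (if i \<in> I then U2 $ i else U1 $ i)" for i
  define u where "u i = (\<chi> k. cnj (R i $ k))" for i
  have o: "(\<Sum>k\<in>UNIV. U1 $ j $ k * cnj (U2 $ i $ k)) = 0" if "i \<in> I" "j \<in> J" for i j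
    using orth[OF that] by (simp add: matrix_matrix_mult_def)
  have o': "(\<Sum>k\<in>UNIV. U2 $ i $ k * cnj (U1 $ j $ k)) = 0" if "i \<in> I" "j \<in> J" for i j
    using arg_cong[OF o[OF that], of cnj] by (simp add: mult.commute)
  have "cinner (u i) (u j) = (\<Sum>k\<in>UNIV. R i $ k * cnj (R j $ k))" for i j
    by (simp add: cinner_def u_def)
  then have "cinner (u i) (u j) = (if i = j then 1 else 0)" if "i \<in> I \<union> J" "j \<in> I \<union> J" for i j
    using that disj o o' U1[unfolded unitary_rows] U2[unfolded unitary_rows] by (auto simp: R_def)
  then obtain W where W: "joined_to_1 W" "\<forall>j\<in>I \<union> J. W *v axis j 1 = u j"
    using orthonormal_extension[of "I \<union> J" u] by blast
  have uW: "unitary (dagger W)" using W joined_to_1_unitary unitary_dagger by blast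
  have "dagger W $ i = R i" if "i \<in> I \<union> J" for i
  proof -
    have "W $ k $ i = cnj (R i $ k)" for k
      using W(2) that mult_axis[of W i k] by (simp add: u_def)
    then show ?thesis by (simp add: vec_eq_iff)
  qed
  moreover obtain V where "V \<in> SU5" "\<And>i. i \<noteq> m \<Longrightarrow> V $ i = dagger W $ i"
    using unitary_rescale_to_SU5[OF uW, of m] by blast
  ultimately have "V \<in> SU5" "\<And>i. i \<in> I \<union> J \<Longrightarrow> V $ i = R i"
    using disj(2) by metis+
  then show ?thesis
    using disj(1) by (intro bexI[of _ V]) (auto simp: R_def)
qed

lemma su_conj_diag_mat_nth:
  "su_conj U (diag_mat x) $ a $ b = (\<Sum>i\<in>UNIV. x i * (cnj (U $ i $ a) * U $ i $ b))"
  unfolding su_conj_def matrix_mul_assoc[symmetric]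
  by (simp add: matrix_matrix_mult_def[of "dagger U"] diag_mat_mult_nth mult_ac)

text \<open>The rows belonging to one of the eigenvalues are irrelevant, since they span the orthogonal
  complement of the others.\<close>

lemma su_conj_diag_mat_cong:
  assumes U: "unitary U" and V: "unitary V" and eq: "\<And>i. x i \<noteq> \<alpha> \<Longrightarrow> U $ i = V $ i"
  shows "su_conj U (diag_mat x) = su_conj V (diag_mat x)"
proof -
  have m: "mat 1 = diag_mat (\<lambda>_. 1)" by (simp add: vec_eq_iff mat_def diag_mat_nth)
  have d: "diag_mat x = \<alpha> *\<^sub>R mat 1 + diag_mat (\<lambda>i. x i - \<alpha>)"
    unfolding m diag_mat_scaleR diag_mat_add by simp
  have "complex_of_real (x i - \<alpha>) * (cnj (U $ i $ a) * U $ i $ b) =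
      complex_of_real (x i - \<alpha>) * (cnj (V $ i $ a) * V $ i $ b)" for i a b
    using eq[of i] by (cases "x i = \<alpha>") auto
  then have "su_conj U (diag_mat (\<lambda>i. x i - \<alpha>)) = su_conj V (diag_mat (\<lambda>i. x i - \<alpha>))"
    unfolding vec_eq_iff su_conj_diag_mat_nth by presburger
  then show ?thesis
    unfolding d su_conj_add su_conj_scaleR by (simp add: su_conj_id U V)
qed

context regime_parameters
begin

text \<open>At minimal distance the inner product of the pair equals that of the diagonal vacua. As
  each vacuum has only two eigenvalues, this product is a constant plus or minus a multiple of the
  overlap weights between the two exceptional eigenspaces.\<close>

lemma minimal_distance_orthogonal:
  assumes U1: "unitary U1" and U2: "unitary U2"
    and dist: "norm (su_conj U2 vac_p - su_conj U1 vac_m) = 2 * w_max / order_lipschitz r"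
    and i: "i \<in> (case r of A_type \<Rightarrow> {1, 2} | B_type \<Rightarrow> {5})"
    and j: "j \<in> (case r of A_type \<Rightarrow> {3, 4} | B_type \<Rightarrow> {4})"
  shows "(U1 ** dagger U2) $ j $ i = 0"
proof -
  define p where "p i j = (cmod ((U1 ** dagger U2) $ j $ i))^2" for i j
  define s where "s = vac_scale r \<mu> h lam"
  define x y where "x = (vector (plus_entries r) :: real^5)" and "y = (vector (minus_entries r) :: real^5)"
  have s: "s > 0" using vac_scale_pos by (simp add: s_def)
  have sq: "(norm (X - Y))^2 = (norm X)^2 + (norm Y)^2 - 2 * (X \<bullet> Y)" for X Y :: mat5
    by (simp add: power2_norm_eq_inner inner_diff_left inner_diff_right inner_commute)
  have "norm (su_conj U2 vac_p - su_conj U1 vac_m) = norm (vac_p - vac_m)"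
    using dist norm_vac_diff by simp
  then have "(norm (su_conj U2 vac_p - su_conj U1 vac_m))^2 = (norm (vac_p - vac_m))^2" by simp
  then have in_eq: "su_conj U2 vac_p \<bullet> su_conj U1 vac_m = vac_p \<bullet> vac_m"
    unfolding sq norm_su_conj[OF U1] norm_su_conj[OF U2] by simp
  have inner_diag: "diag_mat x \<bullet> diag_mat y = (\<Sum>i\<in>UNIV. x i * y i)" for x y
    by (simp add: inner_hermitian diag_mat_mult rtrace_diag_mat)
  note ds = doubly_stochastic_overlap[OF U2 U1]
  have p0: "p i j \<ge> 0" for i j by (simp add: p_def)
  have rows: "p i 1 + p i 2 + p i 3 + p i 4 + p i 5 = 1" and cols: "p 1 j + p 2 j + p 3 j + p 4 j + p 5 j = 1" for i j
    using ds[of i] ds[of j] by (simp_all add: p_def sum_5)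
  have "s^2 * (\<Sum>i\<in>UNIV. x $ i * (\<Sum>j\<in>UNIV. p i j * y $ j)) = s^2 * (\<Sum>i\<in>UNIV. x $ i * y $ i)"
    using in_eq unfolding vac_diag s_def[symmetric] x_def[symmetric] y_def[symmetric]
      inner_su_conj_diag[OF U2 U1] inner_diag p_def[symmetric]
    by (simp add: sum_distrib_left power2_eq_square mult_ac)
  then have lin: "(\<Sum>i\<in>UNIV. x $ i * (\<Sum>j\<in>UNIV. p i j * y $ j)) = (\<Sum>i\<in>UNIV. x $ i * y $ i)"
    using s by simp
  note stoch = rows[of 1] rows[of 2] rows[of 3] rows[of 4] rows[of 5]
    cols[of 1] cols[of 2] cols[of 3] cols[of 4] cols[of 5]
  have "p i j = 0"
  proof (cases r)
    case A_type
    \<comment> \<open>Here the entries are \<open>5 * 1_I - 2\<close> and \<open>2 - 5 * 1_J\<close>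
      with the indicators of \<open>I = {1, 2}\<close> and \<open>J = {3, 4}\<close>. Row and column
      sums fix everything but the overlap of \<open>I\<close> with \<open>J\<close>, which is 0 for
      the diagonal pair.\<close>
    then have "p 1 3 + p 1 4 + p 2 3 + p 2 4 = 0"
      using lin stoch by (simp add: sum_5 x_def y_def algebra_simps)
    then show ?thesis
      using i j p0[of 1 3] p0[of 1 4] p0[of 2 3] p0[of 2 4] by (auto simp: A_type)
  next
    case B_type
    then have "p 5 4 = 0"
      using lin stoch by (simp add: sum_5 x_def y_def algebra_simps)
    then show ?thesis using i j by (auto simp: B_type)
  qed
  then show ?thesis by (simp add: p_def)
qed

lemma simultaneous_conjugation:
  assumes U1: "unitary U1" and U2: "unitary U2"
    and dist: "norm (su_conj U2 vac_p - su_conj U1 vac_m) = 2 * w_max / order_lipschitz r"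
  shows "\<exists>U\<in>SU5. su_conj U1 vac_m = su_conj U vac_m \<and> su_conj U2 vac_p = su_conj U vac_p"
proof -
  \<comment> \<open>\<open>I\<close> and \<open>J\<close> mark the less frequent eigenvalue of the
    plus and of the minus vacuum. At the index \<open>m\<close> both have their more frequent one,
    so its row is free to adjust the determinant.\<close>
  define I :: "5 set" where "I = (case r of A_type \<Rightarrow> {1, 2} | B_type \<Rightarrow> {5})"
  define J :: "5 set" where "J = (case r of A_type \<Rightarrow> {3, 4} | B_type \<Rightarrow> {4})"
  define m :: 5 where "m = (case r of A_type \<Rightarrow> 5 | B_type \<Rightarrow> 1)"
  have "I \<inter> J = {}" "m \<notin> I \<union> J" by (cases r; simp add: I_def J_def m_def)+
  moreover have "(U1 ** dagger U2) $ j $ i = 0" if "i \<in> I" "j \<in> J" for i j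
    using minimal_distance_orthogonal[OF U1 U2 dist] that unfolding I_def J_def by blast
  ultimately obtain U where U: "U \<in> SU5" "\<And>i. i \<in> I \<Longrightarrow> U $ i = U2 $ i" "\<And>j. j \<in> J \<Longrightarrow> U $ j = U1 $ j"
    using common_unitary[OF U1 U2, of I J m] by blast
  have uU: "unitary U" using U SU5_unitary by blast
  have off: "i \<in> J \<or> vector (minus_entries r) $ i = (vector (minus_entries r) :: real^5) $ m"
    "i \<in> I \<or> vector (plus_entries r) $ i = (vector (plus_entries r) :: real^5) $ m" for i
    using exhaust_5[of i] by (cases r; auto simp: I_def J_def m_def)+
  have "su_conj U1 vac_m = su_conj U vac_m"
    unfolding vac_diag
    by (rule su_conj_diag_mat_cong[OF U1 uU, where \<alpha>="vac_scale r \<mu> h lam * vector (minus_entries r) $ m"])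
      (use off(1) U(3) in metis)
  moreover have "su_conj U2 vac_p = su_conj U vac_p"
    unfolding vac_diag
    by (rule su_conj_diag_mat_cong[OF U2 uU, where \<alpha>="vac_scale r \<mu> h lam * vector (plus_entries r) $ m"])
      (use off(2) U(2) in metis)
  ultimately show ?thesis using U by blast
qed

end

theorem theorem7:
  fixes r :: regime and \<mu> h lam V0 :: real and Am Ap :: mat5
  assumes "\<mu> > 0"
    and "in_regime r \<mu> h lam V0"
    and "Am \<in> orbit_minus r \<mu> h lam"
    and "Ap \<in> orbit_plus r \<mu> h lam"
  shows "let V = potential \<mu> h lam V0 in
    (INF \<Psi>\<in>admissible V Am Ap. ereal (energy V \<Psi>)) = ereal (wall_tension r \<mu> h lam)
    \<and> ((\<exists>\<Psi>. minimizer V Am Ap \<Psi>) \<longleftrightarrow> frob (Ap - Am) = min_dist r \<mu> h lam)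
    \<and> (frob (Ap - Am) = min_dist r \<mu> h lam \<longrightarrow>
        (\<exists>U\<in>SU5. Am = su_conj U (vac_minus r \<mu> h lam) \<and> Ap = su_conj U (vac_plus r \<mu> h lam) \<and>
          (\<forall>z0. minimizer V Am Ap (\<lambda>z. su_conj U (kink r \<mu> h lam (z - z0))))))
    \<and> (frob (Ap - Am) > min_dist r \<mu> h lam \<longrightarrow> \<not> (\<exists>\<Psi>. minimizer V Am Ap \<Psi>))"
proof -
  interpret regime_parameters r \<mu> h lam V0 by unfold_locales (rule assms)+
  define V where "V = pot"
  define \<sigma> where "\<sigma> = wall"
  obtain U1 U2 where U: "U1 \<in> SU5" "U2 \<in> SU5"
    and Am: "Am = su_conj U1 vac_m" and Ap: "Ap = su_conj U2 vac_p"
    using assms(3,4) by (auto simp: orbit_minus_def orbit_plus_def)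
  have u: "unitary U1" "unitary U2" using U SU5_unitary by auto
  have A_h0: "Am \<in> h0" "Ap \<in> h0"
    unfolding Am Ap by (intro su_conj_in_h0 u vac_in_h0)+
  interpret calibration V clamped "order_lipschitz r" w_max k_well
    unfolding V_def by (rule calibration_potential)
  have W: "clamped Am = w_max" "clamped Ap = - w_max"
    using order_param_vac_minus[OF u(1)] order_param_vac_plus[OF u(2)] w0_pos
    by (simp_all add: clamped_param_def Am Ap)
  have T: "tension = \<sigma>"
    unfolding tension_def \<sigma>_def using tension_eq_wall_tension by simp
  have ge: "\<sigma> \<le> energy V \<Psi>" if "\<Psi> \<in> admissible V Am Ap" for \<Psi>
    using energy_ge_tension[OF that A_h0(1) W(1) A_h0(2) W(2)] T by simp
  have near: "\<exists>\<Psi>\<in>admissible V Am Ap. energy V \<Psi> \<le> \<sigma> + e" if "e > 0" for e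
    using near_optimal[OF u that] by (simp add: V_def \<sigma>_def Am Ap)
  have dist: "frob (Ap - Am) = norm (Ap - Am)"
    unfolding Am Ap by (rule frob_orbit_diff(2)[OF U])
  have md: "min_dist r \<mu> h lam = 2 * w_max / order_lipschitz r"
    by (rule min_dist_eq)
  have dge: "2 * w_max / order_lipschitz r \<le> norm (Ap - Am)"
    using dist_orbits_ge[OF u] by (simp add: Am Ap norm_minus_commute)
  have inf: "(INF \<Psi>\<in>admissible V Am Ap. ereal (energy V \<Psi>)) = ereal \<sigma>"
  proof (rule antisym)
    show "(INF \<Psi>\<in>admissible V Am Ap. ereal (energy V \<Psi>)) \<le> ereal \<sigma>"
    proof (rule ereal_le_epsilon2)
      fix e :: real assume "e > 0"
      then obtain \<Psi> where "\<Psi> \<in> admissible V Am Ap" "energy V \<Psi> \<le> \<sigma> + e" using near by blast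
      then show "(INF \<Psi>\<in>admissible V Am Ap. ereal (energy V \<Psi>)) \<le> ereal \<sigma> + ereal e"
        by (intro INF_lower2) auto
    qed
    show "ereal \<sigma> \<le> (INF \<Psi>\<in>admissible V Am Ap. ereal (energy V \<Psi>))"
      by (intro INF_greatest) (simp add: ge)
  qed
  have attained: "\<exists>U\<in>SU5. Am = su_conj U vac_m \<and> Ap = su_conj U vac_p \<and>
      (\<forall>z0. minimizer V Am Ap (\<lambda>z. su_conj U (kink r \<mu> h lam (z - z0))))"
    if "frob (Ap - Am) = min_dist r \<mu> h lam"
  proof -
    have "norm (Ap - Am) = 2 * w_max / order_lipschitz r"
      using that by (simp only: dist md)
    from simultaneous_conjugation[OF u this[unfolded Am Ap]]
    obtain W where W: "W \<in> SU5" "Am = su_conj W vac_m" "Ap = su_conj W vac_p"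
      unfolding Am Ap by blast
    have "minimizer V Am Ap (\<lambda>z. su_conj W (kink r \<mu> h lam (z - z0)))" for z0
      unfolding minimizer_def
      using conjugated_kink_admissible[OF SU5_unitary[OF W(1)], of z0] ge
      by (auto simp: V_def[symmetric] \<sigma>_def W(2,3)[symmetric])
    then show ?thesis using W by blast
  qed
  \<comment> \<open>The near-optimal competitors force any minimizer down to energy
    \<open>\<sigma>\<close>, so the equality case bounds the distance from above; the reverse bound
    holds for every pair.\<close>
  have close: "frob (Ap - Am) = min_dist r \<mu> h lam" if "minimizer V Am Ap \<Psi>" for \<Psi>
  proof -
    have a: "\<Psi> \<in> admissible V Am Ap" using that by (simp add: minimizer_def)
    have "energy V \<Psi> \<le> \<sigma>"
    proof (rule field_le_epsilon)
      fix e :: real assume "e > 0"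
      then show "energy V \<Psi> \<le> \<sigma> + e"
        using near that unfolding minimizer_def by (meson order_trans)
    qed
    then have "energy V \<Psi> = tension" using ge[OF a] T by simp
    from optimal_endpoints_dist[OF a A_h0(1) W(1) A_h0(2) W(2) this] show ?thesis
      using dge unfolding dist md by simp
  qed
  show ?thesis
    unfolding V_def[symmetric] \<sigma>_def[symmetric] Let_def
  proof (intro conjI impI)
    show "(\<exists>\<Psi>. minimizer V Am Ap \<Psi>) \<longleftrightarrow> frob (Ap - Am) = min_dist r \<mu> h lam"
      using attained close by blast
    show "\<not> (\<exists>\<Psi>. minimizer V Am Ap \<Psi>)" if "min_dist r \<mu> h lam < frob (Ap - Am)"
      using that close by force
  qed (use inf attained in blast)+
qed

end
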